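(* For every formed space $E$ and every $U\in\mathcal{P}^\omega(E)$, the poset $\mathcal{P}^\omega(E,U)$ is Cohen–Macaulay.
   Context: Formed spaces over a field $\mathbb{F}$ with involution $\sigma$ ($\bar c=\sigma(c)$), $\varepsilon$ ($\varepsilon\bar\varepsilon=1$) and additive subgroup $\Lambda$ with $\{c-\varepsilon\bar c\}\le\Lambda\le\{c:c+\varepsilon\bar c=0\}$: a form on a finite-dimensional $E$ is a sesquilinear $f$ ($f(av,bw)=\bar af(v,w)b$) modulo those with $f(v,v)\in\Lambda$, $f(w,v)=-\varepsilon\overline{f(v,w)}$. $\omega_q(v,w)=q(v,w)+\varepsilon\overline{q(w,v)}$, $Q_q(v)=q(v,v)+\Lambda$; $K(E)=\{v:\omega_q(E,v)=0\}$, radical $R(E)=\{v\in K(E):Q_q(v)=0\}$; $U^\perp=\{v:\omega_q(v,U)=0\}$; isotropic means $\omega_q,Q_q$ vanish on the subspace. $\mathcal{P}^\omega(E)$ is the poset (inclusion) of isotropic $W$ with $R(E)<W<E$, and $\mathcal{P}^\omega(E,U)=\{W\in\mathcal{P}^\omega(E):W+U^\perp=E\}$. A graded poset is Cohen–Macaulay if for all $-\infty\le x\le y\le\infty$ the interval $(x,y)=\{z:x<z<y\}$ has $(\dim(x,y)-1)$-connected realization, $\dim$ being maximal chain length. *)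

theory Defs
  imports "HOL-Analysis.Analysis"
begin

definition form_parameters :: "('k::field \<Rightarrow> 'k) \<Rightarrow> 'k \<Rightarrow> 'k set \<Rightarrow> bool" where
  "form_parameters \<sigma> \<epsilon> \<Lambda> \<longleftrightarrow>
     (\<forall>a b. \<sigma> (a + b) = \<sigma> a + \<sigma> b) \<and> (\<forall>a b. \<sigma> (a * b) = \<sigma> a * \<sigma> b) \<and>
     \<sigma> 1 = 1 \<and> (\<forall>a. \<sigma> (\<sigma> a) = a) \<and>
     \<epsilon> * \<sigma> \<epsilon> = 1 \<and>
     0 \<in> \<Lambda> \<and> (\<forall>a\<in>\<Lambda>. \<forall>b\<in>\<Lambda>. a + b \<in> \<Lambda>) \<and> (\<forall>a\<in>\<Lambda>. - a \<in> \<Lambda>) \<and>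
     {c - \<epsilon> * \<sigma> c | c. True} \<subseteq> \<Lambda> \<and> \<Lambda> \<subseteq> {c. c + \<epsilon> * \<sigma> c = 0}"

definition sesquilinear ::
  "('k::field \<Rightarrow> 'k) \<Rightarrow> ('k \<Rightarrow> 'v::ab_group_add \<Rightarrow> 'v) \<Rightarrow> ('v \<Rightarrow> 'v \<Rightarrow> 'k) \<Rightarrow> bool" where
  "sesquilinear \<sigma> smul f \<longleftrightarrow>
     (\<forall>v v' w. f (v + v') w = f v w + f v' w) \<and>
     (\<forall>v w w'. f v (w + w') = f v w + f v w') \<and>
     (\<forall>a b v w. f (smul a v) (smul b w) = \<sigma> a * f v w * b)"

text \<open>A formed space: a finite-dimensional vector space (the whole type 'v, with
scalar multiplication smul) together with a form, represented by a sesquilinear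
representative q of its class (all notions below only depend on the class).\<close>

definition formed_space ::
  "('k::field \<Rightarrow> 'k) \<Rightarrow> 'k \<Rightarrow> 'k set \<Rightarrow> ('k \<Rightarrow> 'v::ab_group_add \<Rightarrow> 'v) \<Rightarrow> ('v \<Rightarrow> 'v \<Rightarrow> 'k) \<Rightarrow> bool" where
  "formed_space \<sigma> \<epsilon> \<Lambda> smul q \<longleftrightarrow>
     form_parameters \<sigma> \<epsilon> \<Lambda> \<and> vector_space smul \<and>
     (\<exists>B. finite B \<and> module.span smul B = UNIV) \<and>
     sesquilinear \<sigma> smul q"

definition omega_form :: "('k::field \<Rightarrow> 'k) \<Rightarrow> 'k \<Rightarrow> ('v \<Rightarrow> 'v \<Rightarrow> 'k) \<Rightarrow> 'v \<Rightarrow> 'v \<Rightarrow> 'k" where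
  "omega_form \<sigma> \<epsilon> q v w = q v w + \<epsilon> * \<sigma> (q w v)"

text \<open>Q_q(v) = q(v,v) + Lambda vanishes iff q(v,v) lies in Lambda.\<close>

definition Q_zero :: "'k set \<Rightarrow> ('v \<Rightarrow> 'v \<Rightarrow> 'k) \<Rightarrow> 'v \<Rightarrow> bool" where
  "Q_zero \<Lambda> q v \<longleftrightarrow> q v v \<in> \<Lambda>"

definition K_space :: "('k::field \<Rightarrow> 'k) \<Rightarrow> 'k \<Rightarrow> ('v \<Rightarrow> 'v \<Rightarrow> 'k) \<Rightarrow> 'v set" where
  "K_space \<sigma> \<epsilon> q = {v. \<forall>w. omega_form \<sigma> \<epsilon> q w v = 0}"

definition radical :: "('k::field \<Rightarrow> 'k) \<Rightarrow> 'k \<Rightarrow> 'k set \<Rightarrow> ('v \<Rightarrow> 'v \<Rightarrow> 'k) \<Rightarrow> 'v set" where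
  "radical \<sigma> \<epsilon> \<Lambda> q = {v \<in> K_space \<sigma> \<epsilon> q. Q_zero \<Lambda> q v}"

definition perp :: "('k::field \<Rightarrow> 'k) \<Rightarrow> 'k \<Rightarrow> ('v \<Rightarrow> 'v \<Rightarrow> 'k) \<Rightarrow> 'v set \<Rightarrow> 'v set" where
  "perp \<sigma> \<epsilon> q U = {v. \<forall>u\<in>U. omega_form \<sigma> \<epsilon> q v u = 0}"

definition isotropic :: "('k::field \<Rightarrow> 'k) \<Rightarrow> 'k \<Rightarrow> 'k set \<Rightarrow> ('v \<Rightarrow> 'v \<Rightarrow> 'k) \<Rightarrow> 'v set \<Rightarrow> bool" where
  "isotropic \<sigma> \<epsilon> \<Lambda> q W \<longleftrightarrow>
     (\<forall>v\<in>W. \<forall>w\<in>W. omega_form \<sigma> \<epsilon> q v w = 0) \<and> (\<forall>v\<in>W. Q_zero \<Lambda> q v)"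

definition P_omega ::
  "('k::field \<Rightarrow> 'k) \<Rightarrow> 'k \<Rightarrow> 'k set \<Rightarrow> ('k \<Rightarrow> 'v::ab_group_add \<Rightarrow> 'v) \<Rightarrow> ('v \<Rightarrow> 'v \<Rightarrow> 'k) \<Rightarrow> 'v set set" where
  "P_omega \<sigma> \<epsilon> \<Lambda> smul q =
     {W. module.subspace smul W \<and> isotropic \<sigma> \<epsilon> \<Lambda> q W \<and>
         radical \<sigma> \<epsilon> \<Lambda> q \<subset> W \<and> W \<subset> UNIV}"

definition P_omega_rel ::
  "('k::field \<Rightarrow> 'k) \<Rightarrow> 'k \<Rightarrow> 'k set \<Rightarrow> ('k \<Rightarrow> 'v::ab_group_add \<Rightarrow> 'v) \<Rightarrow> ('v \<Rightarrow> 'v \<Rightarrow> 'k) \<Rightarrow> 'v set \<Rightarrow> 'v set set" where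
  "P_omega_rel \<sigma> \<epsilon> \<Lambda> smul q U =
     {W \<in> P_omega \<sigma> \<epsilon> \<Lambda> smul q. {w + x | w x. w \<in> W \<and> x \<in> perp \<sigma> \<epsilon> q U} = UNIV}"

definition is_chain :: "'a set set \<Rightarrow> bool" where
  "is_chain C \<longleftrightarrow> (\<forall>a\<in>C. \<forall>b\<in>C. a \<subseteq> b \<or> b \<subseteq> a)"

text \<open>Dimension = maximal length of a chain, a chain with k+1 elements having length k
(so the empty poset has dimension -1).\<close>

definition poset_dim :: "'a set set \<Rightarrow> int" where
  "poset_dim Q = Max {int (card C) - 1 | C. C \<subseteq> Q \<and> finite C \<and> is_chain C}"

text \<open>Open interval (x,y) with possibly infinite endpoints (None = -infinity resp. +infinity).\<close>

definition open_interval :: "'a set set \<Rightarrow> 'a set option \<Rightarrow> 'a set option \<Rightarrow> 'a set set" where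
  "open_interval Q lo hi =
     {z \<in> Q. (\<forall>x. lo = Some x \<longrightarrow> x \<subset> z) \<and> (\<forall>y. hi = Some y \<longrightarrow> z \<subset> y)}"

text \<open>Geometric realization of the order complex: points are finitely supported
nonnegative weight functions of total weight 1 whose support is a chain of Q.\<close>

definition realization_set :: "'a set set \<Rightarrow> ('a set \<Rightarrow> real) set" where
  "realization_set Q =
     {f. (\<forall>x. 0 \<le> f x) \<and> (\<forall>x. x \<notin> Q \<longrightarrow> f x = 0) \<and> finite {x. f x \<noteq> 0} \<and>
         is_chain {x. f x \<noteq> 0} \<and> sum f {x. f x \<noteq> 0} = 1}"

definition closed_simplex :: "'a set set \<Rightarrow> 'a set set \<Rightarrow> ('a set \<Rightarrow> real) set" where
  "closed_simplex Q C = {f \<in> realization_set Q. {x. f x \<noteq> 0} \<subseteq> C}"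

text \<open>The realization carries the weak (coherent) topology with respect to its closed
simplices, each of which has its Euclidean topology.\<close>

definition realization :: "'a set set \<Rightarrow> ('a set \<Rightarrow> real) topology" where
  "realization Q = topology (\<lambda>U. U \<subseteq> realization_set Q \<and>
     (\<forall>C. C \<subseteq> Q \<and> finite C \<and> is_chain C \<longrightarrow>
        openin (subtopology (powertop_real UNIV) (closed_simplex Q C)) (U \<inter> closed_simplex Q C)))"

text \<open>Unit sphere S^(n-1) and unit disk D^n in R^n (coordinates < n).\<close>

definition std_sphere :: "nat \<Rightarrow> (nat \<Rightarrow> real) topology" where
  "std_sphere n = subtopology (powertop_real UNIV)
     {x. (\<forall>i\<ge>n. x i = 0) \<and> (\<Sum>i<n. (x i)\<^sup>2) = 1}"

definition std_disk :: "nat \<Rightarrow> (nat \<Rightarrow> real) topology" where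
  "std_disk n = subtopology (powertop_real UNIV)
     {x. (\<forall>i\<ge>n. x i = 0) \<and> (\<Sum>i<n. (x i)\<^sup>2) \<le> 1}"

text \<open>X is k-connected (k an integer, k >= -1 meaningful): every map S^(m) -> X with
-1 <= m <= k extends to D^(m+1). (-1)-connected = nonempty; for k <= -2 vacuous.\<close>

definition k_connected :: "int \<Rightarrow> 'a topology \<Rightarrow> bool" where
  "k_connected k X \<longleftrightarrow>
     (\<forall>n::nat. int n \<le> k + 1 \<longrightarrow>
        (\<forall>g. continuous_map (std_sphere n) X g \<longrightarrow>
           (\<exists>h. continuous_map (std_disk n) X h \<and> (\<forall>x\<in>topspace (std_sphere n). h x = g x))))"

definition cohen_macaulay :: "'a set set \<Rightarrow> bool" where
  "cohen_macaulay Q \<longleftrightarrow>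
     (\<forall>lo hi. (\<forall>x. lo = Some x \<longrightarrow> x \<in> Q) \<and> (\<forall>y. hi = Some y \<longrightarrow> y \<in> Q) \<and>
        (\<forall>x y. lo = Some x \<and> hi = Some y \<longrightarrow> x \<subseteq> y) \<longrightarrow>
        k_connected (poset_dim (open_interval Q lo hi) - 1) (realization (open_interval Q lo hi)))"

end

theory Submission
  imports Defs
begin

text \<open>
  Connectivity of order complexes is controlled by two moves on an antichain \<open>V\<close> of new elements with
  links \<open>L\<close>: adding \<open>V\<close> preserves \<open>n\<close>-connectedness if the \<open>L\<close> are \<open>(n-1)\<close>-connected, and removing \<open>V\<close>
  preserves it if the \<open>L\<close> are \<open>n\<close>-connected. Both follow from one carrier argument: a map defined on part
  of a finely subdivided cube is extended cell by cell, every cell being kept inside the set of points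
  with \<open>f v < 1\<close> or with \<open>f v > 0\<close>. The weak topology enters only through the fact that compact sets meet
  finitely many simplices. Posets built by adding antichains to cones satisfy the usual
  connectivity bound for joins, by induction on the construction.

  For isotropic \<open>U\<close>, the condition \<open>W + U\<^sup>\<bottom> = E\<close> says that \<open>W\<^sup>\<bottom> \<inter> U\<close> is the radical, so the upper
  intervals of the poset are posets of isotropic subspaces, and the lower ones are posets of supplements
  in a vector space. If \<open>U\<close> is a line spanned by \<open>v\<close> modulo the radical, fix an isotropic vector \<open>l\<close> not
  orthogonal to \<open>v\<close>. The subspaces \<open>W\<close> with \<open>W \<inter> l\<^sup>\<bottom>\<close> not orthogonal to \<open>v\<close> form a contractible poset;
  every other \<open>W\<close> is orthogonal to a unique \<open>y = v - c l\<close>, and its link is a join of a poset of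
  supplements with the analogous poset for \<open>y\<close> in \<open>W\<^sup>\<bottom>/W\<close>, or with the poset of all isotropic
  subspaces of \<open>W\<^sup>\<bottom>/W\<close> if \<open>y \<in> W + K(E)\<close>. Since \<open>y\<close> need not be isotropic, the
  induction runs over arbitrary vectors \<open>v\<close>. For larger \<open>U\<close> take a hyperplane \<open>U'\<close> of \<open>U\<close> and
  remove the unwanted subspaces from the poset of \<open>U'\<close>.
\<close>

section \<open>Filling cubes\<close>

text \<open>Two notions of connectivity are kept apart. \<open>poset_connected\<close> is
  topological, and only for it can elements be removed. \<open>iconn\<close> records a construction
  from cones by additions, and this record is what proves the bound for joins without homology.
  Everything that enters a join (supplements, linear intervals, \<open>over\<close>,
  \<open>over_off\<close>) is therefore obtained by additions alone; removal is confined to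
  \<open>opposite U\<close> with \<open>U\<close> of dimension at least two modulo the radical. The
  field may be infinite, and with it the antichains; hence the insistence on maps that use finitely
  many vertices. The set \<open>S\<close> in \<open>supplements\<close> comes from links in which a
  subspace must not contain one given vector. The induction needs a hyperplane avoiding this vector
  and a vector of \<open>T\<close>. Two vectors can always be avoided; over the field with two
  elements no hyperplane avoids \<open>t\<close>, \<open>s\<close> and \<open>t + s\<close>.
  Dimensions are measured against \<open>witt\<close>, the common dimension of the maximal isotropic
  subspaces, so the degree required of an interval is the number of dimensions available in it minus
  two.\<close>

definition std_cube :: "nat \<Rightarrow> (nat \<Rightarrow> real) set" where
  "std_cube d = {x. (\<forall>i<d. \<bar>x i\<bar> \<le> 1) \<and> (\<forall>i\<ge>d. x i = 0)}"

definition cube_bd :: "nat \<Rightarrow> (nat \<Rightarrow> real) set" where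
  "cube_bd d = {x \<in> std_cube d. \<exists>i<d. \<bar>x i\<bar> = 1}"

text \<open>The whole map uses finitely many vertices, hence meets finitely many simplices. For such
  maps continuity in the product topology and in the weak topology agree.\<close>

definition fin_map :: "'p::topological_space set \<Rightarrow> ('p \<Rightarrow> 'b \<Rightarrow> real) \<Rightarrow> bool" where
  "fin_map C g \<longleftrightarrow> continuous_on C g \<and> finite (\<Union>x\<in>C. {b. g x b \<noteq> 0})"

text \<open>\<open>S\<close> is a bare set of weight functions, so that the notion also applies to
  parts of a realization such as an open star.\<close>

definition fillable :: "'p::topological_space set \<Rightarrow> 'p set \<Rightarrow> ('b \<Rightarrow> real) set \<Rightarrow> bool" where
  "fillable C B S \<longleftrightarrow> (\<forall>g. fin_map B g \<and> g ` B \<subseteq> S \<longrightarrow>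
     (\<exists>h. fin_map C h \<and> h ` C \<subseteq> S \<and> (\<forall>x\<in>B. h x = g x)))"

abbreviation cube_fillable :: "nat \<Rightarrow> ('b \<Rightarrow> real) set \<Rightarrow> bool" where
  "cube_fillable d \<equiv> fillable (std_cube d) (cube_bd d)"

lemma fillableE:
  assumes "fillable C B S" "fin_map B g" "\<And>x. x \<in> B \<Longrightarrow> g x \<in> S"
  obtains h where "fin_map C h" "\<And>x. x \<in> C \<Longrightarrow> h x \<in> S" "\<And>x. x \<in> B \<Longrightarrow> h x = g x"
proof -
  have "g ` B \<subseteq> S" using assms(3) by (simp add: image_subset_iff)
  with assms(1)[unfolded fillable_def, THEN spec[of _ g]] assms(2)
  obtain h where "fin_map C h" "h ` C \<subseteq> S" "\<forall>x\<in>B. h x = g x" by (elim impE exE conjE) simp_all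
  then show thesis by (intro that[of h]) (simp_all add: image_subset_iff)
qed

lemma fillableI:
  assumes "\<And>g. fin_map B g \<Longrightarrow> (\<And>x. x \<in> B \<Longrightarrow> g x \<in> S) \<Longrightarrow>
    \<exists>h. fin_map C h \<and> (\<forall>x\<in>C. h x \<in> S) \<and> (\<forall>x\<in>B. h x = g x)"
  shows "fillable C B S"
  using assms by (simp add: fillable_def image_subset_iff)

lemma fin_mapI:
  assumes "\<And>b. continuous_on C (\<lambda>x. g x b)" "finite F" "\<And>x b. x \<in> C \<Longrightarrow> b \<notin> F \<Longrightarrow> g x b = 0"
  shows "fin_map C g"
  unfolding fin_map_def
proof
  show "continuous_on C g"
    using assms(1) by (rule continuous_on_coordinatewise_then_product)
  show "finite (\<Union>x\<in>C. {b. g x b \<noteq> 0})"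
    by (rule finite_subset[OF _ assms(2)]) (use assms(3) in blast)
qed

lemma fin_mapE:
  assumes "fin_map C g"
  obtains F where "finite F" "\<And>x b. x \<in> C \<Longrightarrow> b \<notin> F \<Longrightarrow> g x b = 0" "\<And>b. continuous_on C (\<lambda>x. g x b)"
    "continuous_on C g"
proof
  show "finite (\<Union>x\<in>C. {b. g x b \<noteq> 0})" "continuous_on C g"
    using assms by (auto simp: fin_map_def)
  show "\<And>x b. x \<in> C \<Longrightarrow> b \<notin> (\<Union>x\<in>C. {b. g x b \<noteq> 0}) \<Longrightarrow> g x b = 0"
    by blast
  show "\<And>b. continuous_on C (\<lambda>x. g x b)"
    using assms by (auto simp: fin_map_def intro: continuous_on_product_then_coordinatewise)
qed

lemma fin_map_subset:
  assumes "fin_map C g" "D \<subseteq> C"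
  shows "fin_map D g"
  unfolding fin_map_def
proof
  show "continuous_on D g"
    using assms unfolding fin_map_def by (blast intro: continuous_on_subset)
  have "(\<Union>x\<in>D. {b. g x b \<noteq> 0}) \<subseteq> (\<Union>x\<in>C. {b. g x b \<noteq> 0})" using assms(2) by blast
  then show "finite (\<Union>x\<in>D. {b. g x b \<noteq> 0})"
    using assms(1) unfolding fin_map_def by (blast intro: finite_subset)
qed

lemma fin_map_cong: "fin_map C g \<Longrightarrow> (\<And>x. x \<in> C \<Longrightarrow> f x = g x) \<Longrightarrow> fin_map C f"
  unfolding fin_map_def by (simp cong: continuous_on_cong)

lemma fin_map_compose:
  assumes "fin_map C g" "continuous_on D f" "f ` D \<subseteq> C"
  shows "fin_map D (\<lambda>x. g (f x))"
proof -
  from assms(1) obtain F where F: "finite F" "\<And>x b. x \<in> C \<Longrightarrow> b \<notin> F \<Longrightarrow> g x b = 0"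
    "\<And>b. continuous_on C (\<lambda>x. g x b)" by (rule fin_mapE) blast
  show ?thesis
  proof (rule fin_mapI[where F = F])
    show "continuous_on D (\<lambda>x. g (f x) b)" for b
      using continuous_on_compose2[OF F(3) assms(2,3)] .
  qed (use F assms in auto)
qed

lemma fin_map_Union:
  assumes "finite I" "\<And>i. i \<in> I \<Longrightarrow> closed (T i)" "\<And>i. i \<in> I \<Longrightarrow> fin_map (T i) g"
  shows "fin_map (\<Union>i\<in>I. T i) g"
  unfolding fin_map_def
proof
  show "continuous_on (\<Union>i\<in>I. T i) g"
    by (rule continuous_on_closed_Union) (use assms in \<open>auto simp: fin_map_def\<close>)
  have "(\<Union>x\<in>(\<Union>i\<in>I. T i). {b. g x b \<noteq> 0}) = (\<Union>i\<in>I. \<Union>x\<in>T i. {b. g x b \<noteq> 0})" by blast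
  also have "finite \<dots>"
    using assms by (auto simp: fin_map_def)
  finally show "finite (\<Union>x\<in>(\<Union>i\<in>I. T i). {b. g x b \<noteq> 0})" .
qed

text \<open>The filling is pulled back along \<open>\<phi>\<close>, the boundary datum along
  \<open>\<psi>\<close>. The two agree on \<open>B'\<close> because
  \<open>\<psi> (\<phi> x) = x\<close> there.\<close>

lemma fillable_homeomorphic:
  assumes "fillable C B S"
    and "continuous_on C' \<phi>" "\<phi> ` C' \<subseteq> C" "\<phi> ` B' \<subseteq> B"
    and "continuous_on C \<psi>" "\<psi> ` B \<subseteq> B'" "\<And>x. x \<in> B' \<Longrightarrow> \<psi> (\<phi> x) = x" "B \<subseteq> C" "B' \<subseteq> C'"
  shows "fillable C' B' S"
proof (rule fillableI)
  fix g assume g: "fin_map B' g" "\<And>x. x \<in> B' \<Longrightarrow> g x \<in> S"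
  have "fin_map B (\<lambda>x. g (\<psi> x))"
    by (rule fin_map_compose[OF g(1) continuous_on_subset[OF assms(5,8)] assms(6)])
  then obtain h where h: "fin_map C h" "\<And>x. x \<in> C \<Longrightarrow> h x \<in> S" "\<And>x. x \<in> B \<Longrightarrow> h x = g (\<psi> x)"
    using fillableE[OF assms(1), of "\<lambda>x. g (\<psi> x)"] g(2) assms(6) by (simp add: image_subset_iff) metis
  have "fin_map C' (\<lambda>x. h (\<phi> x))" by (rule fin_map_compose[OF h(1) assms(2,3)])
  moreover have "\<forall>x\<in>C'. h (\<phi> x) \<in> S" using h(2) assms(3) by (simp add: image_subset_iff)
  moreover have "\<forall>x\<in>B'. h (\<phi> x) = g x" using h(3) assms(4,7) by (simp add: image_subset_iff)
  ultimately show "\<exists>h. fin_map C' h \<and> (\<forall>x\<in>C'. h x \<in> S) \<and> (\<forall>x\<in>B'. h x = g x)"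
    by (intro exI[of _ "\<lambda>x. h (\<phi> x)"] conjI)
qed

lemma continuous_on_coord: "continuous_on C (\<lambda>x::nat \<Rightarrow> real. x i)"
  by (rule continuous_on_subset[OF continuous_on_product_coordinates]) simp

lemma continuous_on_if_constant:
  "(P \<Longrightarrow> continuous_on C f) \<Longrightarrow> (\<not> P \<Longrightarrow> continuous_on C g) \<Longrightarrow> continuous_on C (\<lambda>x. if P then f x else g x)"
  by (cases P) auto

text \<open>The maximum of the first \<open>d\<close> absolute values, as a recursion: the empty
  maximum is 0, and continuity follows by induction.\<close>

fun sup_norm :: "nat \<Rightarrow> (nat \<Rightarrow> real) \<Rightarrow> real" where
  "sup_norm 0 x = 0"
| "sup_norm (Suc d) x = max (sup_norm d x) \<bar>x d\<bar>"

lemma sup_norm_nonneg: "0 \<le> sup_norm d x"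
  by (induction d) auto

lemma abs_le_sup_norm: "i < d \<Longrightarrow> \<bar>x i\<bar> \<le> sup_norm d x"
  by (induction d) (auto simp: less_Suc_eq max_def)

lemma sup_norm_attained: "0 < d \<Longrightarrow> \<exists>i<d. sup_norm d x = \<bar>x i\<bar>"
proof (induction d)
  case (Suc d)
  then show ?case
    by (cases "d = 0") (auto simp: max_def sup_norm_nonneg less_Suc_eq)
qed simp

lemma sup_norm_scale: "sup_norm d (\<lambda>i. c * x i) = \<bar>c\<bar> * sup_norm d x"
  by (induction d) (auto simp: abs_mult max_mult_distrib_left)

lemma continuous_on_sup_norm: "continuous_on C (sup_norm d)"
proof (induction d)
  case 0
  show ?case by (simp cong: continuous_on_cong)
next
  case (Suc d)
  have "continuous_on C (\<lambda>x::nat \<Rightarrow> real. max (sup_norm d x) \<bar>x d\<bar>)"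
    by (intro continuous_on_max Suc continuous_on_rabs continuous_on_coord)
  then show ?case by simp
qed

lemma std_cube_iff: "x \<in> std_cube d \<longleftrightarrow> sup_norm d x \<le> 1 \<and> (\<forall>i\<ge>d. x i = 0)"
proof -
  have "(\<forall>i<d. \<bar>x i\<bar> \<le> 1) \<longleftrightarrow> sup_norm d x \<le> 1"
    using abs_le_sup_norm[of _ d x] sup_norm_attained[of d x] by (cases "d = 0") force+
  then show ?thesis by (simp add: std_cube_def)
qed

lemma cube_bd_iff: "x \<in> cube_bd d \<longleftrightarrow> sup_norm d x = 1 \<and> (\<forall>i\<ge>d. x i = 0)"
proof
  assume "x \<in> cube_bd d"
  then show "sup_norm d x = 1 \<and> (\<forall>i\<ge>d. x i = 0)"
    using abs_le_sup_norm[of _ d x] by (force simp: cube_bd_def std_cube_iff intro: antisym)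
next
  assume *: "sup_norm d x = 1 \<and> (\<forall>i\<ge>d. x i = 0)"
  then have "d > 0" by (cases d) auto
  with * show "x \<in> cube_bd d"
    using sup_norm_attained[of d x] by (auto simp: cube_bd_def std_cube_iff)
qed

lemma cube_bd_subset: "cube_bd d \<subseteq> std_cube d"
  by (auto simp: cube_bd_def)

lemma compact_std_cube: "compact (std_cube d)"
proof -
  have "std_cube d = (\<Pi>\<^sub>E i\<in>UNIV. if i < d then {-1..1} else {0})"
    by (auto simp: std_cube_def PiE_def Pi_def abs_le_iff not_less split: if_splits)
  moreover have "compactin (product_topology (\<lambda>i. euclidean) UNIV) (\<Pi>\<^sub>E i\<in>UNIV. if i < d then {-1..1::real} else {0})"
    by (subst compactin_PiE) auto
  ultimately show ?thesis
    by (simp add: euclidean_product_topology flip: compactin_euclidean_iff)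
qed

lemma compact_cube_bd: "compact (cube_bd d)"
proof -
  have "closed {x::nat\<Rightarrow>real. sup_norm d x = 1}"
    by (intro closed_Collect_eq continuous_on_sup_norm continuous_on_const)
  moreover have "cube_bd d = std_cube d \<inter> {x. sup_norm d x = 1}"
    by (auto simp: cube_bd_iff std_cube_iff)
  ultimately show ?thesis using compact_std_cube by (simp add: compact_Int_closed)
qed

text \<open>The outer shell of the cube carries the straight-line homotopy, the inner half-size cube
  the given filling.\<close>

lemma fill_by_segments:
  assumes g: "fin_map (cube_bd d) g"
    and h: "fin_map (std_cube d) h" "\<And>x. x \<in> std_cube d \<Longrightarrow> h x \<in> S"
    and seg: "\<And>y t. y \<in> cube_bd d \<Longrightarrow> 0 \<le> t \<Longrightarrow> t \<le> 1 \<Longrightarrow> (\<lambda>b. (1 - t) * h y b + t * g y b) \<in> S"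
  shows "\<exists>h'. fin_map (std_cube d) h' \<and> (\<forall>x\<in>std_cube d. h' x \<in> S) \<and> (\<forall>x\<in>cube_bd d. h' x = g x)"
proof (cases "d = 0")
  case True
  then have "cube_bd d = {}" by (auto simp: cube_bd_def)
  then show ?thesis using h by auto
next
  case False
  define n where "n = sup_norm d"
  define I where "I = {x \<in> std_cube d. n x \<le> 1/2}"
  define J where "J = {x \<in> std_cube d. n x \<ge> 1/2}"
  have nc: "continuous_on A n" for A
    unfolding n_def by (rule continuous_on_sup_norm)
  have clI: "closed I"
  proof -
    have "closed {x. n x \<le> 1/2}" by (intro closed_Collect_le continuous_on_const nc)
    moreover have "I = std_cube d \<inter> {x. n x \<le> 1/2}" by (auto simp: I_def)
    ultimately show ?thesis using compact_imp_closed[OF compact_std_cube[of d]] by auto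
  qed
  have clJ: "closed J"
  proof -
    have "closed {x. 1/2 \<le> n x}" by (intro closed_Collect_le continuous_on_const nc)
    moreover have "J = std_cube d \<inter> {x. 1/2 \<le> n x}" by (auto simp: J_def)
    ultimately show ?thesis using compact_imp_closed[OF compact_std_cube[of d]] by auto
  qed
  define p where "p x = (\<lambda>i. x i / n x)" for x
  define k where "k x = (if x \<in> I then h (\<lambda>i. 2 * x i)
     else (\<lambda>b. (1 - (2 * n x - 1)) * h (p x) b + (2 * n x - 1) * g (p x) b))" for x
  have dbl: "(\<lambda>i. 2 * x i) \<in> std_cube d" if "x \<in> I" for x
    using that sup_norm_scale[of d 2 x] by (auto simp: I_def n_def std_cube_iff)
  have pbd: "p x \<in> cube_bd d" if "x \<in> J" for x
    using that sup_norm_scale[of d "inverse (n x)" x]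
    by (auto simp: J_def cube_bd_iff std_cube_iff p_def n_def field_simps)
  have pc: "continuous_on J p"
    unfolding p_def
    by (intro continuous_on_coordinatewise_then_product continuous_on_divide nc
        continuous_on_coord) (auto simp: J_def)
  obtain F where F: "finite F" "\<And>x b. x \<in> cube_bd d \<Longrightarrow> b \<notin> F \<Longrightarrow> g x b = 0"
    "\<And>b. continuous_on (cube_bd d) (\<lambda>x. g x b)" using g by (rule fin_mapE) blast
  obtain G where G: "finite G" "\<And>x b. x \<in> std_cube d \<Longrightarrow> b \<notin> G \<Longrightarrow> h x b = 0"
    "\<And>b. continuous_on (std_cube d) (\<lambda>x. h x b)" using h(1) by (rule fin_mapE) blast
  have kI: "fin_map I k"
  proof (rule fin_map_cong)
    show "fin_map I (\<lambda>x. h (\<lambda>i. 2 * x i))"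
      by (rule fin_map_compose[OF h(1)])
        (use dbl in \<open>auto intro!: continuous_on_coordinatewise_then_product continuous_on_mult
          continuous_on_const continuous_on_coord\<close>)
  qed (simp add: k_def)
  have kJ_eq: "k x = (\<lambda>b. (1 - (2 * n x - 1)) * h (p x) b + (2 * n x - 1) * g (p x) b)" if "x \<in> J" for x
  proof (cases "x \<in> I")
    case True
    with that have n: "n x = 1/2" unfolding I_def J_def by (simp only: mem_Collect_eq) linarith
    have "p x = (\<lambda>i. 2 * x i)" unfolding p_def n by (rule ext) simp
    then show ?thesis using True by (simp add: k_def n)
  qed (simp add: k_def)
  have kJ: "fin_map J k"
  proof (rule fin_map_cong)
    show "fin_map J (\<lambda>x b. (1 - (2 * n x - 1)) * h (p x) b + (2 * n x - 1) * g (p x) b)"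
    proof (rule fin_mapI[where F = "F \<union> G"])
      fix b
      show "continuous_on J (\<lambda>x. (1 - (2 * n x - 1)) * h (p x) b + (2 * n x - 1) * g (p x) b)"
        using pbd cube_bd_subset
        by (intro continuous_on_add continuous_on_mult continuous_on_diff continuous_on_const nc
            continuous_on_compose2[OF G(3) pc] continuous_on_compose2[OF F(3) pc]) auto
    next
      show "finite (F \<union> G)" using F G by simp
    next
      fix x b assume "x \<in> J" "b \<notin> F \<union> G"
      then have "p x \<in> cube_bd d" "p x \<in> std_cube d" using pbd cube_bd_subset by auto
      then show "(1 - (2 * n x - 1)) * h (p x) b + (2 * n x - 1) * g (p x) b = 0"
        using F(2)[of "p x" b] G(2)[of "p x" b] \<open>b \<notin> F \<union> G\<close> by simp
    qed
  qed (rule kJ_eq)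
  have IJ: "std_cube d = (\<Union>b\<in>{True,False}. if b then I else J)" by (auto simp: I_def J_def)
  have "fin_map (std_cube d) k"
    unfolding IJ by (rule fin_map_Union) (use clI clJ kI kJ in auto)
  moreover have "k x \<in> S" if "x \<in> std_cube d" for x
  proof (cases "x \<in> I")
    case True
    then show ?thesis using dbl h(2) by (auto simp: k_def)
  next
    case False
    with that have J: "x \<in> J" by (auto simp: I_def J_def)
    with that show ?thesis
      unfolding kJ_eq[OF J] by (intro seg pbd) (auto simp: J_def n_def std_cube_iff)
  qed
  moreover have "k x = g x" if "x \<in> cube_bd d" for x
  proof -
    have "n x = 1" using that by (auto simp: n_def cube_bd_iff)
    moreover have "x \<in> J" using that \<open>n x = 1\<close> cube_bd_subset by (auto simp: J_def)
    ultimately show ?thesis by (simp add: kJ_eq p_def)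
  qed
  ultimately show ?thesis by blast
qed

section \<open>Unit cells of an integer grid\<close>

text \<open>A cell is its lower corner and the set of directions in which it has length one; the
  cardinality of that set is its dimension.\<close>

type_synonym cell = "(nat \<Rightarrow> nat) \<times> nat set"

definition cell_set :: "cell \<Rightarrow> (nat \<Rightarrow> real) set" where
  "cell_set c = {x. \<forall>i. real (fst c i) \<le> x i \<and> x i \<le> real (fst c i) + (if i \<in> snd c then 1 else 0)}"

definition cell_bd :: "cell \<Rightarrow> (nat \<Rightarrow> real) set" where
  "cell_bd c = {x \<in> cell_set c. \<exists>i\<in>snd c. x i = real (fst c i) \<or> x i = real (fst c i) + 1}"

definition grid :: "nat \<Rightarrow> nat \<Rightarrow> cell set" where
  "grid m N = {(k, S). S \<subseteq> {..<m} \<and> (\<forall>i<m. k i + (if i \<in> S then 1 else 0) \<le> N) \<and> (\<forall>i\<ge>m. k i = 0)}"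

definition big_cube :: "nat \<Rightarrow> nat \<Rightarrow> (nat \<Rightarrow> real) set" where
  "big_cube m N = {x. (\<forall>i<m. 0 \<le> x i \<and> x i \<le> real N) \<and> (\<forall>i\<ge>m. x i = 0)}"

definition big_bd :: "nat \<Rightarrow> nat \<Rightarrow> (nat \<Rightarrow> real) set" where
  "big_bd m N = {x \<in> big_cube m N. \<exists>i<m. x i = 0 \<or> x i = real N}"

lemma finite_grid: "finite (grid m N)"
proof -
  have "grid m N \<subseteq> {k. \<forall>i. (i \<in> {..<m} \<longrightarrow> k i \<in> {..N}) \<and> (i \<notin> {..<m} \<longrightarrow> k i = 0)} \<times> Pow {..<m}"
    by (auto simp: grid_def)
  then show ?thesis
    by (rule finite_subset) (intro finite_cartesian_product finite_set_of_finite_funs, auto)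
qed

lemma closed_cell: "closed (cell_set c)"
proof -
  have "cell_set c = (\<Inter>i. {x. real (fst c i) \<le> x i} \<inter> {x. x i \<le> real (fst c i) + (if i \<in> snd c then 1 else 0)})"
    unfolding cell_set_def by blast
  moreover have "closed {x::nat\<Rightarrow>real. a \<le> x i}" "closed {x::nat\<Rightarrow>real. x i \<le> a}" for i a
    by (intro closed_Collect_le continuous_on_const continuous_on_coord)+
  ultimately show ?thesis
    by (simp only:) (intro closed_INT ballI closed_Int)
qed

lemma cell_setD:
  assumes "x \<in> cell_set c"
  shows "real (fst c i) \<le> x i" "x i \<le> real (fst c i) + (if i \<in> snd c then 1 else 0)"
    "i \<in> snd c \<Longrightarrow> x i \<le> real (fst c i) + 1" "i \<notin> snd c \<Longrightarrow> x i = real (fst c i)"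
proof -
  show *: "real (fst c i) \<le> x i" "x i \<le> real (fst c i) + (if i \<in> snd c then 1 else 0)"
    using assms unfolding cell_set_def by blast+
  show "i \<in> snd c \<Longrightarrow> x i \<le> real (fst c i) + 1" "i \<notin> snd c \<Longrightarrow> x i = real (fst c i)"
    using * by auto
qed

text \<open>Needed so that data on cells of smaller dimension covers the whole boundary of a cell.
  The direction in which \<open>x\<close> is extremal is frozen, at its lower or at its upper
  end.\<close>

lemma cell_bd_face:
  assumes "c \<in> grid m N" "x \<in> cell_bd c"
  obtains c' where "c' \<in> grid m N" "x \<in> cell_set c'" "cell_set c' \<subseteq> cell_set c" "card (snd c') < card (snd c)"
proof -
  obtain k S where c: "c = (k, S)" by (cases c)
  from assms have S: "finite S" "S \<subseteq> {..<m}" by (auto simp: grid_def c intro: finite_subset)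
  from assms(2) obtain i where i: "i \<in> S" "x i = real (k i) \<or> x i = real (k i) + 1" "x \<in> cell_set c"
    by (auto simp: cell_bd_def c)
  have card: "card (S - {i}) < card S" using i S by (meson card_Diff1_less)
  from i(2) show thesis
  proof
    assume xi: "x i = real (k i)"
    show thesis
    proof (rule that[of "(k, S - {i})"])
      show "(k, S - {i}) \<in> grid m N" using assms(1) by (auto simp: grid_def c split: if_splits)
      show "x \<in> cell_set (k, S - {i})"
        unfolding cell_set_def
      proof (intro CollectI allI)
        fix j
        show "real (fst (k, S - {i}) j) \<le> x j \<and> x j \<le> real (fst (k, S - {i}) j) + (if j \<in> snd (k, S - {i}) then 1 else 0)"
          using cell_setD(1,2)[OF i(3), of j] xi by (cases "j = i") (simp_all add: c)
      qed
      show "cell_set (k, S - {i}) \<subseteq> cell_set c"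
      proof
        fix y assume y: "y \<in> cell_set (k, S - {i})"
        show "y \<in> cell_set c"
          unfolding cell_set_def
        proof (intro CollectI allI)
          fix j
          show "real (fst c j) \<le> y j \<and> y j \<le> real (fst c j) + (if j \<in> snd c then 1 else 0)"
            using cell_setD(1,2)[OF y, of j] by (auto simp: c split: if_splits)
        qed
      qed
    qed (use card c in simp)
  next
    assume xi: "x i = real (k i) + 1"
    show thesis
    proof (rule that[of "(k(i := k i + 1), S - {i})"])
      show "(k(i := k i + 1), S - {i}) \<in> grid m N" using assms(1) i(1)
        by (auto simp: grid_def c split: if_splits)
      show "x \<in> cell_set (k(i := k i + 1), S - {i})"
        unfolding cell_set_def
      proof (intro CollectI allI)
        fix j
        show "real (fst (k(i := k i + 1), S - {i}) j) \<le> x j \<and>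
            x j \<le> real (fst (k(i := k i + 1), S - {i}) j) + (if j \<in> snd (k(i := k i + 1), S - {i}) then 1 else 0)"
          using cell_setD(1,2)[OF i(3), of j] xi by (cases "j = i") (simp_all add: c)
      qed
      show "cell_set (k(i := k i + 1), S - {i}) \<subseteq> cell_set c"
      proof
        fix y assume "y \<in> cell_set (k(i := k i + 1), S - {i})"
        then have y: "\<And>j. real ((k(i := k i + 1)) j) \<le> y j \<and> y j \<le> real ((k(i := k i + 1)) j) + (if j \<in> S - {i} then 1 else 0)"
          by (simp add: cell_set_def)
        show "y \<in> cell_set c"
          unfolding cell_set_def
        proof (intro CollectI allI)
          fix j
          show "real (fst c j) \<le> y j \<and> y j \<le> real (fst c j) + (if j \<in> snd c then 1 else 0)"
            using y[of j] i(1) by (cases "j = i") (auto simp: c)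
        qed
      qed
    qed (use card c in simp)
  qed
qed

text \<open>At an interior point every free coordinate lies strictly between consecutive integers,
  so any grid cell through the point is free in that direction with the same corner coordinate.
  Hence \<open>c\<close> is the smallest cell through \<open>x\<close>.\<close>

lemma cell_interior_face:
  assumes "c \<in> grid m N" "c' \<in> grid m N" "x \<in> cell_set c" "x \<notin> cell_bd c" "x \<in> cell_set c'"
  shows "cell_set c \<subseteq> cell_set c' \<and> (c = c' \<or> card (snd c) < card (snd c'))"
proof -
  obtain k S where c: "c = (k, S)" by (cases c)
  obtain k' S' where c': "c' = (k', S')" by (cases c')
  have x: "real (k i) \<le> x i" "x i \<le> real (k i) + (if i \<in> S then 1 else 0)"
    "real (k' i) \<le> x i" "x i \<le> real (k' i) + (if i \<in> S' then 1 else 0)" for i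
    using cell_setD(1,2)[OF assms(3), of i] cell_setD(1,2)[OF assms(5), of i] by (simp_all add: c c')
  have int: "real (k i) < x i" "x i < real (k i) + 1" if "i \<in> S" for i
    using x(1,2)[of i] assms(3,4) that by (auto simp: cell_bd_def c less_le)
  have SS: "i \<in> S'" "k' i = k i" if "i \<in> S" for i
  proof -
    have *: "k' i < k i + 1" "k i < k' i + 1"
      using int[OF that] x(3,4)[of i] by (auto split: if_splits)
    then show "k' i = k i" by simp
    with int[OF that] x(4)[of i] show "i \<in> S'" by (auto split: if_splits)
  qed
  have nS: "x i = real (k i)" if "i \<notin> S" for i using x[of i] that by auto
  have fin: "finite S'" using assms(2) by (auto simp: grid_def c' intro: finite_subset)
  have sub: "cell_set c \<subseteq> cell_set c'"
  proof
    fix y assume "y \<in> cell_set c"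
    then have y: "real (k i) \<le> y i" "y i \<le> real (k i) + (if i \<in> S then 1 else 0)" for i
      using cell_setD(1,2)[OF \<open>y \<in> cell_set c\<close>, of i] by (simp_all add: c)
    have "real (k' i) \<le> y i \<and> y i \<le> real (k' i) + (if i \<in> S' then 1 else 0)" for i
      using y[of i] SS[of i] nS[of i] x(3,4)[of i] by (cases "i \<in> S") auto
    then show "y \<in> cell_set c'" by (simp add: cell_set_def c')
  qed
  have "S \<subseteq> S'" using SS by blast
  show ?thesis
  proof (cases "S = S'")
    case True
    have "k i = k' i" for i
    proof (cases "i \<in> S")
      case False
      then show ?thesis using nS[of i] x(3,4)[of i] True by auto
    qed (use SS in auto)
    then show ?thesis using sub True by (auto simp: c c')
  next
    case False
    then have "card S < card S'" using \<open>S \<subseteq> S'\<close> fin by (intro psubset_card_mono) auto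
    then show ?thesis using sub by (simp add: c c')
  qed
qed

lemma cell_subset_big_cube: "c \<in> grid m N \<Longrightarrow> cell_set c \<subseteq> big_cube m N"
proof
  fix x assume c: "c \<in> grid m N" and x: "x \<in> cell_set c"
  have x: "real (fst c i) \<le> x i" "x i \<le> real (fst c i) + (if i \<in> snd c then 1 else 0)" for i
    using cell_setD(1,2)[OF x] by auto
  show "x \<in> big_cube m N"
    unfolding big_cube_def
  proof (intro CollectI conjI allI impI)
    fix i assume "i < m"
    then have "fst c i + (if i \<in> snd c then 1 else 0) \<le> N" using c by (auto simp: grid_def)
    then have "real (fst c i) + (if i \<in> snd c then 1 else 0) \<le> real N"
      by (auto split: if_splits)
    then show "x i \<le> real N" using x[of i] by linarith
    show "0 \<le> x i" using x[of i] by linarith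
  next
    fix i assume "m \<le> i"
    then show "x i = 0" using c x[of i] by (auto simp: grid_def split: if_splits)
  qed
qed

text \<open>Rounding down gives the corner, and the free directions are those with a non-integral
  coordinate. A coordinate equal to 0 or \<open>N\<close> is integral, hence constant on the cell,
  which gives the last claim.\<close>

lemma carrier_cell:
  assumes "x \<in> big_cube m N"
  obtains c where "c \<in> grid m N" "x \<in> cell_set c" "x \<in> big_bd m N \<Longrightarrow> cell_set c \<subseteq> big_bd m N"
proof -
  define k where "k i = nat \<lfloor>x i\<rfloor>" for i
  define S where "S = {i. i < m \<and> x i \<noteq> real (k i)}"
  have pos: "0 \<le> x i" for i using assms by (cases "i < m") (auto simp: big_cube_def)
  have k: "real (k i) \<le> x i" "x i < real (k i) + 1" for i
    using pos[of i] by (auto simp: k_def)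
  have k0: "k i = 0" if "i \<ge> m" for i using that assms by (auto simp: k_def big_cube_def)
  have nS: "x i = real (k i)" if "i \<notin> S" for i
    using that k0[of i] assms by (cases "i < m") (auto simp: S_def big_cube_def)
  have g: "(k, S) \<in> grid m N"
  proof -
    have "k i + (if i \<in> S then 1 else 0) \<le> N" if "i < m" for i
    proof -
      have "x i \<le> real N" using assms that by (auto simp: big_cube_def)
      show ?thesis
      proof (cases "i \<in> S")
        case True
        then have "real (k i) < x i" using k[of i] by (auto simp: S_def)
        then have "k i < N" using \<open>x i \<le> real N\<close> by linarith
        then show ?thesis by simp
      next
        case False
        then show ?thesis using nS \<open>x i \<le> real N\<close> by auto
      qed
    qed
    then show ?thesis using k0 by (auto simp: grid_def S_def)
  qed
  show thesis
  proof (rule that[OF g])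
    show "x \<in> cell_set (k, S)"
      using k nS by (auto simp: cell_set_def less_imp_le)
    assume "x \<in> big_bd m N"
    then obtain i where i: "i < m" "x i = 0 \<or> x i = real N" by (auto simp: big_bd_def)
    then have "x i = real (k i)" by (auto simp: k_def)
    then have "i \<notin> S" by (simp add: S_def)
    show "cell_set (k, S) \<subseteq> big_bd m N"
    proof
      fix y assume y: "y \<in> cell_set (k, S)"
      then have "y i = x i" using \<open>i \<notin> S\<close> nS[of i] cell_setD(4)[OF y, of i] by simp
      then show "y \<in> big_bd m N"
        using y cell_subset_big_cube[OF g] i by (auto simp: big_bd_def)
    qed
  qed
qed

text \<open>An affine chart: \<open>f\<close> numbers the free directions of the cell.\<close>

lemma cell_fillable:
  assumes c: "c \<in> grid m N" and e: "cube_fillable (card (snd c)) S"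
  shows "fillable (cell_set c) (cell_bd c) S"
proof -
  obtain k T where ck: "c = (k, T)" by (cases c)
  from c have "finite T" by (auto simp: grid_def ck intro: finite_subset)
  define d where "d = card T"
  obtain f where f: "bij_betw f {..<d} T"
    using \<open>finite T\<close> d_def by (metis bij_betw_from_nat_into_finite)
  define f' where "f' = inv_into {..<d} f"
  have f'f: "f' (f j) = j" if "j < d" for j
    using f that by (auto simp: f'_def bij_betw_def)
  have ff': "f (f' i) = i" "f' i < d" if "i \<in> T" for i
    using f that by (auto simp: f'_def bij_betw_def f_inv_into_f dest: inv_into_into)
  have fT: "f j \<in> T" if "j < d" for j using f that by (auto simp: bij_betw_def)
  define \<phi> where "\<phi> x = (\<lambda>j. if j < d then 2 * (x (f j) - real (k (f j))) - 1 else 0)" for x :: "nat \<Rightarrow> real"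
  define \<psi> where "\<psi> z = (\<lambda>i. real (k i) + (if i \<in> T then (z (f' i) + 1) / 2 else 0))" for z :: "nat \<Rightarrow> real"
  show ?thesis
  proof (rule fillable_homeomorphic[where C = "std_cube d" and B = "cube_bd d" and \<phi> = \<phi> and \<psi> = \<psi>])
    show "cube_fillable d S" using e by (simp add: d_def ck)
    show "continuous_on (cell_set c) \<phi>"
      unfolding \<phi>_def
      by (intro continuous_on_coordinatewise_then_product continuous_on_if_constant continuous_on_add
          continuous_on_diff continuous_on_mult continuous_on_divide continuous_on_const continuous_on_coord)
    show "continuous_on (std_cube d) \<psi>"
      unfolding \<psi>_def
      by (intro continuous_on_coordinatewise_then_product continuous_on_if_constant continuous_on_add
          continuous_on_diff continuous_on_mult continuous_on_divide continuous_on_const continuous_on_coord) simp_all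
    have cube: "\<phi> x \<in> std_cube d" if "x \<in> cell_set c" for x
    proof -
      have "real (k i) \<le> x i \<and> x i \<le> real (k i) + 1" if "i \<in> T" for i
        using cell_setD[OF \<open>x \<in> cell_set c\<close>, of i] that by (simp add: ck)
      then have "\<bar>2 * (x (f j) - real (k (f j))) - 1\<bar> \<le> 1" if "j < d" for j
        using fT[OF that] by (force simp: abs_le_iff)
      then show ?thesis
        by (simp add: std_cube_def \<phi>_def)
    qed
    then show "\<phi> ` cell_set c \<subseteq> std_cube d" by blast
    show "\<phi> ` cell_bd c \<subseteq> cube_bd d"
    proof (clarify)
      fix x assume x: "x \<in> cell_bd c"
      then obtain i where i: "i \<in> T" "x i = real (k i) \<or> x i = real (k i) + 1" by (auto simp: cell_bd_def ck)
      then have "\<bar>\<phi> x (f' i)\<bar> = 1" using ff'[of i] by (auto simp: \<phi>_def)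
      then show "\<phi> x \<in> cube_bd d" using x cube ff'(2)[OF i(1)] by (auto simp: cube_bd_def cell_bd_def)
    qed
    show "\<psi> ` cube_bd d \<subseteq> cell_bd c"
    proof clarify
      fix z assume z: "z \<in> cube_bd d"
      then have z1: "\<bar>z j\<bar> \<le> 1" if "j < d" for j using that by (auto simp: cube_bd_def std_cube_def)
      have "\<psi> z \<in> cell_set c"
        unfolding cell_set_def
      proof (intro CollectI allI)
        fix i
        show "real (fst c i) \<le> \<psi> z i \<and> \<psi> z i \<le> real (fst c i) + (if i \<in> snd c then 1 else 0)"
          using z1[OF ff'(2)[of i]] by (auto simp: ck \<psi>_def abs_le_iff)
      qed
      moreover from z obtain j where j: "j < d" "\<bar>z j\<bar> = 1" by (auto simp: cube_bd_def)
      then have "\<psi> z (f j) = real (k (f j)) \<or> \<psi> z (f j) = real (k (f j)) + 1"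
        using f'f[of j] fT[of j] by (auto simp: \<psi>_def abs_if split: if_splits)
      ultimately show "\<psi> z \<in> cell_bd c" using fT[OF j(1)] by (auto simp: cell_bd_def ck)
    qed
    show "\<psi> (\<phi> x) = x" if "x \<in> cell_bd c" for x
    proof
      fix i
      have "x \<in> cell_set c" using that by (simp add: cell_bd_def)
      from cell_setD(4)[OF this, of i] show "\<psi> (\<phi> x) i = x i"
        using ff'[of i] by (cases "i \<in> T") (simp_all add: ck \<phi>_def \<psi>_def diff_divide_distrib)
    qed
  qed (auto simp: cube_bd_def cell_bd_def)
qed

text \<open>Induction over skeleta with a carrier \<open>\<Phi>\<close>. Monotonicity along faces
  puts the boundary of a new cell into the set in which the cell is filled. It is asked only for
  faces of smaller dimension, so that \<open>\<Phi>\<close> may treat top cells specially.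
  \<open>D\<close> is a subcomplex on which the map is prescribed.\<close>

lemma carrier_extension:
  fixes \<Phi> :: "cell \<Rightarrow> ('b \<Rightarrow> real) set"
  assumes D: "D \<subseteq> grid m N"
    and Ddown: "\<And>c c'. c \<in> D \<Longrightarrow> c' \<in> grid m N \<Longrightarrow> cell_set c' \<subseteq> cell_set c \<Longrightarrow> c' \<in> D"
    and g: "fin_map (\<Union>c\<in>D. cell_set c) g"
    and g\<Phi>: "\<And>c x. c \<in> D \<Longrightarrow> x \<in> cell_set c \<Longrightarrow> g x \<in> \<Phi> c"
    and mono: "\<And>c c'. c \<in> grid m N - D \<Longrightarrow> c' \<in> grid m N \<Longrightarrow> cell_set c' \<subseteq> cell_set c \<Longrightarrow>
       card (snd c') < card (snd c) \<Longrightarrow> \<Phi> c' \<subseteq> \<Phi> c"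
    and fill: "\<And>c. c \<in> grid m N - D \<Longrightarrow> cube_fillable (card (snd c)) (\<Phi> c)"
  obtains h where "fin_map (big_cube m N) h" "\<And>c x. c \<in> D \<Longrightarrow> x \<in> cell_set c \<Longrightarrow> h x = g x"
    "\<And>c x. c \<in> grid m N \<Longrightarrow> x \<in> cell_set c \<Longrightarrow> h x \<in> \<Phi> c"
proof -
  define K where "K d = {c \<in> grid m N. c \<in> D \<or> card (snd c) < d}" for d
  define A where "A d = (\<Union>c\<in>K d. cell_set c)" for d
  have "\<exists>h. fin_map (A d) h \<and> (\<forall>c\<in>D. \<forall>x\<in>cell_set c. h x = g x) \<and> (\<forall>c\<in>K d. \<forall>x\<in>cell_set c. h x \<in> \<Phi> c)" for d
  proof (induction d)
    case 0
    have "K 0 = D" using D by (auto simp: K_def)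
    then show ?case using g g\<Phi> unfolding A_def by (intro exI[of _ g]) simp
  next
    case (Suc d)
    then obtain h where h: "fin_map (A d) h" "\<And>c x. c \<in> D \<Longrightarrow> x \<in> cell_set c \<Longrightarrow> h x = g x"
      "\<And>c x. c \<in> K d \<Longrightarrow> x \<in> cell_set c \<Longrightarrow> h x \<in> \<Phi> c" by (elim exE conjE) simp
    define New where "New = {c \<in> grid m N - D. card (snd c) = d}"
    have bd: "x \<in> A d \<and> h x \<in> \<Phi> c" if c: "c \<in> New" and x: "x \<in> cell_bd c" for c x
    proof -
      have "c \<in> grid m N" using c by (simp add: New_def)
      from cell_bd_face[OF this x] obtain c' where c': "c' \<in> grid m N" "x \<in> cell_set c'"
        "cell_set c' \<subseteq> cell_set c" "card (snd c') < card (snd c)" by metis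
      then have "c' \<in> K d" using c by (simp add: K_def New_def)
      moreover have "\<Phi> c' \<subseteq> \<Phi> c" using mono[of c c'] c c' by (simp add: New_def)
      ultimately show ?thesis using h(3)[of c' x] c'(2) unfolding A_def by blast
    qed
    define good where "good c k \<longleftrightarrow> fin_map (cell_set c) k \<and> (\<forall>x\<in>cell_set c. k x \<in> \<Phi> c) \<and> (\<forall>x\<in>cell_bd c. k x = h x)"
      for c k
    have "\<exists>k. good c k" if c: "c \<in> New" for c
    proof -
      have cg: "c \<in> grid m N - D" using c by (simp add: New_def)
      have "fin_map (cell_bd c) h"
        by (rule fin_map_subset[OF h(1)]) (use bd[OF c] in blast)
      then obtain k where "fin_map (cell_set c) k" "\<And>x. x \<in> cell_set c \<Longrightarrow> k x \<in> \<Phi> c"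
          "\<And>x. x \<in> cell_bd c \<Longrightarrow> k x = h x"
        using fillableE[OF cell_fillable[OF _ fill[OF cg]], of m N h] bd[OF c] cg by (metis DiffD1)
      then show ?thesis unfolding good_def by (intro exI[of _ k]) simp
    qed
    then have "\<forall>c\<in>New. \<exists>k. good c k" by simp
    then obtain H where "\<forall>c\<in>New. good c (H c)" by (rule bchoice[THEN exE])
    then have H: "\<And>c. c \<in> New \<Longrightarrow> fin_map (cell_set c) (H c)"
      "\<And>c x. c \<in> New \<Longrightarrow> x \<in> cell_set c \<Longrightarrow> H c x \<in> \<Phi> c"
      "\<And>c x. c \<in> New \<Longrightarrow> x \<in> cell_bd c \<Longrightarrow> H c x = h x" by (simp_all add: good_def)
    define h' where "h' x = (if x \<in> A d then h x else H (SOME c. c \<in> New \<and> x \<in> cell_set c) x)" for x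
    have h'A: "h' x = h x" if "x \<in> A d" for x using that by (simp add: h'_def)
    have h'N: "h' x = H c x" if c: "c \<in> New" and x: "x \<in> cell_set c" for c x
    proof (cases "x \<in> A d")
      case True
      then obtain c' where c': "c' \<in> K d" "x \<in> cell_set c'" by (auto simp: A_def)
      \<comment> \<open>An older cell meeting the interior of \<open>c\<close> would contain
        \<open>c\<close>. This is impossible: \<open>D\<close> is closed under faces, and the other
        older cells have smaller dimension.\<close>
      have "x \<in> cell_bd c"
      proof (rule ccontr)
        assume "x \<notin> cell_bd c"
        then have "cell_set c \<subseteq> cell_set c' \<and> (c = c' \<or> card (snd c) < card (snd c'))"
          using c c' x by (intro cell_interior_face[of c m N c' x]) (auto simp: K_def New_def)
        then show False using c c' Ddown[of c' c] by (auto simp: K_def New_def)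
      qed
      then show ?thesis using H(3)[OF c] h'A[OF True] by simp
    next
      case False
      \<comment> \<open>Distinct new cells have equal dimension and share no interior point, so the
        choice made in \<open>h'\<close> returns \<open>c\<close> itself.\<close>
      define c1 where "c1 = (SOME c. c \<in> New \<and> x \<in> cell_set c)"
      have c1: "c1 \<in> New \<and> x \<in> cell_set c1" unfolding c1_def by (rule someI[of _ c]) (use c x in simp)
      have "x \<notin> cell_bd c" using bd[OF c] False by auto
      then have "c = c1 \<or> card (snd c) < card (snd c1)"
        using c c1 x cell_interior_face[of c m N c1 x] by (auto simp: New_def)
      then have "c = c1" using c c1 by (auto simp: New_def)
      then show ?thesis using False by (simp add: h'_def c1_def)
    qed
    have KS: "c \<in> K d \<or> c \<in> New" if "c \<in> K (Suc d)" for c using that by (auto simp: K_def New_def)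
    have cA: "cell_set c \<subseteq> A d" if "c \<in> K d" for c using that by (auto simp: A_def)
    have "fin_map (A (Suc d)) h'"
      unfolding A_def
    proof (rule fin_map_Union)
      show "finite (K (Suc d))" by (rule finite_subset[OF _ finite_grid[of m N]]) (auto simp: K_def)
      fix c assume "c \<in> K (Suc d)"
      show "closed (cell_set c)" by (rule closed_cell)
      from KS[OF \<open>c \<in> K (Suc d)\<close>] show "fin_map (cell_set c) h'"
      proof
        assume "c \<in> K d"
        show ?thesis
          by (rule fin_map_cong[OF fin_map_subset[OF h(1) cA[OF \<open>c \<in> K d\<close>]]])
            (use cA[OF \<open>c \<in> K d\<close>] h'A in blast)
      next
        assume "c \<in> New"
        then show ?thesis by (intro fin_map_cong[OF H(1)] h'N)
      qed
    qed
    moreover have "h' x = g x" if "c \<in> D" "x \<in> cell_set c" for c x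
    proof -
      have "c \<in> K d" using that D by (auto simp: K_def)
      then have "x \<in> A d" using that by (auto simp: A_def)
      then show ?thesis using h'A h(2)[OF that] by simp
    qed
    moreover have "h' x \<in> \<Phi> c" if "c \<in> K (Suc d)" "x \<in> cell_set c" for c x
      using KS[OF that(1)]
    proof
      assume "c \<in> K d"
      then show ?thesis using cA[of c] that h'A[of x] h(3)[of c x] by auto
    next
      assume "c \<in> New"
      then show ?thesis using h'N that H(2) by simp
    qed
    ultimately show ?case by (intro exI[of _ h']) simp
  qed
  \<comment> \<open>No cell has dimension above \<open>m\<close>, so this stage is the whole
    grid.\<close>
  from this[of "Suc m"] obtain h where h: "fin_map (A (Suc m)) h" "\<And>c x. c \<in> D \<Longrightarrow> x \<in> cell_set c \<Longrightarrow> h x = g x"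
      "\<And>c x. c \<in> K (Suc m) \<Longrightarrow> x \<in> cell_set c \<Longrightarrow> h x \<in> \<Phi> c" by (elim exE conjE) simp
  have K: "K (Suc m) = grid m N"
  proof -
    have "card (snd c) < Suc m" if "c \<in> grid m N" for c
      using that card_mono[of "{..<m}" "snd c"] by (auto simp: grid_def)
    then show ?thesis by (auto simp: K_def)
  qed
  have "big_cube m N \<subseteq> A (Suc m)"
  proof
    fix x assume "x \<in> big_cube m N"
    from carrier_cell[OF this] obtain c where "c \<in> grid m N" "x \<in> cell_set c" by metis
    then show "x \<in> A (Suc m)" using K by (auto simp: A_def)
  qed
  then show thesis using that[of h] h K fin_map_subset by metis
qed

text \<open>The distance on functions weights the coordinates by powers of 1/2, whose sum is
  2.\<close>

lemma dist_fun_le: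
  fixes x y :: "nat \<Rightarrow> real"
  assumes "\<And>i. \<bar>x i - y i\<bar> \<le> e"
  shows "dist x y \<le> 2 * e"
proof -
  have e: "0 \<le> e" using assms[of 0] by linarith
  have s: "summable (\<lambda>n. (1/2)^n * min (dist (x (from_nat n)) (y (from_nat n))) 1)"
    by (rule summable_comparison_test'[of "\<lambda>n. (1/2)^n"]) (auto simp: summable_geometric_iff)
  have s2: "summable (\<lambda>n. (1/2)^n * e)"
    by (intro summable_mult2) (simp add: summable_geometric_iff)
  have "dist x y \<le> (\<Sum>n. (1/2)^n * e)"
    unfolding dist_fun_def
    by (rule suminf_le[OF _ s s2]) (auto intro!: mult_left_mono min.coboundedI1 simp: dist_real_def assms)
  also have "\<dots> = 2 * e"
    using suminf_mult2[of "\<lambda>n. (1/2::real)^n" e] suminf_geometric[of "1/2::real"]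
    by (simp add: summable_geometric_iff)
  finally show ?thesis .
qed

text \<open>\<open>2 / real N\<close> is the side of a cell when the cube of side 2 is cut into
  \<open>N\<close> slabs in every direction. Variation below 1 suffices: no cell then contains both
  a point where a weight is 0 and one where it is 1.\<close>

lemma fine_grid:
  fixes u :: "(nat \<Rightarrow> real) \<Rightarrow> real"
  assumes "compact C" "continuous_on C u"
  obtains N where "N \<ge> 1" "\<And>x y. x \<in> C \<Longrightarrow> y \<in> C \<Longrightarrow> (\<And>i. \<bar>x i - y i\<bar> \<le> 2 / real N) \<Longrightarrow> \<bar>u x - u y\<bar> < 1"
proof -
  have "uniformly_continuous_on C u" using assms by (simp add: compact_uniformly_continuous)
  then obtain \<delta> where \<delta>: "\<delta> > 0" "\<And>x y. x \<in> C \<Longrightarrow> y \<in> C \<Longrightarrow> dist y x < \<delta> \<Longrightarrow> dist (u y) (u x) < 1"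
    unfolding uniformly_continuous_on_def by (metis zero_less_one)
  \<comment> \<open>Coordinates differing by at most \<open>2 / real N\<close> give distance at most
    twice that, hence the 4.\<close>
  obtain N where N: "real N > 4 / \<delta>" using reals_Archimedean2 by blast
  have N1: "N \<ge> 1" using N \<delta>(1) by (cases N) (auto simp: field_simps)
  have "4 / real N < \<delta>" using N \<delta>(1) N1 by (simp add: field_simps)
  show thesis
  proof (rule that[OF N1])
    fix x y assume "x \<in> C" "y \<in> C" and "\<And>i. \<bar>x i - y i\<bar> \<le> 2 / real N"
    then have "dist x y \<le> 2 * (2 / real N)" by (intro dist_fun_le)
    then have "dist x y < \<delta>" using \<open>4 / real N < \<delta>\<close> by simp
    then show "\<bar>u x - u y\<bar> < 1" using \<delta>(2) \<open>x \<in> C\<close> \<open>y \<in> C\<close> by (simp add: dist_real_def)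
  qed
qed

definition rescale :: "nat \<Rightarrow> nat \<Rightarrow> (nat \<Rightarrow> real) \<Rightarrow> nat \<Rightarrow> real" where
  "rescale m N y = (\<lambda>i. if i < m then 2 * y i / real N - 1 else 0)"

lemma continuous_on_rescale: "continuous_on C (rescale m N)"
  unfolding rescale_def divide_inverse
  by (intro continuous_on_coordinatewise_then_product continuous_on_if_constant continuous_on_diff
        continuous_on_mult continuous_on_const continuous_on_coord)

definition unscale :: "nat \<Rightarrow> nat \<Rightarrow> (nat \<Rightarrow> real) \<Rightarrow> nat \<Rightarrow> real" where
  "unscale m N x = (\<lambda>i. if i < m then (x i + 1) * real N / 2 else 0)"

lemma continuous_on_unscale: "continuous_on C (unscale m N)"
  unfolding unscale_def divide_inverse
  by (intro continuous_on_coordinatewise_then_product continuous_on_if_constant continuous_on_add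
        continuous_on_mult continuous_on_const continuous_on_coord)

lemma rescale_unscale: "N \<ge> 1 \<Longrightarrow> x \<in> std_cube m \<Longrightarrow> rescale m N (unscale m N x) = x"
  by (auto simp: fun_eq_iff std_cube_def rescale_def unscale_def)

lemma unscale_big_cube: assumes "x \<in> std_cube m" shows "unscale m N x \<in> big_cube m N"
proof -
  have "0 \<le> (x i + 1) * real N / 2 \<and> (x i + 1) * real N / 2 \<le> real N" if "i < m" for i
  proof -
    have "0 \<le> x i + 1" "x i + 1 \<le> 2" using assms that by (auto simp: std_cube_def abs_le_iff)
    then have "(x i + 1) * real N \<le> 2 * real N" by (intro mult_right_mono) auto
    then show ?thesis using \<open>0 \<le> x i + 1\<close> by auto
  qed
  then show ?thesis by (auto simp: big_cube_def unscale_def)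
qed

lemma unscale_big_bd: assumes "x \<in> cube_bd m" shows "unscale m N x \<in> big_bd m N"
proof -
  from assms obtain i where i: "i < m" "x i = 1 \<or> x i = -1" by (auto simp: cube_bd_def abs_if split: if_splits)
  show ?thesis
    unfolding big_bd_def
  proof (intro CollectI conjI exI[of _ i])
    show "unscale m N x \<in> big_cube m N" using assms by (intro unscale_big_cube) (simp add: cube_bd_def)
  qed (use i in \<open>auto simp: unscale_def\<close>)
qed

lemma rescale_std_cube: assumes "N \<ge> 1" "y \<in> big_cube m N" shows "rescale m N y \<in> std_cube m"
proof -
  have "\<bar>2 * y j / real N - 1\<bar> \<le> 1" if "j < m" for j
  proof -
    have "0 \<le> y j" "y j \<le> real N" using assms that by (auto simp: big_cube_def)
    then have "0 \<le> y j / real N" "y j / real N \<le> 1" using assms(1) by (auto simp: divide_le_eq)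
    then show ?thesis by (simp add: abs_le_iff)
  qed
  then show ?thesis by (simp add: std_cube_def rescale_def)
qed

lemma rescale_cube_bd: assumes "N \<ge> 1" "y \<in> big_bd m N" shows "rescale m N y \<in> cube_bd m"
proof -
  obtain i where i: "i < m" "y i = 0 \<or> y i = real N" using assms by (auto simp: big_bd_def)
  show ?thesis
    unfolding cube_bd_def
  proof (intro CollectI conjI exI[of _ i])
    show "rescale m N y \<in> std_cube m" using assms by (intro rescale_std_cube) (simp_all add: big_bd_def)
  qed (use i assms in \<open>auto simp: rescale_def\<close>)
qed

lemma rescale_cell_close:
  assumes "N \<ge> 1" "x \<in> cell_set c" "y \<in> cell_set c"
  shows "\<bar>rescale m N x i - rescale m N y i\<bar> \<le> 2 / real N"
proof -
  have "\<bar>x i - y i\<bar> \<le> 1"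
    using cell_setD(1,2)[OF assms(2), of i] cell_setD(1,2)[OF assms(3), of i] by (auto split: if_splits)
  then have "\<bar>x i - y i\<bar> / real N \<le> 1 / real N" by (intro divide_right_mono) simp_all
  moreover have "\<bar>2 * x i / real N - 2 * y i / real N\<bar> = 2 * (\<bar>x i - y i\<bar> / real N)"
  proof -
    have "2 * x i / real N - 2 * y i / real N = 2 * ((x i - y i) / real N)" by (simp add: diff_divide_distrib)
    then show ?thesis by (simp only: abs_mult abs_divide abs_numeral abs_of_nat)
  qed
  ultimately show ?thesis by (simp add: rescale_def)
qed

section \<open>Realizations of order complexes\<close>

lemma is_chain_subset: "is_chain A \<Longrightarrow> B \<subseteq> A \<Longrightarrow> is_chain B"
  unfolding is_chain_def by blast

lemma realization_setI:
  assumes "finite A" "A \<subseteq> Q" "is_chain A" "\<And>x. 0 \<le> f x" "\<And>x. x \<notin> A \<Longrightarrow> f x = 0" "sum f A = 1"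
  shows "f \<in> realization_set Q"
proof -
  have sub: "{x. f x \<noteq> 0} \<subseteq> A" using assms(5) by blast
  moreover have "sum f {x. f x \<noteq> 0} = 1"
    using sum.mono_neutral_left[OF assms(1) sub, of f] assms(6) by simp
  ultimately show ?thesis
    using assms is_chain_subset[OF assms(3) sub] finite_subset[OF sub] unfolding realization_set_def by blast
qed

lemma realization_setE:
  assumes "f \<in> realization_set Q"
  obtains A where "finite A" "A \<subseteq> Q" "is_chain A" "\<And>x. 0 \<le> f x" "\<And>x. x \<notin> A \<longleftrightarrow> f x = 0" "sum f A = 1"
  using assms by (intro that[of "{x. f x \<noteq> 0}"]) (auto simp: realization_set_def)

lemma realization_set_mono: "Q \<subseteq> Q' \<Longrightarrow> realization_set Q \<subseteq> realization_set Q'"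
  unfolding realization_set_def by blast

lemma realization_segment:
  assumes f: "f \<in> realization_set Q" and k: "k \<in> realization_set Q"
    and ch: "is_chain ({x. f x \<noteq> 0} \<union> {x. k x \<noteq> 0})" and t: "0 \<le> t" "t \<le> 1"
  shows "(\<lambda>x. (1 - t) * k x + t * f x) \<in> realization_set Q"
proof -
  obtain A where A: "finite A" "A \<subseteq> Q" "\<And>x. 0 \<le> f x" "\<And>x. x \<notin> A \<longleftrightarrow> f x = 0" "sum f A = 1"
    using f by (rule realization_setE) blast
  obtain B where B: "finite B" "B \<subseteq> Q" "\<And>x. 0 \<le> k x" "\<And>x. x \<notin> B \<longleftrightarrow> k x = 0" "sum k B = 1"
    using k by (rule realization_setE) blast
  have AB: "A = {x. f x \<noteq> 0}" "B = {x. k x \<noteq> 0}" using A(4) B(4) by blast+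
  have "sum f (A \<union> B) = 1" "sum k (A \<union> B) = 1"
    using sum.mono_neutral_left[of "A \<union> B" A f] sum.mono_neutral_left[of "A \<union> B" B k] A B by auto
  then have "(\<Sum>x\<in>A \<union> B. (1 - t) * k x + t * f x) = 1"
    by (simp add: sum.distrib flip: sum_distrib_left)
  then show ?thesis
    using A B t ch AB by (intro realization_setI[of "A \<union> B"]) auto
qed

section \<open>Stars, links and radial projection from a vertex\<close>

definition vertex_point :: "'a set \<Rightarrow> 'a set \<Rightarrow> real" where
  "vertex_point v = (\<lambda>x. if x = v then 1 else 0)"

lemma vertex_point_realization: "v \<in> Q \<Longrightarrow> vertex_point v \<in> realization_set Q"
  by (intro realization_setI[of "{v}"]) (auto simp: vertex_point_def is_chain_def)

lemma vertex_point_support: "{x. vertex_point v x \<noteq> 0} = {v}"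
  by (auto simp: vertex_point_def)

lemma fin_map_vertex_point: "fin_map C (\<lambda>_. vertex_point v)"
  by (rule fin_mapI[of _ _ "{v}"]) (auto simp: vertex_point_def)

text \<open>Radial projection from the vertex \<open>v\<close>: its weight is dropped and the others
  are renormalised. It is applied where \<open>f v < 1\<close>.\<close>

definition away :: "'a set \<Rightarrow> ('a set \<Rightarrow> real) \<Rightarrow> 'a set \<Rightarrow> real" where
  "away v f = (\<lambda>x. if x = v then 0 else f x / (1 - f v))"

text \<open>The vertices of the link of \<open>v\<close> in the order complex. It is mostly taken
  for \<open>v\<close> outside \<open>Q\<close>, before \<open>v\<close> is added or after it is
  removed.\<close>

definition link :: "'a set set \<Rightarrow> 'a set \<Rightarrow> 'a set set" where
  "link Q v = {z \<in> Q. z \<subset> v \<or> v \<subset> z}"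

lemma link_subset: "link Q v \<subseteq> Q" by (auto simp: link_def)

text \<open>If \<open>v\<close> carries weight, the support is a chain through \<open>v\<close>; all
  its other members are comparable with \<open>v\<close>, so the projection lands in the
  link.\<close>

lemma away_realization:
  assumes f: "f \<in> realization_set (insert v Q)" "f v < 1"
  shows "away v f \<in> realization_set (Q - {v})" "0 < f v \<Longrightarrow> away v f \<in> realization_set (link Q v)"
    "{x. away v f x \<noteq> 0} \<subseteq> {x. f x \<noteq> 0}"
proof -
  obtain A where A: "finite A" "A \<subseteq> insert v Q" "is_chain A" "\<And>x. 0 \<le> f x" "\<And>x. x \<notin> A \<longleftrightarrow> f x = 0" "sum f A = 1"
    using f(1) by (rule realization_setE) blast
  have "sum f (A - {v}) = 1 - f v"
    using A by (cases "v \<in> A") (auto simp: sum_diff1)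
  moreover have "sum (away v f) (A - {v}) = sum f (A - {v}) / (1 - f v)"
    unfolding sum_divide_distrib by (rule sum.cong) (auto simp: away_def)
  ultimately have s: "sum (away v f) (A - {v}) = 1" using f(2) by simp
  have nn: "0 \<le> away v f x" for x using A(4) f(2) by (simp add: away_def)
  have z: "away v f x = 0" if "x \<notin> A - {v}" for x using that A(5)[of x] by (auto simp: away_def)
  have ch: "is_chain (A - {v})" using A(3) by (rule is_chain_subset) blast
  show "away v f \<in> realization_set (Q - {v})"
    by (rule realization_setI[of "A - {v}"]) (use A s nn z ch in auto)
  show "{x. away v f x \<noteq> 0} \<subseteq> {x. f x \<noteq> 0}" by (auto simp: away_def)
  assume "0 < f v"
  then have "v \<in> A" using A(5)[of v] by auto
  then have "A - {v} \<subseteq> link Q v" using A(2,3) unfolding is_chain_def link_def by blast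
  then show "away v f \<in> realization_set (link Q v)"
    by (intro realization_setI[of "A - {v}"]) (use A s nn z ch in auto)
qed

lemma away_fin_map:
  assumes g: "fin_map C g" and lt: "\<And>x. x \<in> C \<Longrightarrow> g x v < 1"
  shows "fin_map C (\<lambda>x. away v (g x))"
proof -
  obtain F where F: "finite F" "\<And>x b. x \<in> C \<Longrightarrow> b \<notin> F \<Longrightarrow> g x b = 0"
    "\<And>b. continuous_on C (\<lambda>x. g x b)" using g by (rule fin_mapE) blast
  show ?thesis
  proof (rule fin_mapI[OF _ F(1)])
    fix b
    have "1 - g x v \<noteq> 0" if "x \<in> C" for x using lt[OF that] by simp
    then show "continuous_on C (\<lambda>x. away v (g x) b)"
      unfolding away_def
      by (intro continuous_on_if_constant continuous_on_const continuous_on_divide continuous_on_diff F(3)) auto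
  next
    fix x b assume "x \<in> C" "b \<notin> F"
    then show "away v (g x) b = 0" using F(2) by (simp add: away_def)
  qed
qed

lemma away_id: "f \<in> realization_set Q \<Longrightarrow> v \<notin> Q \<Longrightarrow> away v f = f"
  by (auto simp: away_def realization_set_def fun_eq_iff)

text \<open>A chain remains one when \<open>p\<close> is added, so segments to the vertex
  \<open>p\<close> stay in the realization.\<close>

lemma cone_fillable:
  assumes p: "p \<in> Q" "\<And>z. z \<in> Q \<Longrightarrow> z \<subseteq> p \<or> p \<subseteq> z"
  shows "cube_fillable d (realization_set Q)"
proof (rule fillableI)
  fix g assume g: "fin_map (cube_bd d) g" "\<And>x. x \<in> cube_bd d \<Longrightarrow> g x \<in> realization_set Q"
  show "\<exists>h. fin_map (std_cube d) h \<and> (\<forall>x\<in>std_cube d. h x \<in> realization_set Q) \<and> (\<forall>x\<in>cube_bd d. h x = g x)"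
  proof (rule fill_by_segments[OF g(1) fin_map_vertex_point vertex_point_realization[OF p(1)]])
    fix y t assume y: "y \<in> cube_bd d" and t: "0 \<le> (t::real)" "t \<le> 1"
    obtain A where A: "A \<subseteq> Q" "is_chain A" "\<And>x. x \<notin> A \<longleftrightarrow> g y x = 0"
      using g(2)[OF y] by (rule realization_setE) blast
    have "{x. g y x \<noteq> 0} \<union> {p} \<subseteq> A \<union> {p}" using A(3) by blast
    moreover have "is_chain (A \<union> {p})" using A(1,2) p(2) unfolding is_chain_def by blast
    ultimately have "is_chain ({x. g y x \<noteq> 0} \<union> {x. vertex_point p x \<noteq> 0})"
      unfolding vertex_point_support by (metis is_chain_subset)
    then show "(\<lambda>b. (1 - t) * vertex_point p b + t * g y b) \<in> realization_set Q"
      using g(2)[OF y] vertex_point_realization[OF p(1)] t by (intro realization_segment)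
  qed
qed

text \<open>The open star is star-shaped about \<open>v\<close>.\<close>

lemma open_star_fillable:
  "cube_fillable d {f \<in> realization_set (insert v Q). 0 < f v}"
proof (rule fillableI)
  let ?S = "{f \<in> realization_set (insert v Q). 0 < f v}"
  fix g assume g: "fin_map (cube_bd d) g" "\<And>x. x \<in> cube_bd d \<Longrightarrow> g x \<in> ?S"
  show "\<exists>h. fin_map (std_cube d) h \<and> (\<forall>x\<in>std_cube d. h x \<in> ?S) \<and> (\<forall>x\<in>cube_bd d. h x = g x)"
  proof (rule fill_by_segments[OF g(1) fin_map_vertex_point])
    have v: "vertex_point v \<in> realization_set (insert v Q)" by (intro vertex_point_realization) simp
    then show "vertex_point v \<in> ?S" by (simp add: vertex_point_def)
    fix y t assume y: "y \<in> cube_bd d" and t: "0 \<le> (t::real)" "t \<le> 1"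
    have gy: "g y \<in> realization_set (insert v Q)" "0 < g y v" using g(2)[OF y] by simp_all
    then have "{x. g y x \<noteq> 0} \<union> {x. vertex_point v x \<noteq> 0} = {x. g y x \<noteq> 0}"
      unfolding vertex_point_support by auto
    then have "is_chain ({x. g y x \<noteq> 0} \<union> {x. vertex_point v x \<noteq> 0})"
      using gy(1) by (simp add: realization_set_def)
    then have "(\<lambda>b. (1 - t) * vertex_point v b + t * g y b) \<in> realization_set (insert v Q)"
      using gy(1) v t by (intro realization_segment)
    moreover have "0 < (1 - t) * vertex_point v v + t * g y v"
    proof (cases "t = 0")
      case False
      then have "0 < t * g y v" using t gy(2) by simp
      then show ?thesis using t by (simp add: vertex_point_def)
    qed (simp add: vertex_point_def)
    ultimately show "(\<lambda>b. (1 - t) * vertex_point v b + t * g y b) \<in> ?S" by simp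
  qed
qed

text \<open>Away from the point \<open>v\<close> the realization contracts radially onto that of
  \<open>Q\<close>: fill the projected boundary there and return to the given one along the radial
  segments.\<close>

lemma punctured_fillable:
  assumes v: "v \<notin> Q" and Q: "cube_fillable d (realization_set Q)"
  shows "cube_fillable d {f \<in> realization_set (insert v Q). f v < 1}"
proof (rule fillableI)
  let ?S = "{f \<in> realization_set (insert v Q). f v < 1}"
  fix g assume g: "fin_map (cube_bd d) g" "\<And>x. x \<in> cube_bd d \<Longrightarrow> g x \<in> ?S"
  have aw: "away v (g x) \<in> realization_set Q" if "x \<in> cube_bd d" for x
    using away_realization(1)[of "g x" v Q] g(2)[OF that] v by simp
  have "fin_map (cube_bd d) (\<lambda>x. away v (g x))" by (rule away_fin_map[OF g(1)]) (use g(2) in simp)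
  from fillableE[OF Q this aw] obtain h where h: "fin_map (std_cube d) h"
    "\<And>x. x \<in> std_cube d \<Longrightarrow> h x \<in> realization_set Q" "\<And>x. x \<in> cube_bd d \<Longrightarrow> h x = away v (g x)" by metis
  have sub: "f \<in> realization_set (insert v Q) \<and> f v = 0" if "f \<in> realization_set Q" for f
    using that v realization_set_mono[of Q "insert v Q"] by (auto simp: realization_set_def)
  show "\<exists>h. fin_map (std_cube d) h \<and> (\<forall>x\<in>std_cube d. h x \<in> ?S) \<and> (\<forall>x\<in>cube_bd d. h x = g x)"
  proof (rule fill_by_segments[OF g(1) h(1)])
    fix x assume "x \<in> std_cube d"
    then show "h x \<in> ?S" using sub[OF h(2)[of x]] by simp
  next
    fix y t assume y: "y \<in> cube_bd d" and t: "0 \<le> (t::real)" "t \<le> 1"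
    have gy: "g y \<in> realization_set (insert v Q)" "g y v < 1" using g(2)[OF y] by simp_all
    have hy: "h y \<in> realization_set (insert v Q)" "h y v = 0" using sub[OF aw[OF y]] h(3)[OF y] by simp_all
    have "{x. g y x \<noteq> 0} \<union> {x. h y x \<noteq> 0} = {x. g y x \<noteq> 0}"
      using away_realization(3)[OF gy] h(3)[OF y] by auto
    then have "is_chain ({x. g y x \<noteq> 0} \<union> {x. h y x \<noteq> 0})"
      using gy(1) by (simp add: realization_set_def)
    then have "(\<lambda>b. (1 - t) * h y b + t * g y b) \<in> realization_set (insert v Q)"
      using gy(1) hy(1) t by (intro realization_segment)
    moreover have "0 \<le> g y v" using gy(1) by (simp add: realization_set_def)
    then have "t * g y v \<le> g y v" using t by (simp add: mult_left_le_one_le)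
    then have "(1 - t) * h y v + t * g y v < 1" using gy(2) hy(2) by simp
    ultimately show "(\<lambda>b. (1 - t) * h y b + t * g y b) \<in> ?S" by simp
  qed
qed

text \<open>The open star without its centre is the link times an open interval.\<close>

lemma punctured_star_fillable:
  assumes v: "v \<notin> Q" and lk: "cube_fillable d (realization_set (link Q v))"
  shows "cube_fillable d {f \<in> realization_set (insert v Q). 0 < f v \<and> f v < 1}"
proof (rule fillableI)
  let ?S = "{f \<in> realization_set (insert v Q). 0 < f v \<and> f v < 1}"
  fix g assume g: "fin_map (cube_bd d) g" "\<And>x. x \<in> cube_bd d \<Longrightarrow> g x \<in> ?S"
  have aw: "away v (g x) \<in> realization_set (link Q v)" if "x \<in> cube_bd d" for x
    using away_realization(2)[of "g x" v Q] g(2)[OF that] v by simp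
  have "fin_map (cube_bd d) (\<lambda>x. away v (g x))" by (rule away_fin_map[OF g(1)]) (use g(2) in simp)
  from fillableE[OF lk this aw] obtain h where h: "fin_map (std_cube d) h"
    "\<And>x. x \<in> std_cube d \<Longrightarrow> h x \<in> realization_set (link Q v)" "\<And>x. x \<in> cube_bd d \<Longrightarrow> h x = away v (g x)" by metis
  \<comment> \<open>The filling in the link is moved half way to \<open>v\<close>, which brings it
    into the open star and keeps it off \<open>v\<close>.\<close>
  define k where "k x = (\<lambda>b. (1 - 1/2) * vertex_point v b + 1/2 * h x b)" for x
  have vQ: "vertex_point v \<in> realization_set (insert v Q)" by (intro vertex_point_realization) simp
  have kS: "k x \<in> realization_set (insert v Q)" "k x v = 1/2" if x: "h x \<in> realization_set (link Q v)" for x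
  proof -
    obtain A where A: "A \<subseteq> link Q v" "is_chain A" "\<And>z. z \<notin> A \<longleftrightarrow> h x z = 0"
      using x by (rule realization_setE) blast
    have "{z. h x z \<noteq> 0} \<union> {v} = A \<union> {v}" using A(3) by blast
    moreover have "is_chain (A \<union> {v})" using A(1,2) unfolding is_chain_def link_def by blast
    ultimately have ch: "is_chain ({z. h x z \<noteq> 0} \<union> {z. vertex_point v z \<noteq> 0})"
      unfolding vertex_point_support by simp
    have "h x \<in> realization_set (insert v Q)"
      using x realization_set_mono[of "link Q v" "insert v Q"] link_subset[of Q v] by blast
    then show "k x \<in> realization_set (insert v Q)"
      unfolding k_def using ch vQ by (intro realization_segment) simp_all
    have "h x v = 0" using A(1,3) v by (auto simp: link_def)
    then show "k x v = 1/2" by (simp add: k_def vertex_point_def)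
  qed
  have kfin: "fin_map (std_cube d) k"
  proof -
    obtain F where F: "finite F" "\<And>x b. x \<in> std_cube d \<Longrightarrow> b \<notin> F \<Longrightarrow> h x b = 0"
      "\<And>b. continuous_on (std_cube d) (\<lambda>x. h x b)" using h(1) by (rule fin_mapE) blast
    show ?thesis
      unfolding k_def
    proof (rule fin_mapI[of _ _ "insert v F"])
      show "continuous_on (std_cube d) (\<lambda>x. (1 - 1/2) * vertex_point v b + 1/2 * h x b)" for b
        by (intro continuous_on_add continuous_on_mult continuous_on_const F(3))
    qed (use F in \<open>auto simp: vertex_point_def\<close>)
  qed
  show "\<exists>h. fin_map (std_cube d) h \<and> (\<forall>x\<in>std_cube d. h x \<in> ?S) \<and> (\<forall>x\<in>cube_bd d. h x = g x)"
  proof (rule fill_by_segments[OF g(1) kfin])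
    fix x assume "x \<in> std_cube d"
    then show "k x \<in> ?S" using kS[OF h(2)[of x]] by simp
  next
    fix y t assume y: "y \<in> cube_bd d" and t: "0 \<le> (t::real)" "t \<le> 1"
    have gy: "g y \<in> realization_set (insert v Q)" "0 < g y v" "g y v < 1" using g(2)[OF y] by simp_all
    have ky: "k y \<in> realization_set (insert v Q)" "k y v = 1/2" using kS aw[OF y] h(3)[OF y] by simp_all
    have "{x. g y x \<noteq> 0} \<union> {x. k y x \<noteq> 0} = {x. g y x \<noteq> 0}"
      using away_realization(3)[OF gy(1,3)] h(3)[OF y] gy(2) by (auto simp: k_def vertex_point_def)
    then have "is_chain ({x. g y x \<noteq> 0} \<union> {x. k y x \<noteq> 0})"
      using gy(1) by (simp add: realization_set_def)
    then have "(\<lambda>b. (1 - t) * k y b + t * g y b) \<in> realization_set (insert v Q)"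
      using gy(1) ky(1) t by (intro realization_segment)
    moreover have "0 < (1 - t) * k y v + t * g y v \<and> (1 - t) * k y v + t * g y v < 1"
      unfolding ky(2) using convex_real_interval(8)[of 0 1] convexD[of "{0<..<1}" "k y v" "g y v" "1 - t" t] gy(2,3) ky(2) t
      by simp
    ultimately show "(\<lambda>b. (1 - t) * k y b + t * g y b) \<in> ?S" by simp
  qed
qed

section \<open>Adding and removing vertices\<close>

definition poset_connected :: "int \<Rightarrow> 'a set set \<Rightarrow> bool" where
  "poset_connected n Q \<longleftrightarrow> (\<forall>d. int d \<le> n + 1 \<longrightarrow> cube_fillable d (realization_set Q))"

text \<open>A Mayer-Vietoris argument for maps: the sets \<open>f v < 1\<close> and
  \<open>0 < f v\<close> cover the realization and look like \<open>Q\<close> and like a point, and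
  their overlap looks like the link. The overlap never has to receive a top cell, hence the degree
  \<open>n - 1\<close> for the link.\<close>

lemma poset_connected_insert:
  assumes v: "v \<notin> Q" and Q: "poset_connected n Q" and lk: "poset_connected (n - 1) (link Q v)"
  shows "poset_connected n (insert v Q)"
  unfolding poset_connected_def
proof (intro allI impI)
  fix m assume m: "int m \<le> n + 1"
  let ?R = "realization_set (insert v Q)"
  show "cube_fillable m ?R"
  proof (rule fillableI)
    fix g assume g: "fin_map (cube_bd m) g" "\<And>x. x \<in> cube_bd m \<Longrightarrow> g x \<in> ?R"
    have "continuous_on (cube_bd m) (\<lambda>x. g x v)" using g(1) by (rule fin_mapE) blast
    then obtain N where N: "N \<ge> 1" "\<And>x y. x \<in> cube_bd m \<Longrightarrow> y \<in> cube_bd m \<Longrightarrow>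
        (\<And>i. \<bar>x i - y i\<bar> \<le> 2 / real N) \<Longrightarrow> \<bar>g x v - g y v\<bar> < 1"
      using fine_grid[OF compact_cube_bd] by metis
    define g' where "g' y = g (rescale m N y)" for y
    have g': "g' y \<in> ?R" if "y \<in> big_bd m N" for y
      unfolding g'_def by (intro g(2) rescale_cube_bd N(1) that)
    have g'fin: "fin_map (big_bd m N) g'"
      unfolding g'_def
      by (rule fin_map_compose[OF g(1) continuous_on_rescale]) (use rescale_cube_bd[OF N(1)] in blast)
    define P0 where "P0 c \<longleftrightarrow> (\<forall>x\<in>cell_set c \<inter> big_bd m N. g' x v < 1)" for c
    define P1 where "P1 c \<longleftrightarrow> (\<forall>x\<in>cell_set c \<inter> big_bd m N. 0 < g' x v)" for c
    have P: "P0 c \<or> P1 c" for c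
    proof (rule ccontr)
      assume "\<not> ?thesis"
      then obtain x y where xy: "x \<in> cell_set c" "x \<in> big_bd m N" "y \<in> cell_set c" "y \<in> big_bd m N"
        "\<not> g' x v < 1" "\<not> 0 < g' y v" by (auto simp: P0_def P1_def)
      have "\<bar>g' x v - g' y v\<bar> < 1"
        unfolding g'_def by (rule N(2)) (use xy rescale_cube_bd[OF N(1)] rescale_cell_close[OF N(1)] in auto)
      with xy(5,6) show False by linarith
    qed
    define X0 where "X0 = {f \<in> ?R. f v < 1}"
    define X1 where "X1 = {f \<in> ?R. 0 < f v}"
    define X01 where "X01 = {f \<in> ?R. 0 < f v \<and> f v < 1}"
    \<comment> \<open>Boundary values may force a cell into one of the two sets. A cell with a free
      choice goes to the overlap, so that it can be a face of cells of either kind. A top cell is a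
      proper face of nothing and may use the larger set \<open>X0\<close>.\<close>
    define \<Phi> where "\<Phi> c = (if \<not> P0 c then X1 else if \<not> P1 c \<or> card (snd c) = m then X0 else X01)" for c :: cell
    define D where "D = {c \<in> grid m N. cell_set c \<subseteq> big_bd m N}"
    have UD: "(\<Union>c\<in>D. cell_set c) = big_bd m N"
    proof
      show "big_bd m N \<subseteq> (\<Union>c\<in>D. cell_set c)"
      proof
        fix x assume x: "x \<in> big_bd m N"
        then have "x \<in> big_cube m N" by (simp add: big_bd_def)
        from carrier_cell[OF this] x obtain c where "c \<in> grid m N" "x \<in> cell_set c" "cell_set c \<subseteq> big_bd m N"
          by metis
        then show "x \<in> (\<Union>c\<in>D. cell_set c)" unfolding D_def by blast
      qed
    qed (auto simp: D_def)
    have dimc: "card (snd c) \<le> m" if "c \<in> grid m N" for c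
      using that card_mono[of "{..<m}" "snd c"] by (auto simp: grid_def)
    have "\<exists>h. fin_map (big_cube m N) h \<and> (\<forall>c\<in>D. \<forall>x\<in>cell_set c. h x = g' x) \<and>
        (\<forall>c\<in>grid m N. \<forall>x\<in>cell_set c. h x \<in> \<Phi> c)"
    proof (rule carrier_extension[where D = D and m = m and N = N and g = g' and \<Phi> = \<Phi>])
      show "D \<subseteq> grid m N" by (auto simp: D_def)
      show "c' \<in> D" if "c \<in> D" "c' \<in> grid m N" "cell_set c' \<subseteq> cell_set c" for c c'
        using that by (auto simp: D_def)
      show "fin_map (\<Union>c\<in>D. cell_set c) g'" unfolding UD by (rule g'fin)
      show "g' x \<in> \<Phi> c" if "c \<in> D" "x \<in> cell_set c" for c x
      proof -
        have "x \<in> big_bd m N" using that by (auto simp: D_def)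
        then show ?thesis
          using that g'[of x] P[of c] by (auto simp: \<Phi>_def X0_def X1_def X01_def P0_def P1_def)
      qed
      show "\<Phi> c' \<subseteq> \<Phi> c" if "c \<in> grid m N - D" "c' \<in> grid m N" "cell_set c' \<subseteq> cell_set c"
        "card (snd c') < card (snd c)" for c c'
      proof -
        have m': "card (snd c') \<noteq> m" using dimc[of c] that by auto
        have P0: "P0 c \<Longrightarrow> P0 c'" and P1: "P1 c \<Longrightarrow> P1 c'" using that(3) by (auto simp: P0_def P1_def)
        have X: "X01 \<subseteq> X0" "X01 \<subseteq> X1" by (auto simp: X0_def X1_def X01_def)
        show ?thesis
        proof (cases "P0 c")
          case True
          then show ?thesis using P0 P1 X m' by (auto simp: \<Phi>_def)
        next
          case False
          then have "P1 c'" using P[of c] P1 by simp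
          then show ?thesis using False X m' by (auto simp: \<Phi>_def)
        qed
      qed
      show "cube_fillable (card (snd c)) (\<Phi> c)" if "c \<in> grid m N - D" for c
      proof -
        have dm: "card (snd c) \<le> m" using dimc that by simp
        have 1: "cube_fillable (card (snd c)) X1" unfolding X1_def by (rule open_star_fillable)
        have "cube_fillable (card (snd c)) (realization_set Q)"
          using Q dm m unfolding poset_connected_def by simp
        then have 0: "cube_fillable (card (snd c)) X0" unfolding X0_def by (rule punctured_fillable[OF v])
        have 01: "cube_fillable (card (snd c)) X01" if "card (snd c) \<noteq> m"
        proof -
          have "cube_fillable (card (snd c)) (realization_set (link Q v))"
            using lk dm m that unfolding poset_connected_def by simp
          then show ?thesis unfolding X01_def by (rule punctured_star_fillable[OF v])
        qed
        show ?thesis using 0 1 01 by (auto simp: \<Phi>_def)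
      qed
    next
      fix h assume "fin_map (big_cube m N) h" "\<And>c x. c \<in> D \<Longrightarrow> x \<in> cell_set c \<Longrightarrow> h x = g' x"
        "\<And>c x. c \<in> grid m N \<Longrightarrow> x \<in> cell_set c \<Longrightarrow> h x \<in> \<Phi> c"
      then show ?thesis by (intro exI[of _ h]) simp
    qed
    then obtain h where h: "fin_map (big_cube m N) h" "\<And>c x. c \<in> D \<Longrightarrow> x \<in> cell_set c \<Longrightarrow> h x = g' x"
        "\<And>c x. c \<in> grid m N \<Longrightarrow> x \<in> cell_set c \<Longrightarrow> h x \<in> \<Phi> c" by (elim exE conjE) simp
    have \<Phi>R: "\<Phi> c \<subseteq> ?R" for c by (auto simp: \<Phi>_def X0_def X1_def X01_def)
    have hR: "h x \<in> ?R" if "x \<in> big_cube m N" for x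
    proof -
      from carrier_cell[OF that] obtain c where "c \<in> grid m N" "x \<in> cell_set c" by metis
      then show ?thesis using h(3)[of c x] \<Phi>R[of c] by auto
    qed
    have hbd: "h x = g' x" if "x \<in> big_bd m N" for x
    proof -
      from that obtain c where "c \<in> D" "x \<in> cell_set c" unfolding UD[symmetric] by auto
      then show ?thesis by (rule h(2))
    qed
    show "\<exists>h. fin_map (std_cube m) h \<and> (\<forall>x\<in>std_cube m. h x \<in> ?R) \<and> (\<forall>x\<in>cube_bd m. h x = g x)"
    proof (intro exI[of _ "\<lambda>x. h (unscale m N x)"] conjI ballI)
      show "fin_map (std_cube m) (\<lambda>x. h (unscale m N x))"
        by (rule fin_map_compose[OF h(1) continuous_on_unscale]) (use unscale_big_cube in blast)
      show "h (unscale m N x) \<in> ?R" if "x \<in> std_cube m" for x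
        by (intro hR unscale_big_cube that)
      show "h (unscale m N x) = g x" if "x \<in> cube_bd m" for x
        using hbd[OF unscale_big_bd[OF that]] rescale_unscale[OF N(1), of x m] that cube_bd_subset[of m]
        by (auto simp: g'_def)
    qed
  qed
qed

text \<open>The filling is pushed off \<open>v\<close>. Cells on which the weight of
  \<open>v\<close> stays below 1 are kept; on every other cell the weight is positive throughout,
  and the cell is refilled in the punctured open star. The result avoids the point \<open>v\<close>
  and is projected radially into \<open>Q\<close>. Top cells may have to be refilled too, so the
  link needs one degree more than for adding \<open>v\<close>.\<close>

lemma fill_avoiding_vertex:
  assumes v: "v \<notin> Q" and lk: "\<And>d. d \<le> m \<Longrightarrow> cube_fillable d (realization_set (link Q v))"
    and F: "fin_map (std_cube m) F" "\<And>x. x \<in> std_cube m \<Longrightarrow> F x \<in> realization_set (insert v Q)"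
    and bd: "\<And>x. x \<in> cube_bd m \<Longrightarrow> F x \<in> realization_set Q"
  shows "\<exists>h. fin_map (std_cube m) h \<and> (\<forall>x\<in>std_cube m. h x \<in> realization_set Q) \<and> (\<forall>x\<in>cube_bd m. h x = F x)"
proof -
  let ?R = "realization_set (insert v Q)"
  have "continuous_on (std_cube m) (\<lambda>x. F x v)" using F(1) by (rule fin_mapE) blast
  then obtain N where N: "N \<ge> 1" "\<And>x y. x \<in> std_cube m \<Longrightarrow> y \<in> std_cube m \<Longrightarrow>
      (\<And>i. \<bar>x i - y i\<bar> \<le> 2 / real N) \<Longrightarrow> \<bar>F x v - F y v\<bar> < 1"
    using fine_grid[OF compact_std_cube] by metis
  define g where "g y = F (rescale m N y)" for y
  have gR: "g y \<in> ?R" if "y \<in> big_cube m N" for y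
    unfolding g_def by (intro F(2) rescale_std_cube N(1) that)
  have gfin: "fin_map (big_cube m N) g"
    unfolding g_def
    by (rule fin_map_compose[OF F(1) continuous_on_rescale]) (use rescale_std_cube[OF N(1)] in blast)
  define P0 where "P0 c \<longleftrightarrow> (\<forall>x\<in>cell_set c. g x v < 1)" for c
  define P1 where "P1 c \<longleftrightarrow> (\<forall>x\<in>cell_set c. 0 < g x v)" for c
  have P: "P1 c" if c: "c \<in> grid m N" "\<not> P0 c" for c
  proof (rule ccontr)
    assume "\<not> ?thesis"
    then obtain x y where xy: "x \<in> cell_set c" "y \<in> cell_set c"
      "\<not> g x v < 1" "\<not> 0 < g y v" using c(2) by (auto simp: P0_def P1_def)
    have "\<bar>g x v - g y v\<bar> < 1"
      unfolding g_def
      by (rule N(2)) (use xy rescale_std_cube[OF N(1)] rescale_cell_close[OF N(1)] cell_subset_big_cube[OF c(1)] in auto)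
    with xy(3,4) show False by linarith
  qed
  define X0 where "X0 = {f \<in> ?R. f v < 1}"
  define X01 where "X01 = {f \<in> ?R. 0 < f v \<and> f v < 1}"
  \<comment> \<open>A cell to be refilled satisfies \<open>P1\<close>, and so do all its faces; this
    makes \<open>\<Phi>\<close> monotone where that is required.\<close>
  define \<Phi> where "\<Phi> c = (if P1 c then X01 else X0)" for c :: cell
  define D where "D = {c \<in> grid m N. P0 c}"
  have dimc: "card (snd c) \<le> m" if "c \<in> grid m N" for c
    using that card_mono[of "{..<m}" "snd c"] by (auto simp: grid_def)
  have "\<exists>h. fin_map (big_cube m N) h \<and> (\<forall>c\<in>D. \<forall>x\<in>cell_set c. h x = g x) \<and>
      (\<forall>c\<in>grid m N. \<forall>x\<in>cell_set c. h x \<in> \<Phi> c)"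
  proof (rule carrier_extension[where D = D and m = m and N = N and g = g and \<Phi> = \<Phi>])
    show "D \<subseteq> grid m N" by (auto simp: D_def)
    show "c' \<in> D" if "c \<in> D" "c' \<in> grid m N" "cell_set c' \<subseteq> cell_set c" for c c'
      using that by (auto simp: D_def P0_def)
    have "(\<Union>c\<in>D. cell_set c) \<subseteq> big_cube m N" unfolding D_def using cell_subset_big_cube by blast
    then show "fin_map (\<Union>c\<in>D. cell_set c) g" by (rule fin_map_subset[OF gfin])
    show "g x \<in> \<Phi> c" if "c \<in> D" "x \<in> cell_set c" for c x
    proof -
      have "x \<in> big_cube m N" using that cell_subset_big_cube unfolding D_def by blast
      then show ?thesis
        using that gR[of x] by (auto simp: \<Phi>_def X0_def X01_def P0_def P1_def D_def)
    qed
    show "\<Phi> c' \<subseteq> \<Phi> c" if "c \<in> grid m N - D" "c' \<in> grid m N" "cell_set c' \<subseteq> cell_set c" for c c'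
    proof -
      have "P1 c" using that P[of c] by (auto simp: D_def)
      then have "P1 c'" using that(3) by (auto simp: P1_def)
      then show ?thesis using \<open>P1 c\<close> by (simp add: \<Phi>_def)
    qed
    show "cube_fillable (card (snd c)) (\<Phi> c)" if "c \<in> grid m N - D" for c
    proof -
      have "P1 c" using that P[of c] by (auto simp: D_def)
      moreover have "cube_fillable (card (snd c)) X01"
        unfolding X01_def by (rule punctured_star_fillable[OF v lk]) (use dimc that in simp)
      ultimately show ?thesis by (simp add: \<Phi>_def)
    qed
  next
    fix h assume "fin_map (big_cube m N) h" "\<And>c x. c \<in> D \<Longrightarrow> x \<in> cell_set c \<Longrightarrow> h x = g x"
      "\<And>c x. c \<in> grid m N \<Longrightarrow> x \<in> cell_set c \<Longrightarrow> h x \<in> \<Phi> c"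
    then show ?thesis by (intro exI[of _ h]) simp
  qed
  then obtain h where h: "fin_map (big_cube m N) h" "\<And>c x. c \<in> D \<Longrightarrow> x \<in> cell_set c \<Longrightarrow> h x = g x"
      "\<And>c x. c \<in> grid m N \<Longrightarrow> x \<in> cell_set c \<Longrightarrow> h x \<in> \<Phi> c" by (elim exE conjE) simp
  have hR: "h x \<in> ?R" "h x v < 1" if "x \<in> big_cube m N" for x
  proof -
    from carrier_cell[OF that] obtain c where "c \<in> grid m N" "x \<in> cell_set c" by metis
    then have "h x \<in> X0" using h(3)[of c x] by (auto simp: \<Phi>_def X0_def X01_def split: if_splits)
    then show "h x \<in> ?R" "h x v < 1" by (simp_all add: X0_def)
  qed
  have hbd: "h x = g x \<and> g x \<in> realization_set Q" if x: "x \<in> big_bd m N" for x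
  proof -
    have gQ: "g y \<in> realization_set Q" if "y \<in> big_bd m N" for y
      unfolding g_def by (intro bd rescale_cube_bd N(1) that)
    have "x \<in> big_cube m N" using x by (simp add: big_bd_def)
    from carrier_cell[OF this] x obtain c where c: "c \<in> grid m N" "x \<in> cell_set c" "cell_set c \<subseteq> big_bd m N"
      by metis
    \<comment> \<open>Boundary values have no weight at \<open>v\<close>, so boundary cells belong
      to \<open>D\<close> and stay fixed.\<close>
    have "P0 c"
      unfolding P0_def
    proof
      fix y assume "y \<in> cell_set c"
      then have "g y v = 0" using gQ[of y] c(3) v by (auto simp: realization_set_def)
      then show "g y v < 1" by simp
    qed
    then show ?thesis using h(2)[of c x] c gQ[OF x] by (simp add: D_def)
  qed
  show ?thesis
  proof (intro exI[of _ "\<lambda>x. away v (h (unscale m N x))"] conjI ballI)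
    have "fin_map (big_cube m N) (\<lambda>x. away v (h x))" by (rule away_fin_map[OF h(1) hR(2)])
    then show "fin_map (std_cube m) (\<lambda>x. away v (h (unscale m N x)))"
      by (rule fin_map_compose[OF _ continuous_on_unscale]) (use unscale_big_cube in blast)
    show "away v (h (unscale m N x)) \<in> realization_set Q" if "x \<in> std_cube m" for x
      using away_realization(1)[OF hR, OF unscale_big_cube unscale_big_cube, OF that that] v by simp
    show "away v (h (unscale m N x)) = F x" if "x \<in> cube_bd m" for x
    proof -
      have "h (unscale m N x) = g (unscale m N x)" "g (unscale m N x) \<in> realization_set Q"
        using hbd[OF unscale_big_bd[OF that]] by simp_all
      then have "away v (h (unscale m N x)) = g (unscale m N x)" using away_id v by metis
      also have "\<dots> = F x"
        using rescale_unscale[OF N(1), of x m] that cube_bd_subset[of m] by (auto simp: g_def)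
      finally show ?thesis .
    qed
  qed
qed

definition antichain :: "'a set set \<Rightarrow> bool" where
  "antichain V \<longleftrightarrow> (\<forall>v\<in>V. \<forall>w\<in>V. \<not> v \<subset> w)"

text \<open>An antichain can be added one element at a time: the earlier elements do not enter the
  link of the next.\<close>

lemma link_antichain: "antichain (insert v F) \<Longrightarrow> link (Q \<union> F) v = link Q v"
  unfolding link_def antichain_def by blast

lemma fin_map_realization_vertices:
  assumes "fin_map C g" "\<And>x. x \<in> C \<Longrightarrow> g x \<in> realization_set Q"
  obtains F where "finite F" "F \<subseteq> Q" "\<And>x. x \<in> C \<Longrightarrow> g x \<in> realization_set F"
proof -
  obtain F where F: "finite F" "\<And>x b. x \<in> C \<Longrightarrow> b \<notin> F \<Longrightarrow> g x b = 0"
    using assms(1) by (rule fin_mapE) blast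
  have "g x \<in> realization_set (F \<inter> Q)" if "x \<in> C" for x
    using assms(2)[OF that] F(2)[OF that] unfolding realization_set_def by auto
  then show thesis using that[of "F \<inter> Q"] F(1) by simp
qed

text \<open>\<open>V\<close> may be infinite, but a given boundary map uses finitely many of its
  elements.\<close>

lemma poset_connected_Un_antichain:
  assumes Q: "poset_connected n Q" and V: "antichain V" "V \<inter> Q = {}"
    and lk: "\<And>v. v \<in> V \<Longrightarrow> poset_connected (n - 1) (link Q v)"
  shows "poset_connected n (Q \<union> V)"
proof -
  have fin: "poset_connected n (Q \<union> F)" if "finite F" "F \<subseteq> V" for F
    using that
  proof (induction F)
    case empty
    then show ?case using Q by simp
  next
    case (insert v F)
    have "antichain (insert v F)" using V(1) insert.prems unfolding antichain_def by blast
    then have "poset_connected (n - 1) (link (Q \<union> F) v)"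
      using lk[of v] insert.prems by (simp add: link_antichain)
    then have "poset_connected n (insert v (Q \<union> F))"
      using insert V(2) by (intro poset_connected_insert) auto
    then show ?case by simp
  qed
  show ?thesis
    unfolding poset_connected_def
  proof (intro allI impI)
    fix d assume d: "int d \<le> n + 1"
    show "cube_fillable d (realization_set (Q \<union> V))"
    proof (rule fillableI)
      fix g assume g: "fin_map (cube_bd d) g" "\<And>x. x \<in> cube_bd d \<Longrightarrow> g x \<in> realization_set (Q \<union> V)"
      obtain F where F: "finite F" "F \<subseteq> Q \<union> V" "\<And>x. x \<in> cube_bd d \<Longrightarrow> g x \<in> realization_set F"
        using fin_map_realization_vertices[OF g] by metis
      have "realization_set F \<subseteq> realization_set (Q \<union> (F \<inter> V))" using F(2) by (intro realization_set_mono) auto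
      then have gF: "g x \<in> realization_set (Q \<union> (F \<inter> V))" if "x \<in> cube_bd d" for x using F(3)[OF that] by blast
      have "cube_fillable d (realization_set (Q \<union> (F \<inter> V)))"
        using fin[of "F \<inter> V"] F(1) d by (simp add: poset_connected_def)
      from fillableE[OF this g(1) gF] obtain h where h: "fin_map (std_cube d) h"
        "\<And>x. x \<in> std_cube d \<Longrightarrow> h x \<in> realization_set (Q \<union> (F \<inter> V))" "\<And>x. x \<in> cube_bd d \<Longrightarrow> h x = g x" by metis
      have "realization_set (Q \<union> (F \<inter> V)) \<subseteq> realization_set (Q \<union> V)" by (intro realization_set_mono) auto
      then show "\<exists>h. fin_map (std_cube d) h \<and> (\<forall>x\<in>std_cube d. h x \<in> realization_set (Q \<union> V)) \<and> (\<forall>x\<in>cube_bd d. h x = g x)"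
        using h by (intro exI[of _ h]) auto
    qed
  qed
qed

text \<open>A filling in the larger poset uses finitely many elements of \<open>V\<close>; it is
  pushed off them one by one, with its boundary fixed.\<close>

lemma poset_connected_remove_antichain:
  assumes Q: "poset_connected n (Q \<union> V)" and V: "antichain V" "V \<inter> Q = {}"
    and lk: "\<And>v. v \<in> V \<Longrightarrow> poset_connected n (link Q v)"
  shows "poset_connected n Q"
  unfolding poset_connected_def
proof (intro allI impI)
  fix d assume d: "int d \<le> n + 1"
  have fin: "\<exists>h. fin_map (std_cube d) h \<and> (\<forall>x\<in>std_cube d. h x \<in> realization_set Q) \<and> (\<forall>x\<in>cube_bd d. h x = g x)"
    if "finite F" "F \<subseteq> V" "\<exists>h. fin_map (std_cube d) h \<and> (\<forall>x\<in>std_cube d. h x \<in> realization_set (Q \<union> F)) \<and> (\<forall>x\<in>cube_bd d. h x = g x)"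
      "\<And>x. x \<in> cube_bd d \<Longrightarrow> g x \<in> realization_set Q" for F g
    using that
  proof (induction F)
    case empty
    then show ?case by simp
  next
    case (insert v F)
    from insert.prems(2) obtain h where h: "fin_map (std_cube d) h"
      "\<And>x. x \<in> std_cube d \<Longrightarrow> h x \<in> realization_set (insert v (Q \<union> F))" "\<And>x. x \<in> cube_bd d \<Longrightarrow> h x = g x"
      by (elim exE conjE) simp
    have "antichain (insert v F)" using V(1) insert.prems(1) unfolding antichain_def by blast
    then have lk': "poset_connected n (link (Q \<union> F) v)"
      using lk[of v] insert.prems by (simp add: link_antichain)
    have "\<exists>k. fin_map (std_cube d) k \<and> (\<forall>x\<in>std_cube d. k x \<in> realization_set (Q \<union> F)) \<and> (\<forall>x\<in>cube_bd d. k x = h x)"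
    proof (rule fill_avoiding_vertex[OF _ _ h(1,2)])
      show "v \<notin> Q \<union> F" using insert V(2) by auto
      show "cube_fillable e (realization_set (link (Q \<union> F) v))" if "e \<le> d" for e
        using lk' that d unfolding poset_connected_def by simp
      show "h x \<in> realization_set (Q \<union> F)" if "x \<in> cube_bd d" for x
        using h(3)[OF that] insert.prems(3)[OF that] realization_set_mono[of Q "Q \<union> F"] by auto
    qed
    then have "\<exists>k. fin_map (std_cube d) k \<and> (\<forall>x\<in>std_cube d. k x \<in> realization_set (Q \<union> F)) \<and> (\<forall>x\<in>cube_bd d. k x = g x)"
      using h(3) by simp
    then show ?case using insert.IH insert.prems by simp
  qed
  show "cube_fillable d (realization_set Q)"
  proof (rule fillableI)
    fix g assume g: "fin_map (cube_bd d) g" "\<And>x. x \<in> cube_bd d \<Longrightarrow> g x \<in> realization_set Q"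
    have gQV: "g x \<in> realization_set (Q \<union> V)" if "x \<in> cube_bd d" for x
      using g(2)[OF that] realization_set_mono[of Q "Q \<union> V"] by auto
    have "cube_fillable d (realization_set (Q \<union> V))" using Q d unfolding poset_connected_def by simp
    from fillableE[OF this g(1) gQV] obtain h where h: "fin_map (std_cube d) h"
      "\<And>x. x \<in> std_cube d \<Longrightarrow> h x \<in> realization_set (Q \<union> V)" "\<And>x. x \<in> cube_bd d \<Longrightarrow> h x = g x" by metis
    obtain F where F: "finite F" "F \<subseteq> Q \<union> V" "\<And>x. x \<in> std_cube d \<Longrightarrow> h x \<in> realization_set F"
      using fin_map_realization_vertices[OF h(1,2)] by metis
    have "realization_set F \<subseteq> realization_set (Q \<union> (F \<inter> V))" using F(2) by (intro realization_set_mono) auto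
    then have "\<exists>h. fin_map (std_cube d) h \<and> (\<forall>x\<in>std_cube d. h x \<in> realization_set (Q \<union> (F \<inter> V))) \<and> (\<forall>x\<in>cube_bd d. h x = g x)"
      using F(3) h(1,3) by (intro exI[of _ h]) auto
    then show "\<exists>h. fin_map (std_cube d) h \<and> (\<forall>x\<in>std_cube d. h x \<in> realization_set Q) \<and> (\<forall>x\<in>cube_bd d. h x = g x)"
      using fin[of "F \<inter> V" g] F(1) g(2) by simp
  qed
qed

section \<open>The weak topology of the realization\<close>

lemma openin_realization:
  "openin (realization Q) U \<longleftrightarrow> U \<subseteq> realization_set Q \<and>
     (\<forall>C. C \<subseteq> Q \<and> finite C \<and> is_chain C \<longrightarrow>
        openin (top_of_set (closed_simplex Q C)) (U \<inter> closed_simplex Q C))" (is "_ \<longleftrightarrow> ?P U")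
proof -
  have "istopology ?P"
    unfolding istopology_def
  proof (intro conjI allI impI)
    fix S T assume S: "?P S" and T: "?P T"
    show "S \<inter> T \<subseteq> realization_set Q" using S by blast
    fix C assume C: "C \<subseteq> Q \<and> finite C \<and> is_chain C"
    have "S \<inter> T \<inter> closed_simplex Q C = (S \<inter> closed_simplex Q C) \<inter> (T \<inter> closed_simplex Q C)" by blast
    then show "openin (top_of_set (closed_simplex Q C)) (S \<inter> T \<inter> closed_simplex Q C)"
      using S T C by (metis openin_Int)
  next
    fix K assume K: "\<forall>S\<in>K. ?P S"
    show "\<Union>K \<subseteq> realization_set Q" using K by blast
    fix C assume C: "C \<subseteq> Q \<and> finite C \<and> is_chain C"
    have "\<Union>K \<inter> closed_simplex Q C = \<Union>((\<lambda>S. S \<inter> closed_simplex Q C) ` K)" by blast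
    then show "openin (top_of_set (closed_simplex Q C)) (\<Union>K \<inter> closed_simplex Q C)"
      using K C by (simp only:) (intro openin_Union, blast)
  qed
  then show ?thesis
    by (simp add: realization_def topology_inverse' euclidean_product_topology)
qed

lemma topspace_realization: "topspace (realization Q) = realization_set Q"
proof
  show "topspace (realization Q) \<subseteq> realization_set Q"
    using openin_topspace[of "realization Q"] unfolding openin_realization by blast
  have "realization_set Q \<inter> closed_simplex Q C = closed_simplex Q C" for C
    by (auto simp: closed_simplex_def)
  then have "openin (realization Q) (realization_set Q)"
    unfolding openin_realization by simp
  then show "realization_set Q \<subseteq> topspace (realization Q)" by (rule openin_subset)
qed

lemma closed_simplex_eq:
  assumes "finite C" "C \<subseteq> Q" "is_chain C"
  shows "closed_simplex Q C = {f. (\<forall>x. 0 \<le> f x) \<and> (\<forall>x\<in>-C. f x = 0) \<and> sum f C = 1}"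
proof (intro equalityI subsetI)
  fix f assume "f \<in> closed_simplex Q C"
  then have f: "f \<in> realization_set Q" "{x. f x \<noteq> 0} \<subseteq> C" by (auto simp: closed_simplex_def)
  have "sum f C = sum f {x. f x \<noteq> 0}" by (rule sum.mono_neutral_right[OF assms(1) f(2)]) auto
  then show "f \<in> {f. (\<forall>x. 0 \<le> f x) \<and> (\<forall>x\<in>-C. f x = 0) \<and> sum f C = 1}"
    using f by (auto simp: realization_set_def)
next
  fix f :: "'a set \<Rightarrow> real" assume "f \<in> {f. (\<forall>x. 0 \<le> f x) \<and> (\<forall>x\<in>-C. f x = 0) \<and> sum f C = 1}"
  then show "f \<in> closed_simplex Q C"
    using assms realization_setI[of C Q f] by (auto simp: closed_simplex_def)
qed

lemma closed_closed_simplex: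
  assumes "finite C" "C \<subseteq> Q" "is_chain C"
  shows "closed (closed_simplex Q C)"
proof -
  have c: "continuous_on UNIV (\<lambda>f::'a set \<Rightarrow> real. f x)" for x by (rule continuous_on_product_coordinates)
  have "closed_simplex Q C = (\<Inter>x. {f. 0 \<le> f x}) \<inter> (\<Inter>x\<in>-C. {f. f x = 0}) \<inter> {f. sum f C = 1}"
    unfolding closed_simplex_eq[OF assms] by blast
  moreover have "closed {f::'a set \<Rightarrow> real. 0 \<le> f x}" "closed {f::'a set \<Rightarrow> real. f x = 0}" for x
    by (intro closed_Collect_le closed_Collect_eq continuous_on_const c)+
  moreover have "closed {f::'a set \<Rightarrow> real. sum f C = 1}"
    by (intro closed_Collect_eq continuous_on_const continuous_on_sum c)
  ultimately show ?thesis by (simp only:) (intro closed_Int closed_INT ballI)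
qed

lemma finite_functions_closed:
  fixes T :: "('b \<Rightarrow> real) set"
  assumes "finite T"
  shows "closed T"
proof -
  have "closed {f}" for f :: "'b \<Rightarrow> real"
  proof -
    have "{f} = (\<Inter>x. {k. k x = f x})" by auto
    moreover have "closed {k. k x = f x}" for x
      by (intro closed_Collect_eq continuous_on_const continuous_on_product_coordinates)
    ultimately show ?thesis by (simp only:) (intro closed_INT ballI)
  qed
  moreover have "T = (\<Union>f\<in>T. {f})" by simp
  ultimately show ?thesis using assms by (metis closed_UN)
qed

text \<open>Choose for every vertex that occurs a point of \<open>K\<close> with weight there. A
  simplex contains only finitely many of the chosen points, so every set of them is weakly closed.
  If infinitely many vertices occurred, the chosen points would form an infinite closed discrete
  subset of a compact set.\<close>

lemma compactin_realization_finite_vertices: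
  assumes K: "compactin (realization Q) K"
  shows "finite (\<Union>f\<in>K. {b. f b \<noteq> 0})"
proof (rule ccontr)
  assume inf: "infinite (\<Union>f\<in>K. {b. f b \<noteq> 0})"
  define V where "V = (\<Union>f\<in>K. {b. f b \<noteq> 0})"
  have KQ: "K \<subseteq> realization_set Q" using compactin_subset_topspace[OF K] by (simp add: topspace_realization)
  have "\<forall>b\<in>V. \<exists>f. f \<in> K \<and> f b \<noteq> 0" by (auto simp: V_def)
  then obtain y where y: "\<forall>b\<in>V. y b \<in> K \<and> y b b \<noteq> 0" by (rule bchoice[THEN exE])
  define Y where "Y = y ` V"
  have YK: "Y \<subseteq> K" using y by (auto simp: Y_def)
  \<comment> \<open>The choice \<open>y\<close> need not be injective, but a single point accounts
    for finitely many vertices only.\<close>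
  have "infinite Y"
  proof
    assume "finite Y"
    have "finite {b. f b \<noteq> 0}" if "f \<in> Y" for f using that YK KQ by (auto simp: realization_set_def)
    then have "finite (\<Union>f\<in>Y. {b. f b \<noteq> 0})" using \<open>finite Y\<close> by simp
    moreover have "V \<subseteq> (\<Union>f\<in>Y. {b. f b \<noteq> 0})" using y by (auto simp: Y_def)
    ultimately show False using inf finite_subset by (auto simp: V_def)
  qed
  have op: "openin (realization Q) (realization_set Q - T)" if T: "T \<subseteq> Y" for T
    unfolding openin_realization
  proof (intro conjI allI impI)
    fix C assume C: "C \<subseteq> Q \<and> finite C \<and> is_chain C"
    have "T \<inter> closed_simplex Q C \<subseteq> y ` C"
    proof
      fix f assume f: "f \<in> T \<inter> closed_simplex Q C"
      then obtain b where b: "b \<in> V" "f = y b" using T by (auto simp: Y_def)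
      then have "b \<in> C" using y f by (auto simp: closed_simplex_def)
      then show "f \<in> y ` C" using b by simp
    qed
    then have "finite (T \<inter> closed_simplex Q C)" using C finite_subset by blast
    then have "closed (T \<inter> closed_simplex Q C)" by (rule finite_functions_closed)
    moreover have "(realization_set Q - T) \<inter> closed_simplex Q C = closed_simplex Q C - (T \<inter> closed_simplex Q C)"
      by (auto simp: closed_simplex_def)
    ultimately show "openin (top_of_set (closed_simplex Q C)) ((realization_set Q - T) \<inter> closed_simplex Q C)"
      by (simp add: openin_diff closed_subset)
  qed simp
  \<comment> \<open>For \<open>z\<close> in \<open>Y\<close> this open set contains no point of
    \<open>Y\<close> except \<open>z\<close>, so a finite subcover makes \<open>Y\<close>
    finite.\<close>
  define O' where "O' z = realization_set Q - (Y - {z})" for z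
  have "K \<subseteq> \<Union>(O' ` Y)"
  proof
    fix p assume p: "p \<in> K"
    obtain z where "z \<in> Y" using \<open>infinite Y\<close> by (metis ex_in_conv finite.emptyI)
    show "p \<in> \<Union>(O' ` Y)"
    proof (cases "p \<in> Y")
      case True
      then show ?thesis using p KQ by (auto simp: O'_def)
    next
      case False
      then show ?thesis using p KQ \<open>z \<in> Y\<close> by (auto simp: O'_def)
    qed
  qed
  moreover have "openin (realization Q) U" if "U \<in> O' ` Y" for U
    using that op by (auto simp: O'_def)
  ultimately obtain G where G: "finite G" "G \<subseteq> O' ` Y" "K \<subseteq> \<Union>G"
    using K unfolding compactin_def by meson
  then obtain Z where Z: "Z \<subseteq> Y" "finite Z" "G = O' ` Z" by (meson finite_subset_image)
  have "Y \<subseteq> Z"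
  proof
    fix z assume "z \<in> Y"
    then obtain w where "w \<in> Z" "z \<in> O' w" using YK G(3) Z(3) by blast
    then show "z \<in> Z" using \<open>z \<in> Y\<close> by (auto simp: O'_def)
  qed
  then show False using \<open>infinite Y\<close> Z(2) finite_subset by blast
qed

text \<open>Compactness yields the finite support. A single weight is weakly continuous because it
  is continuous on every closed simplex.\<close>

lemma fin_map_of_continuous_map:
  assumes S: "compact S" and g: "continuous_map (top_of_set S) (realization Q) g"
  shows "fin_map S g" "\<And>x. x \<in> S \<Longrightarrow> g x \<in> realization_set Q"
proof -
  show "g x \<in> realization_set Q" if "x \<in> S" for x
    using continuous_map_image_subset_topspace[OF g] that by (auto simp: topspace_realization)
  have "compactin (realization Q) (g ` S)"
    by (rule image_compactin[OF _ g]) (simp add: S compactin_subtopology)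
  then have "finite (\<Union>x\<in>S. {b. g x b \<noteq> 0})"
    using compactin_realization_finite_vertices by fastforce
  then show "fin_map S g"
  proof (rule fin_mapI[rotated])
    fix b
    have "continuous_map (realization Q) euclideanreal (\<lambda>f. f b)"
      unfolding continuous_map_def
    proof (intro conjI allI impI)
      fix U :: "real set" assume U: "openin euclideanreal U"
      show "openin (realization Q) {f \<in> topspace (realization Q). f b \<in> U}"
        unfolding openin_realization topspace_realization
      proof (intro conjI allI impI)
        fix C
        have "open ((\<lambda>f. f b) -` U)"
          using U by (intro open_vimage) (auto simp: continuous_on_product_coordinates)
        moreover have "{f \<in> realization_set Q. f b \<in> U} \<inter> closed_simplex Q C
            = closed_simplex Q C \<inter> ((\<lambda>f. f b) -` U)" by (auto simp: closed_simplex_def)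
        ultimately show "openin (top_of_set (closed_simplex Q C)) ({f \<in> realization_set Q. f b \<in> U} \<inter> closed_simplex Q C)"
          by (simp add: openin_open_Int)
      qed blast
    qed simp
    from continuous_map_compose[OF g this] show "continuous_on S (\<lambda>x. g x b)"
      by (simp add: o_def)
  qed auto
qed

text \<open>Only finitely many chains can occur as supports, so the preimage of a weakly closed set
  is a finite union of closed sets, one for each simplex.\<close>

lemma continuous_map_of_fin_map:
  assumes k: "fin_map S k" "\<And>x. x \<in> S \<Longrightarrow> k x \<in> realization_set Q"
  shows "continuous_map (top_of_set S) (realization Q) k"
  unfolding continuous_map_closedin
proof (intro conjI allI impI ballI)
  show "k \<in> topspace (top_of_set S) \<rightarrow> topspace (realization Q)"
    using k(2) by (simp add: topspace_realization)
  fix T assume T: "closedin (realization Q) T"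
  obtain F where F: "finite F" "\<And>x b. x \<in> S \<Longrightarrow> b \<notin> F \<Longrightarrow> k x b = 0"
    using k(1) by (rule fin_mapE) blast
  define \<C> where "\<C> = {C. C \<subseteq> F \<inter> Q \<and> is_chain C}"
  have fin: "finite \<C>" using F(1) by (intro finite_subset[of \<C> "Pow F"]) (auto simp: \<C>_def)
  have cl: "closed (T \<inter> closed_simplex Q C)" if "C \<in> \<C>" for C
  proof -
    have C: "C \<subseteq> Q" "finite C" "is_chain C" using that F(1) finite_subset by (auto simp: \<C>_def)
    have "openin (realization Q) (realization_set Q - T)" using T by (simp add: closedin_def topspace_realization)
    then have "openin (top_of_set (closed_simplex Q C)) ((realization_set Q - T) \<inter> closed_simplex Q C)"
      using C unfolding openin_realization by blast
    then have "closedin (top_of_set (closed_simplex Q C)) (closed_simplex Q C - (realization_set Q - T) \<inter> closed_simplex Q C)"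
      by (metis closedin_diff closedin_topspace topspace_euclidean_subtopology)
    moreover have "closed_simplex Q C - (realization_set Q - T) \<inter> closed_simplex Q C = T \<inter> closed_simplex Q C"
      by (auto simp: closed_simplex_def)
    ultimately show ?thesis
      using closed_closed_simplex[OF C(2,1,3)] closedin_closed_trans by metis
  qed
  have "{x \<in> topspace (top_of_set S). k x \<in> T} = (\<Union>C\<in>\<C>. S \<inter> k -` (T \<inter> closed_simplex Q C))"
  proof (intro equalityI subsetI)
    fix x assume "x \<in> {x \<in> topspace (top_of_set S). k x \<in> T}"
    then have x: "x \<in> S" "k x \<in> T" by auto
    have "{b. k x b \<noteq> 0} \<in> \<C>" using k(2)[OF x(1)] F(2)[OF x(1)] by (auto simp: \<C>_def realization_set_def)
    moreover have "k x \<in> closed_simplex Q {b. k x b \<noteq> 0}" using k(2)[OF x(1)] by (simp add: closed_simplex_def)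
    ultimately show "x \<in> (\<Union>C\<in>\<C>. S \<inter> k -` (T \<inter> closed_simplex Q C))" using x by blast
  qed auto
  moreover have "closedin (top_of_set S) (\<Union>C\<in>\<C>. S \<inter> k -` (T \<inter> closed_simplex Q C))"
  proof (intro closedin_Union)
    show "finite ((\<lambda>C. S \<inter> k -` (T \<inter> closed_simplex Q C)) ` \<C>)" using fin by simp
    fix A assume "A \<in> (\<lambda>C. S \<inter> k -` (T \<inter> closed_simplex Q C)) ` \<C>"
    then obtain C where C: "C \<in> \<C>" "A = S \<inter> k -` (T \<inter> closed_simplex Q C)" by blast
    have "continuous_on S k" using k(1) by (simp add: fin_map_def)
    then show "closedin (top_of_set S) A"
      unfolding C(2) by (rule continuous_closedin_preimage[OF _ cl[OF C(1)]])
  qed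
  ultimately show "closedin (top_of_set S) {x \<in> topspace (top_of_set S). k x \<in> T}" by simp
qed

section \<open>Spheres and disks in place of cubes\<close>

definition l2 :: "nat \<Rightarrow> (nat \<Rightarrow> real) \<Rightarrow> real" where
  "l2 n x = sqrt (\<Sum>i<n. (x i)\<^sup>2)"

lemma continuous_on_l2: "continuous_on C (l2 n)"
  unfolding l2_def by (intro continuous_on_real_sqrt continuous_on_sum continuous_on_power continuous_on_coord)

lemma l2_scale: "l2 n (\<lambda>i. c * x i) = \<bar>c\<bar> * l2 n x"
proof -
  have "(\<Sum>i<n. (c * x i)\<^sup>2) = c\<^sup>2 * (\<Sum>i<n. (x i)\<^sup>2)" by (simp add: power_mult_distrib sum_distrib_left)
  then show ?thesis by (simp add: l2_def real_sqrt_mult)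
qed

lemma sup_norm_le_l2: "sup_norm n x \<le> l2 n x"
proof (cases "n = 0")
  case False
  then obtain i where i: "i < n" "sup_norm n x = \<bar>x i\<bar>" using sup_norm_attained by blast
  have "(x i)\<^sup>2 \<le> (\<Sum>i<n. (x i)\<^sup>2)" using i(1) by (intro member_le_sum) auto
  then have "sqrt ((x i)\<^sup>2) \<le> l2 n x" unfolding l2_def by (rule real_sqrt_le_mono)
  then show ?thesis using i(2) by simp
qed (simp add: l2_def)

text \<open>If all coordinates were below \<open>1 / (n + 1)\<close>, the squares would add up to at
  most \<open>n / (n + 1)^2\<close>, which is less than 1. The shift by 1 keeps the denominator
  positive for \<open>n = 0\<close>.\<close>

lemma sup_norm_sphere:
  assumes "(\<Sum>i<n. (x i)\<^sup>2) = 1"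
  shows "1 / (real n + 1) \<le> sup_norm n x"
proof (rule ccontr)
  assume "\<not> ?thesis"
  then have lt: "sup_norm n x < 1 / (real n + 1)" by simp
  have "(\<Sum>i<n. (x i)\<^sup>2) \<le> (\<Sum>i<n. (1 / (real n + 1))\<^sup>2)"
  proof (rule sum_mono)
    fix i assume "i \<in> {..<n}"
    then have "\<bar>x i\<bar> \<le> 1 / (real n + 1)" using abs_le_sup_norm[of i n x] lt by simp
    then show "(x i)\<^sup>2 \<le> (1 / (real n + 1))\<^sup>2" by (simp flip: abs_le_square_iff)
  qed
  also have "\<dots> = real n / (real n + 1)\<^sup>2" by (simp add: power_divide)
  also have "\<dots> < 1"
  proof -
    have "real n < (real n + 1)\<^sup>2" by (simp add: power2_eq_square algebra_simps add_strict_increasing)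
    then show ?thesis by (simp add: divide_less_eq)
  qed
  finally show False using assms by simp
qed

text \<open>Cube and disk are compared by radial maps: \<open>p\<close> takes the cube boundary to
  the sphere, \<open>\<phi>\<close> the disk into the cube, and \<open>p (\<phi> x) = x\<close> on
  the sphere is all that the extension requires of them on the boundary.\<close>

theorem poset_connected_imp_k_connected:
  assumes "poset_connected n Q" "k \<le> n"
  shows "k_connected k (realization Q)"
  unfolding k_connected_def
proof (intro allI impI)
  fix m g assume m: "int m \<le> k + 1" and g: "continuous_map (std_sphere m) (realization Q) g"
  define S where "S = {x::nat\<Rightarrow>real. (\<forall>i\<ge>m. x i = 0) \<and> (\<Sum>i<m. (x i)\<^sup>2) = 1}"
  define D where "D = {x::nat\<Rightarrow>real. (\<forall>i\<ge>m. x i = 0) \<and> (\<Sum>i<m. (x i)\<^sup>2) \<le> 1}"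
  have sph: "std_sphere m = top_of_set S" by (simp add: std_sphere_def S_def euclidean_product_topology)
  have dsk: "std_disk m = top_of_set D" by (simp add: std_disk_def D_def euclidean_product_topology)
  have l2S: "l2 m x = 1" if "x \<in> S" for x using that by (simp add: S_def l2_def)
  have "S \<subseteq> std_cube m"
  proof
    fix x assume x: "x \<in> S"
    then have "sup_norm m x \<le> 1" using sup_norm_le_l2[of m x] l2S[OF x] by simp
    then show "x \<in> std_cube m" using x by (simp add: std_cube_iff S_def)
  qed
  moreover have "closed S"
  proof -
    have "S = (\<Inter>i\<in>{m..}. {x. x i = 0}) \<inter> {x. (\<Sum>i<m. (x i)\<^sup>2) = 1}" unfolding S_def by auto
    moreover have "closed {x::nat\<Rightarrow>real. x i = 0}" for i
      by (intro closed_Collect_eq continuous_on_const continuous_on_coord)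
    moreover have "closed {x::nat\<Rightarrow>real. (\<Sum>i<m. (x i)\<^sup>2) = 1}"
      by (intro closed_Collect_eq continuous_on_const continuous_on_sum continuous_on_power continuous_on_coord)
    ultimately show ?thesis by (simp only:) (intro closed_Int closed_INT ballI)
  qed
  ultimately have compS: "compact S"
    using compact_Int_closed[OF compact_std_cube[of m]] by (metis inf.absorb_iff2)
  note gS = fin_map_of_continuous_map[OF compS g[unfolded sph]]
  define p where "p y = (\<lambda>i. inverse (l2 m y) * y i)" for y
  have l2pos: "1 \<le> l2 m y" if "y \<in> cube_bd m" for y
    using that sup_norm_le_l2[of m y] by (auto simp: cube_bd_iff)
  have pS: "p y \<in> S" if "y \<in> cube_bd m" for y
  proof -
    have "l2 m (p y) = 1" unfolding p_def l2_scale using l2pos[OF that] by simp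
    then have "(\<Sum>i<m. (p y i)\<^sup>2) = 1" by (simp add: l2_def)
    then show ?thesis using that by (auto simp: S_def p_def cube_bd_iff)
  qed
  have pc: "continuous_on (cube_bd m) p"
    unfolding p_def
    by (intro continuous_on_coordinatewise_then_product continuous_on_mult continuous_on_inverse
        continuous_on_l2 continuous_on_coord) (use l2pos in force)
  have "fin_map (cube_bd m) (\<lambda>y. g (p y))"
    by (rule fin_map_compose[OF gS(1) pc]) (use pS in blast)
  moreover have "cube_fillable m (realization_set Q)"
    using assms m unfolding poset_connected_def by simp
  ultimately obtain h where h: "fin_map (std_cube m) h" "\<And>x. x \<in> std_cube m \<Longrightarrow> h x \<in> realization_set Q"
    "\<And>x. x \<in> cube_bd m \<Longrightarrow> h x = g (p x)"
    using fillableE[of "std_cube m" "cube_bd m" "realization_set Q" "\<lambda>y. g (p y)"] gS(2)[OF pS] by metis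
  \<comment> \<open>Division by the sup norm alone fails at the origin. The cut-off restores
    continuity there and, by \<open>sup_norm_sphere\<close>, is inactive on the sphere.\<close>
  define \<phi> where "\<phi> x = (\<lambda>i. inverse (max (sup_norm m x) (1 / (real m + 1))) * x i)" for x
  have mpos: "0 < max (sup_norm m x) (1 / (real m + 1))" for x by (simp add: less_max_iff_disj)
  have \<phi>c: "continuous_on D \<phi>"
    unfolding \<phi>_def
    by (intro continuous_on_coordinatewise_then_product continuous_on_mult continuous_on_inverse
        continuous_on_max continuous_on_const continuous_on_sup_norm continuous_on_coord)
      (use mpos in \<open>simp add: less_imp_neq[THEN not_sym]\<close>)
  have \<phi>D: "\<phi> x \<in> std_cube m" if "x \<in> D" for x
  proof -
    have "sup_norm m (\<phi> x) = inverse (max (sup_norm m x) (1 / (real m + 1))) * sup_norm m x"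
      unfolding \<phi>_def sup_norm_scale using mpos[of x] by simp
    also have "\<dots> \<le> 1" using mpos[of x] by (simp add: field_simps)
    finally show ?thesis using that by (simp add: std_cube_iff D_def \<phi>_def)
  qed
  have \<phi>S: "\<phi> x \<in> cube_bd m" "p (\<phi> x) = x" if "x \<in> S" for x
  proof -
    have s: "1 / (real m + 1) \<le> sup_norm m x" using that by (intro sup_norm_sphere) (simp add: S_def)
    then have pos: "0 < sup_norm m x" by (rule less_le_trans[rotated]) simp
    have \<phi>x: "\<phi> x = (\<lambda>i. inverse (sup_norm m x) * x i)" using s by (simp add: \<phi>_def max_absorb1)
    then have "sup_norm m (\<phi> x) = 1" using pos by (simp add: sup_norm_scale)
    then show "\<phi> x \<in> cube_bd m" using that by (simp add: cube_bd_iff S_def \<phi>_def)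
    have "l2 m (\<phi> x) = inverse (sup_norm m x)" using l2S[OF that] pos by (simp add: \<phi>x l2_scale)
    then show "p (\<phi> x) = x" using pos by (simp add: p_def \<phi>x flip: mult.assoc)
  qed
  show "\<exists>h. continuous_map (std_disk m) (realization Q) h \<and> (\<forall>x\<in>topspace (std_sphere m). h x = g x)"
  proof (intro exI[of _ "\<lambda>x. h (\<phi> x)"] conjI ballI)
    show "continuous_map (std_disk m) (realization Q) (\<lambda>x. h (\<phi> x))"
      unfolding dsk
      by (rule continuous_map_of_fin_map[OF fin_map_compose[OF h(1) \<phi>c]]) (use \<phi>D h(2) in auto)
    show "h (\<phi> x) = g x" if "x \<in> topspace (std_sphere m)" for x
      using that \<phi>S[of x] h(3)[of "\<phi> x"] by (simp add: sph)
  qed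
qed

section \<open>Combinatorial connectivity of posets\<close>

text \<open>A bounded rank, so that elements can be processed in finitely many antichain layers even
  if there are infinitely many of them. For subspaces the rank is the dimension.\<close>

definition finite_height :: "'a set set \<Rightarrow> bool" where
  "finite_height X \<longleftrightarrow> (\<exists>r N. \<forall>x\<in>X. r x < (N::nat) \<and> (\<forall>y\<in>X. x \<subset> y \<longrightarrow> r x < r y))"

lemma finite_height_subset: "finite_height X \<Longrightarrow> Y \<subseteq> X \<Longrightarrow> finite_height Y"
  unfolding finite_height_def by (meson subsetD)

text \<open>The two rules without cone point or gluing record \<open>finite_height\<close>, because
  in a join their elements are added layer by layer.\<close>

inductive iconn :: "int \<Rightarrow> 'a set set \<Rightarrow> bool" where
  low: "n \<le> -2 \<Longrightarrow> finite_height Q \<Longrightarrow> iconn n Q"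
| nonempty: "x \<in> Q \<Longrightarrow> finite_height Q \<Longrightarrow> iconn (-1) Q"
| cone: "p \<in> Q \<Longrightarrow> (\<And>z. z \<in> Q \<Longrightarrow> z \<subseteq> p \<or> p \<subseteq> z) \<Longrightarrow> iconn n Q"
| glue: "iconn n Q \<Longrightarrow> antichain V \<Longrightarrow> V \<inter> Q = {} \<Longrightarrow> (\<And>v. v \<in> V \<Longrightarrow> iconn (n - 1) (link Q v)) \<Longrightarrow>
    iconn n (Q \<union> V)"

lemma iconn_mono: "iconn n Q \<Longrightarrow> m \<le> n \<Longrightarrow> iconn m Q"
proof (induction arbitrary: m rule: iconn.induct)
  case (low n Q)
  then show ?case by (intro iconn.low) auto
next
  case (nonempty x Q)
  then show ?case by (cases "m = -1") (auto intro: iconn.low iconn.nonempty)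
next
  case (cone p Q n)
  then show ?case by (intro iconn.cone[of p])
next
  case (glue n Q V)
  then show ?case by (intro iconn.glue) auto
qed

lemma iconn_imp_poset_connected: "iconn n Q \<Longrightarrow> poset_connected n Q"
proof (induction rule: iconn.induct)
  case (low n Q)
  then show ?case by (simp add: poset_connected_def)
next
  case (nonempty x Q)
  have "cube_fillable 0 (realization_set Q)"
  proof (rule fillableI)
    fix g :: "(nat \<Rightarrow> real) \<Rightarrow> 'a set \<Rightarrow> real"
    have "cube_bd 0 = {}" by (simp add: cube_bd_def)
    then show "\<exists>h. fin_map (std_cube 0) h \<and> (\<forall>x\<in>std_cube 0. h x \<in> realization_set Q) \<and> (\<forall>x\<in>cube_bd 0. h x = g x)"
      using vertex_point_realization[OF nonempty(1)] by (intro exI[of _ "\<lambda>_. vertex_point x"]) (simp add: fin_map_vertex_point)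
  qed
  then show ?case by (simp add: poset_connected_def)
next
  case (cone p Q n)
  then show ?case unfolding poset_connected_def by (intro allI impI cone_fillable[of p])
next
  case (glue n Q V)
  then show ?case by (intro poset_connected_Un_antichain)
qed

text \<open>\<open>\<rho>\<close> only has to separate comparable elements of \<open>Z\<close>, so
  that its levels are antichains. It may increase or decrease along the order, which yields the two
  orders of insertion.\<close>

lemma iconn_layers:
  fixes \<rho> :: "'a set \<Rightarrow> nat"
  assumes Y: "iconn n Y" and dis: "Y \<inter> Z = {}"
    and b: "\<And>x. x \<in> Z \<Longrightarrow> \<rho> x < N"
    and ne: "\<And>x y. x \<in> Z \<Longrightarrow> y \<in> Z \<Longrightarrow> x \<subset> y \<Longrightarrow> \<rho> x \<noteq> \<rho> y"
    and lk: "\<And>x. x \<in> Z \<Longrightarrow> iconn (n - 1) (link (Y \<union> {z \<in> Z. \<rho> z < \<rho> x}) x)"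
  shows "iconn n (Y \<union> Z)"
proof -
  have "iconn n (Y \<union> {z \<in> Z. \<rho> z < k})" for k
  proof (induction k)
    case 0
    then show ?case using Y by simp
  next
    case (Suc k)
    have "iconn n ((Y \<union> {z \<in> Z. \<rho> z < k}) \<union> {z \<in> Z. \<rho> z = k})"
    proof (rule iconn.glue[OF Suc])
      show "antichain {z \<in> Z. \<rho> z = k}" unfolding antichain_def using ne by (metis (mono_tags, lifting) mem_Collect_eq)
      show "{z \<in> Z. \<rho> z = k} \<inter> (Y \<union> {z \<in> Z. \<rho> z < k}) = {}" using dis by auto
      show "iconn (n - 1) (link (Y \<union> {z \<in> Z. \<rho> z < k}) v)" if "v \<in> {z \<in> Z. \<rho> z = k}" for v
        using that lk[of v] by simp
    qed
    moreover have "(Y \<union> {z \<in> Z. \<rho> z < k}) \<union> {z \<in> Z. \<rho> z = k} = Y \<union> {z \<in> Z. \<rho> z < Suc k}" by auto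
    ultimately show ?case by simp
  qed
  from this[of N] b show ?thesis by (metis (mono_tags, lifting) Collect_mem_eq Collect_cong)
qed

text \<open>The levels are peeled off from the highest value of \<open>\<rho>\<close>, so each link
  is taken in the same poset as when the levels are added.\<close>

lemma poset_connected_remove_layers:
  fixes \<rho> :: "'a set \<Rightarrow> nat"
  assumes X: "poset_connected n (Y \<union> Z)" and dis: "Y \<inter> Z = {}"
    and b: "\<And>x. x \<in> Z \<Longrightarrow> \<rho> x < N"
    and ne: "\<And>x y. x \<in> Z \<Longrightarrow> y \<in> Z \<Longrightarrow> x \<subset> y \<Longrightarrow> \<rho> x \<noteq> \<rho> y"
    and lk: "\<And>x. x \<in> Z \<Longrightarrow> poset_connected n (link (Y \<union> {z \<in> Z. \<rho> z < \<rho> x}) x)"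
  shows "poset_connected n Y"
proof -
  have "poset_connected n (Y \<union> {z \<in> Z. \<rho> z < N - k})" for k
  proof (induction k)
    case 0
    have "Y \<union> {z \<in> Z. \<rho> z < N} = Y \<union> Z" using b by auto
    then show ?case using X by simp
  next
    case (Suc k)
    show ?case
    proof (cases "k < N")
      case True
      show ?thesis
      proof (rule poset_connected_remove_antichain[where V = "{z \<in> Z. \<rho> z = N - Suc k}"])
        have "Y \<union> {z \<in> Z. \<rho> z < N - Suc k} \<union> {z \<in> Z. \<rho> z = N - Suc k} = Y \<union> {z \<in> Z. \<rho> z < N - k}"
          using True by auto
        then show "poset_connected n (Y \<union> {z \<in> Z. \<rho> z < N - Suc k} \<union> {z \<in> Z. \<rho> z = N - Suc k})"
          using Suc by simp
        show "antichain {z \<in> Z. \<rho> z = N - Suc k}" unfolding antichain_def using ne by (metis (mono_tags, lifting) mem_Collect_eq)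
        show "{z \<in> Z. \<rho> z = N - Suc k} \<inter> (Y \<union> {z \<in> Z. \<rho> z < N - Suc k}) = {}" using dis by auto
        show "poset_connected n (link (Y \<union> {z \<in> Z. \<rho> z < N - Suc k}) v)" if "v \<in> {z \<in> Z. \<rho> z = N - Suc k}" for v
          using that lk[of v] by simp
      qed
    next
      case False
      then show ?thesis using Suc by simp
    qed
  qed
  from this[of N] show ?thesis by simp
qed

section \<open>Insertion and removal by increasing or decreasing rank\<close>

lemma finite_heightE:
  assumes "finite_height X"
  obtains r :: "'a set \<Rightarrow> nat" and N where "\<And>x. x \<in> X \<Longrightarrow> r x < N" "\<And>x y. x \<in> X \<Longrightarrow> y \<in> X \<Longrightarrow> x \<subset> y \<Longrightarrow> r x < r y"
  using assms unfolding finite_height_def by metis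

lemma link_increasing:
  fixes r :: "'a set \<Rightarrow> nat"
  assumes "\<And>x y. x \<in> X \<Longrightarrow> y \<in> X \<Longrightarrow> x \<subset> y \<Longrightarrow> r x < r y" "Y \<subseteq> X" "x \<in> X - Y"
  shows "link (Y \<union> {z \<in> X - Y. r z < r x}) x = {z \<in> X. z \<subset> x} \<union> {z \<in> Y. x \<subset> z}"
proof (intro equalityI subsetI)
  fix z assume z: "z \<in> link (Y \<union> {z \<in> X - Y. r z < r x}) x"
  show "z \<in> {z \<in> X. z \<subset> x} \<union> {z \<in> Y. x \<subset> z}"
  proof (cases "z \<subset> x")
    case True
    then show ?thesis using z assms(2) by (auto simp: link_def)
  next
    case False
    then have "x \<subset> z" using z by (auto simp: link_def)
    moreover have "\<not> r z < r x" if "z \<in> X" using assms(1)[of x z] assms(3) that \<open>x \<subset> z\<close> by auto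
    ultimately show ?thesis using z by (auto simp: link_def)
  qed
next
  fix z assume "z \<in> {z \<in> X. z \<subset> x} \<union> {z \<in> Y. x \<subset> z}"
  then show "z \<in> link (Y \<union> {z \<in> X - Y. r z < r x}) x"
    using assms(1)[of z x] assms(2,3) by (auto simp: link_def)
qed

lemma link_decreasing:
  fixes r :: "'a set \<Rightarrow> nat"
  assumes "\<And>x. x \<in> X \<Longrightarrow> r x < N" "\<And>x y. x \<in> X \<Longrightarrow> y \<in> X \<Longrightarrow> x \<subset> y \<Longrightarrow> r x < r y" "Y \<subseteq> X" "x \<in> X - Y"
  shows "link (Y \<union> {z \<in> X - Y. N - r z < N - r x}) x = {z \<in> Y. z \<subset> x} \<union> {z \<in> X. x \<subset> z}"
proof (intro equalityI subsetI)
  fix z assume z: "z \<in> link (Y \<union> {z \<in> X - Y. N - r z < N - r x}) x"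
  show "z \<in> {z \<in> Y. z \<subset> x} \<union> {z \<in> X. x \<subset> z}"
  proof (cases "x \<subset> z")
    case True
    then show ?thesis using z assms(3) by (auto simp: link_def)
  next
    case False
    then have "z \<subset> x" using z by (auto simp: link_def)
    moreover have "\<not> N - r z < N - r x" if "z \<in> X" using assms(2)[of z x] assms(4) that \<open>z \<subset> x\<close> by auto
    ultimately show ?thesis using z by (auto simp: link_def)
  qed
next
  fix z assume z: "z \<in> {z \<in> Y. z \<subset> x} \<union> {z \<in> X. x \<subset> z}"
  show "z \<in> link (Y \<union> {z \<in> X - Y. N - r z < N - r x}) x"
  proof (cases "z \<in> Y")
    case True
    then show ?thesis using z by (auto simp: link_def)
  next
    case False
    then have "z \<in> X" "x \<subset> z" using z by auto
    \<comment> \<open>The bound \<open>N\<close> keeps the truncated difference strictly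
      decreasing.\<close>
    then have "r x < r z" "r z < N" using assms(1)[of z] assms(2)[of x z] assms(4) by auto
    then show ?thesis using False \<open>z \<in> X\<close> \<open>x \<subset> z\<close> by (auto simp: link_def)
  qed
qed

text \<open>With smaller elements entering first, \<open>x\<close> finds everything of
  \<open>X\<close> below it, but above it only what belongs to \<open>Y\<close>.\<close>

lemma iconn_add_increasing:
  assumes Y: "iconn n Y" "Y \<subseteq> X" and X: "finite_height X"
    and lk: "\<And>x. x \<in> X - Y \<Longrightarrow> iconn (n - 1) ({z \<in> X. z \<subset> x} \<union> {z \<in> Y. x \<subset> z})"
  shows "iconn n X"
proof -
  obtain r :: "'a set \<Rightarrow> nat" and N where r: "\<And>x. x \<in> X \<Longrightarrow> r x < N" "\<And>x y. x \<in> X \<Longrightarrow> y \<in> X \<Longrightarrow> x \<subset> y \<Longrightarrow> r x < r y"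
    using finite_heightE[OF X] by metis
  have "iconn n (Y \<union> (X - Y))"
  proof (rule iconn_layers[OF Y(1), where \<rho> = r and N = N])
    show "r x \<noteq> r y" if "x \<in> X - Y" "y \<in> X - Y" "x \<subset> y" for x y using r(2)[of x y] that by auto
    show "iconn (n - 1) (link (Y \<union> {z \<in> X - Y. r z < r x}) x)" if "x \<in> X - Y" for x
      using lk[OF that] link_increasing[of X r Y x, OF r(2) Y(2) that] by simp
  qed (use r in auto)
  moreover have "Y \<union> (X - Y) = X" using Y(2) by blast
  ultimately show ?thesis by simp
qed

text \<open>The dual order: all of \<open>X\<close> is present above \<open>x\<close>, and only
  \<open>Y\<close> below it. Which order serves depends on the side on which the part in
  \<open>Y\<close> is understood.\<close>

lemma iconn_add_decreasing:
  assumes Y: "iconn n Y" "Y \<subseteq> X" and X: "finite_height X"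
    and lk: "\<And>x. x \<in> X - Y \<Longrightarrow> iconn (n - 1) ({z \<in> Y. z \<subset> x} \<union> {z \<in> X. x \<subset> z})"
  shows "iconn n X"
proof -
  obtain r :: "'a set \<Rightarrow> nat" and N where r: "\<And>x. x \<in> X \<Longrightarrow> r x < N" "\<And>x y. x \<in> X \<Longrightarrow> y \<in> X \<Longrightarrow> x \<subset> y \<Longrightarrow> r x < r y"
    using finite_heightE[OF X] by metis
  have "iconn n (Y \<union> (X - Y))"
  proof (rule iconn_layers[OF Y(1), where \<rho> = "\<lambda>x. N - r x" and N = "Suc N"])
    show "N - r x \<noteq> N - r y" if "x \<in> X - Y" "y \<in> X - Y" "x \<subset> y" for x y
      using r(2)[of x y] r(1)[of x] r(1)[of y] that by auto
    show "iconn (n - 1) (link (Y \<union> {z \<in> X - Y. N - r z < N - r x}) x)" if "x \<in> X - Y" for x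
      using lk[OF that] link_decreasing[of X r N Y x, OF r Y(2) that] by simp
  qed (use r in auto)
  moreover have "Y \<union> (X - Y) = X" using Y(2) by blast
  ultimately show ?thesis by simp
qed

text \<open>The name refers to the order of insertion that is being reversed: the largest elements
  leave first.\<close>

lemma poset_connected_remove_increasing:
  assumes X: "poset_connected n X" "finite_height X" and Y: "Y \<subseteq> X"
    and lk: "\<And>x. x \<in> X - Y \<Longrightarrow> poset_connected n ({z \<in> X. z \<subset> x} \<union> {z \<in> Y. x \<subset> z})"
  shows "poset_connected n Y"
proof -
  obtain r :: "'a set \<Rightarrow> nat" and N where r: "\<And>x. x \<in> X \<Longrightarrow> r x < N" "\<And>x y. x \<in> X \<Longrightarrow> y \<in> X \<Longrightarrow> x \<subset> y \<Longrightarrow> r x < r y"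
    using finite_heightE[OF X(2)] by metis
  show ?thesis
  proof (rule poset_connected_remove_layers[where Z = "X - Y" and \<rho> = r and N = N])
    have "Y \<union> (X - Y) = X" using Y by blast
    then show "poset_connected n (Y \<union> (X - Y))" using X(1) by simp
    show "r x \<noteq> r y" if "x \<in> X - Y" "y \<in> X - Y" "x \<subset> y" for x y using r(2)[of x y] that by auto
    show "poset_connected n (link (Y \<union> {z \<in> X - Y. r z < r x}) x)" if "x \<in> X - Y" for x
      using lk[OF that] link_increasing[of X r Y x, OF r(2) Y that] by simp
  qed (use r in auto)
qed

lemma poset_connected_remove_decreasing:
  assumes X: "poset_connected n X" "finite_height X" and Y: "Y \<subseteq> X"
    and lk: "\<And>x. x \<in> X - Y \<Longrightarrow> poset_connected n ({z \<in> Y. z \<subset> x} \<union> {z \<in> X. x \<subset> z})"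
  shows "poset_connected n Y"
proof -
  obtain r :: "'a set \<Rightarrow> nat" and N where r: "\<And>x. x \<in> X \<Longrightarrow> r x < N" "\<And>x y. x \<in> X \<Longrightarrow> y \<in> X \<Longrightarrow> x \<subset> y \<Longrightarrow> r x < r y"
    using finite_heightE[OF X(2)] by metis
  show ?thesis
  proof (rule poset_connected_remove_layers[where Z = "X - Y" and \<rho> = "\<lambda>x. N - r x" and N = "Suc N"])
    have "Y \<union> (X - Y) = X" using Y by blast
    then show "poset_connected n (Y \<union> (X - Y))" using X(1) by simp
    show "N - r x \<noteq> N - r y" if "x \<in> X - Y" "y \<in> X - Y" "x \<subset> y" for x y
      using r(2)[of x y] r(1)[of x] r(1)[of y] that by auto
    show "poset_connected n (link (Y \<union> {z \<in> X - Y. N - r z < N - r x}) x)" if "x \<in> X - Y" for x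
      using lk[OF that] link_decreasing[of X r N Y x, OF r Y that] by simp
  qed (use r in auto)
qed

text \<open>\<open>f\<close> is a closure operator: for \<open>x\<close> outside \<open>Y\<close>,
  the element \<open>f x\<close> lies above \<open>x\<close> and below everything of
  \<open>Y\<close> above \<open>x\<close>, so every link is a cone with apex
  \<open>f x\<close>.\<close>

lemma iconn_closure_up:
  assumes Y: "iconn n Y" "Y \<subseteq> X" and X: "finite_height X"
    and f: "\<And>x. x \<in> X \<Longrightarrow> f x \<in> Y" "\<And>x. x \<in> X \<Longrightarrow> x \<subseteq> f x" "\<And>x y. x \<in> X \<Longrightarrow> y \<in> Y \<Longrightarrow> x \<subseteq> y \<Longrightarrow> f x \<subseteq> y"
  shows "iconn n X"
proof (rule iconn_add_increasing[OF Y X])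
  fix x assume x: "x \<in> X - Y"
  show "iconn (n - 1) ({z \<in> X. z \<subset> x} \<union> {z \<in> Y. x \<subset> z})"
    by (rule iconn.cone[of "f x"]) (use f(1)[of x] f(2)[of x] f(3)[of x] x in auto)
qed

lemma iconn_closure_down:
  assumes Y: "iconn n Y" "Y \<subseteq> X" and X: "finite_height X"
    and f: "\<And>x. x \<in> X \<Longrightarrow> f x \<in> Y" "\<And>x. x \<in> X \<Longrightarrow> f x \<subseteq> x" "\<And>x y. x \<in> X \<Longrightarrow> y \<in> Y \<Longrightarrow> y \<subseteq> x \<Longrightarrow> y \<subseteq> f x"
  shows "iconn n X"
proof (rule iconn_add_decreasing[OF Y X])
  fix x assume x: "x \<in> X - Y"
  show "iconn (n - 1) ({z \<in> Y. z \<subset> x} \<union> {z \<in> X. x \<subset> z})"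
    by (rule iconn.cone[of "f x"]) (use f(1)[of x] f(2)[of x] f(3)[of x] x in auto)
qed

text \<open>The link of \<open>x\<close> among \<open>Y\<close> and the elements of lower rank is
  again \<open>Y\<close> with a set below it, so induction on the rank gives it degree
  \<open>b\<close>, more than gluing asks for. This handles a factor of degree at most -2.\<close>

lemma iconn_join_arbitrary:
  assumes Y: "iconn b Y" and XY: "\<And>x y. x \<in> X \<Longrightarrow> y \<in> Y \<Longrightarrow> x \<subset> y" and X: "finite_height X"
  shows "iconn b (X \<union> Y)"
proof -
  obtain r :: "'a set \<Rightarrow> nat" and N where r: "\<And>x. x \<in> X \<Longrightarrow> r x < N" "\<And>x y. x \<in> X \<Longrightarrow> y \<in> X \<Longrightarrow> x \<subset> y \<Longrightarrow> r x < r y"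
    using finite_heightE[OF X] by metis
  have "iconn b (Y \<union> X')" if "X' \<subseteq> X" "\<And>x. x \<in> X' \<Longrightarrow> r x < k" for X' k
    using that
  proof (induction k arbitrary: X')
    case 0
    then have "X' = {}" by auto
    then show ?case using Y by simp
  next
    case (Suc k)
    show ?case
    proof (rule iconn_layers[OF Y, where \<rho> = r and N = "Suc k"])
      show "Y \<inter> X' = {}" using XY Suc.prems(1) by blast
      show "r x \<noteq> r y" if "x \<in> X'" "y \<in> X'" "x \<subset> y" for x y using r(2)[of x y] that Suc.prems(1) by (simp add: subset_iff)
      fix x assume x: "x \<in> X'"
      define W where "W = {z \<in> X'. r z < r x \<and> (z \<subset> x \<or> x \<subset> z)}"
      have "link (Y \<union> {z \<in> X'. r z < r x}) x = Y \<union> W"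
        using XY[of x] x Suc.prems(1) unfolding link_def W_def by blast
      moreover have "iconn b (Y \<union> W)"
        by (rule Suc.IH) (use Suc.prems x in \<open>force simp: W_def\<close>)+
      ultimately show "iconn (b - 1) (link (Y \<union> {z \<in> X'. r z < r x}) x)"
        by (simp add: iconn_mono[of b])
    qed (use Suc.prems in auto)
  qed
  from this[of X N] r(1) show ?thesis by (simp add: Un_commute)
qed

text \<open>Induction over the construction of \<open>X\<close>. A cone point of \<open>X\<close> is
  one of the join, and an element glued to \<open>X\<close> is glued to the join with its link
  enlarged by \<open>Y\<close>. For a nonempty \<open>X\<close> start from the cone over
  \<open>Y\<close> with apex \<open>x0\<close>; every further link is \<open>Y\<close> with elements
  below it.\<close>

lemma iconn_join:
  "iconn a X \<Longrightarrow> iconn b Y \<Longrightarrow> (\<And>x y. x \<in> X \<Longrightarrow> y \<in> Y \<Longrightarrow> x \<subset> y) \<Longrightarrow> iconn (a + b + 2) (X \<union> Y)"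
proof (induction rule: iconn.induct)
  case (low n Q)
  have "iconn b (Q \<union> Y)" by (rule iconn_join_arbitrary) (use low in auto)
  then show ?case by (rule iconn_mono) (use low in simp)
next
  case (nonempty x0 Q)
  obtain r :: "'a set \<Rightarrow> nat" and N where r: "\<And>x. x \<in> Q \<Longrightarrow> r x < N" "\<And>x y. x \<in> Q \<Longrightarrow> y \<in> Q \<Longrightarrow> x \<subset> y \<Longrightarrow> r x < r y"
    using finite_heightE[OF nonempty(2)] by metis
  have "iconn (b + 1) (insert x0 Y \<union> (Q - {x0}))"
  proof (rule iconn_layers[where \<rho> = r and N = N])
    show "iconn (b + 1) (insert x0 Y)"
      by (rule iconn.cone[of x0]) (use nonempty in auto)
    show "insert x0 Y \<inter> (Q - {x0}) = {}" using nonempty(4) by blast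
    show "r x \<noteq> r y" if "x \<in> Q - {x0}" "y \<in> Q - {x0}" "x \<subset> y" for x y using r(2)[of x y] that by auto
    fix x assume x: "x \<in> Q - {x0}"
    define W where "W = {z \<in> Q. (z = x0 \<or> r z < r x) \<and> (z \<subset> x \<or> x \<subset> z)}"
    have "link (insert x0 Y \<union> {z \<in> Q - {x0}. r z < r x}) x = W \<union> Y"
      using nonempty(4)[of x] x nonempty(1) unfolding link_def W_def by blast
    moreover have "iconn b (W \<union> Y)"
    proof (rule iconn_join_arbitrary[OF nonempty(3)])
      show "finite_height W" using nonempty(2) by (rule finite_height_subset) (auto simp: W_def)
    qed (use nonempty(4) in \<open>auto simp: W_def\<close>)
    ultimately show "iconn (b + 1 - 1) (link (insert x0 Y \<union> {z \<in> Q - {x0}. r z < r x}) x)" by simp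
  qed (use r in auto)
  moreover have "insert x0 Y \<union> (Q - {x0}) = Q \<union> Y" using nonempty(1) by blast
  ultimately show ?case by (simp add: add.commute)
next
  case (cone p Q n)
  show ?case by (rule iconn.cone[of p]) (use cone in \<open>auto simp: psubset_eq\<close>)
next
  case (glue n Q V)
  have "iconn (n + b + 2) ((Q \<union> Y) \<union> V)"
  proof (rule iconn.glue)
    show "iconn (n + b + 2) (Q \<union> Y)" using glue.IH(1) glue.prems by blast
    show "antichain V" by fact
    show "V \<inter> (Q \<union> Y) = {}" using glue.hyps(3) glue.prems(2) by blast
    fix v assume v: "v \<in> V"
    have "iconn (n - 1 + b + 2) (link Q v \<union> Y)"
      by (rule glue.IH(2)[OF v glue.prems(1)]) (use glue.prems(2) in \<open>auto simp: link_def\<close>)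
    moreover have "link (Q \<union> Y) v = link Q v \<union> Y" using glue.prems(2)[of v] v unfolding link_def by blast
    ultimately show "iconn (n + b + 2 - 1) (link (Q \<union> Y) v)" by (simp add: algebra_simps)
  qed
  moreover have "(Q \<union> Y) \<union> V = (Q \<union> V) \<union> Y" by blast
  ultimately show ?case by simp
qed

section \<open>Posets of subspaces\<close>

locale subspace_posets = finite_dimensional_vector_space scale Basis
  for scale :: "'a::field \<Rightarrow> 'b::ab_group_add \<Rightarrow> 'b" (infixr "\<odot>" 75) and Basis :: "'b set"
begin

definition ssum :: "'b set \<Rightarrow> 'b set \<Rightarrow> 'b set" where
  "ssum A B = {x + y | x y. x \<in> A \<and> y \<in> B}"

definition adj :: "'b set \<Rightarrow> 'b \<Rightarrow> 'b set" where
  "adj A x = span (insert x A)"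

definition hyperplane :: "'b set \<Rightarrow> 'b set \<Rightarrow> bool" where
  "hyperplane H V \<longleftrightarrow> subspace H \<and> subspace V \<and> H \<subseteq> V \<and> dim V = Suc (dim H)"

lemma ssumI: "x \<in> A \<Longrightarrow> y \<in> B \<Longrightarrow> x + y \<in> ssum A B"
  by (auto simp: ssum_def)

lemma ssumE: "z \<in> ssum A B \<Longrightarrow> (\<And>x y. x \<in> A \<Longrightarrow> y \<in> B \<Longrightarrow> z = x + y \<Longrightarrow> P) \<Longrightarrow> P"
  by (auto simp: ssum_def)

lemma subspace_ssum: "subspace A \<Longrightarrow> subspace B \<Longrightarrow> subspace (ssum A B)"
  unfolding ssum_def by (rule subspace_sums)

lemma ssum_upper: "subspace A \<Longrightarrow> subspace B \<Longrightarrow> A \<subseteq> ssum A B" "subspace A \<Longrightarrow> subspace B \<Longrightarrow> B \<subseteq> ssum A B"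
  using ssumI[of _ A 0 B] ssumI[of 0 A _ B] by (auto simp: subspace_0)

lemma ssum_least: "subspace C \<Longrightarrow> A \<subseteq> C \<Longrightarrow> B \<subseteq> C \<Longrightarrow> ssum A B \<subseteq> C"
  by (auto simp: ssum_def intro: subspace_add)

lemma ssum_mono: "A \<subseteq> A' \<Longrightarrow> B \<subseteq> B' \<Longrightarrow> ssum A B \<subseteq> ssum A' B'"
  by (auto simp: ssum_def)

lemma dim_ssum: "subspace A \<Longrightarrow> subspace B \<Longrightarrow> dim (ssum A B) + dim (A \<inter> B) = dim A + dim B"
  unfolding ssum_def by (rule dim_sums_Int)

lemma subspace_adj: "subspace (adj A x)" by (simp add: adj_def)

lemma adj_upper: "A \<subseteq> adj A x" "x \<in> adj A x"
  by (auto simp: adj_def intro: span_base)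

lemma adj_least: "subspace B \<Longrightarrow> A \<subseteq> B \<Longrightarrow> x \<in> B \<Longrightarrow> adj A x \<subseteq> B"
  unfolding adj_def by (rule span_minimal) auto

lemma mem_adj_iff: "subspace A \<Longrightarrow> y \<in> adj A x \<longleftrightarrow> (\<exists>k. y - k \<odot> x \<in> A)"
  unfolding adj_def span_breakdown_eq by (simp add: span_eq_iff[THEN iffD2])

lemma dim_adj: "subspace A \<Longrightarrow> x \<notin> A \<Longrightarrow> dim (adj A x) = Suc (dim A)"
  unfolding adj_def by (simp add: dim_insert span_eq_iff[THEN iffD2])

lemma dim_strict: "subspace A \<Longrightarrow> subspace B \<Longrightarrow> A \<subset> B \<Longrightarrow> dim A < dim B"
  using dim_psubset[of A B] by (simp add: span_eq_iff[THEN iffD2])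

lemma hyperplane_adj:
  assumes "hyperplane H V" "x \<in> V" "x \<notin> H"
  shows "adj H x = V"
proof (rule subspace_dim_equal)
  show "adj H x \<subseteq> V" using assms by (intro adj_least) (auto simp: hyperplane_def)
  show "dim V \<le> dim (adj H x)" using assms by (simp add: hyperplane_def dim_adj)
qed (use assms in \<open>auto simp: hyperplane_def subspace_adj\<close>)

lemma hyperplaneI: "subspace H \<Longrightarrow> subspace V \<Longrightarrow> H \<subseteq> V \<Longrightarrow> x \<in> V \<Longrightarrow> x \<notin> H \<Longrightarrow> V \<subseteq> adj H x \<Longrightarrow> hyperplane H V"
  using dim_adj[of H x] adj_least[of V H x] by (auto simp: hyperplane_def dest: antisym)

lemma hyperplane_psubset: "hyperplane H V \<Longrightarrow> H \<subset> V"
  by (auto simp: hyperplane_def)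

lemma hyperplane_decomp:
  assumes "hyperplane H V" "x \<in> V" "x \<notin> H" "y \<in> V"
  obtains k where "y - k \<odot> x \<in> H"
  using assms mem_adj_iff[of H y x] hyperplane_adj[OF assms(1-3)] by (auto simp: hyperplane_def)

text \<open>Take \<open>N\<close> maximal among the subspaces over \<open>A\<close> that avoid
  \<open>t\<close> and \<open>s\<close>. By maximality \<open>V\<close> is covered by
  \<open>adj N t\<close> and \<open>adj N s\<close>, so one of these contains \<open>V\<close>; if
  it is the second, it contains \<open>t\<close> and equals the first.\<close>

lemma exists_hyperplane:
  assumes V: "subspace V" "subspace A" "A \<subseteq> V" and t: "t \<in> V" "t \<notin> A" and s: "s \<notin> A"
  obtains N where "hyperplane N V" "A \<subseteq> N" "t \<notin> N" "s \<notin> N"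
proof -
  let ?P = "\<lambda>N. subspace N \<and> A \<subseteq> N \<and> N \<subseteq> V \<and> t \<notin> N \<and> s \<notin> N"
  have "?P A" using assms by auto
  moreover have "dim N < Suc dimension" if "?P N" for N
    using dim_subset_UNIV[of N] by simp
  ultimately obtain N where N: "?P N" and max: "\<And>N'. ?P N' \<Longrightarrow> dim N' \<le> dim N"
    using ex_has_greatest_nat[of ?P A dim "Suc dimension"] by (metis less_imp_le)
  have sub: "subspace N" "A \<subseteq> N" "N \<subseteq> V" "t \<notin> N" "s \<notin> N" using N by auto
  have cover: "V \<subseteq> adj N t \<union> adj N s"
  proof
    fix x assume x: "x \<in> V"
    show "x \<in> adj N t \<union> adj N s"
    proof (rule ccontr)
      assume xx: "x \<notin> adj N t \<union> adj N s"
      have "x \<notin> N" using xx adj_upper(1) by blast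
      \<comment> \<open>Exchange: a dependence of \<open>y\<close> on \<open>x\<close> modulo
        \<open>N\<close> can be solved for \<open>x\<close>.\<close>
      have mem: "y \<notin> adj N x" if y: "y \<notin> N" "x \<notin> adj N y" for y
      proof
        assume "y \<in> adj N x"
        then obtain k where k: "y - k \<odot> x \<in> N" using mem_adj_iff[OF sub(1)] by blast
        have "k \<noteq> 0" using k y(1) by auto
        have "x - inverse k \<odot> y = - (inverse k \<odot> (y - k \<odot> x))"
          using \<open>k \<noteq> 0\<close> by (simp add: scale_right_diff_distrib)
        also have "\<dots> \<in> N" using k sub(1) by (intro subspace_neg subspace_scale)
        finally show False using y(2) mem_adj_iff[OF sub(1)] by blast
      qed
      have "?P (adj N x)"
        using mem[of t] mem[of s] xx sub subspace_adj adj_upper(1)[of N x] adj_least[OF V(1) sub(3) x] by auto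
      then have "dim (adj N x) \<le> dim N" by (rule max)
      then show False using dim_adj[OF sub(1) \<open>x \<notin> N\<close>] by simp
    qed
  qed
  have "V \<subseteq> adj N t"
  proof
    fix x assume x: "x \<in> V"
    show "x \<in> adj N t"
    proof (rule ccontr)
      assume xt: "x \<notin> adj N t"
      then have xs: "x \<in> adj N s" using cover x by blast
      \<comment> \<open>As for a group covered by two subgroups: \<open>t + x\<close> is not in the
        first, so it is in the second, and with it \<open>t\<close>.\<close>
      have "t + x \<notin> adj N t"
        using subspace_diff[OF subspace_adj _ adj_upper(2), of "t + x" N t] xt by auto
      then have "t + x \<in> adj N s" using cover subspace_add[OF V(1) t(1) x] by blast
      then have "t \<in> adj N s" using subspace_diff[OF subspace_adj _ xs, of "t + x"] by simp
      then have "adj N t \<subseteq> adj N s" using adj_upper(1) by (intro adj_least subspace_adj)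
      then have "adj N t = adj N s"
        using sub dim_adj by (intro subspace_dim_equal subspace_adj) auto
      then show False using xs xt by simp
    qed
  qed
  then have "hyperplane N V" using sub V(1) t by (intro hyperplaneI[of N V t]) auto
  then show thesis using that sub by blast
qed

lemma finite_height_subspaces: "(\<And>W. W \<in> X \<Longrightarrow> subspace W) \<Longrightarrow> finite_height X"
  unfolding finite_height_def
  by (rule exI[of _ dim], rule exI[of _ "Suc dimension"]) (auto simp: dim_strict dim_subset_UNIV less_Suc_eq_le)

text \<open>For \<open>A \<subseteq> T\<close> these are, modulo \<open>A\<close>, the proper
  subspaces that supplement \<open>T\<close>. \<open>S\<close> is empty or holds one vector to be
  avoided.\<close>

definition supplements :: "'b set \<Rightarrow> 'b set \<Rightarrow> 'b set \<Rightarrow> 'b set \<Rightarrow> 'b set set" where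
  "supplements A V T S = {W. subspace W \<and> A \<subseteq> W \<and> W \<subset> V \<and> ssum W T = V \<and> S \<inter> W = {}}"

lemma supplementsD:
  assumes "W \<in> supplements A V T S"
  shows "subspace W" "A \<subseteq> W" "W \<subset> V" "ssum W T = V" "S \<inter> W = {}"
  using assms by (auto simp: supplements_def)

lemma finite_height_supplements: "X \<subseteq> supplements A V T S \<Longrightarrow> finite_height X"
  by (rule finite_height_subspaces) (auto simp: supplements_def)

text \<open>The modular law: the part of a supplement poset below \<open>W\<close> is a supplement
  poset inside \<open>W\<close>.\<close>

lemma ssum_modular:
  assumes "subspace W" "subspace T" "subspace W'" "W' \<subseteq> W" "ssum W T = V"
  shows "ssum W' T = V \<longleftrightarrow> ssum W' (T \<inter> W) = W"
proof
  assume V: "ssum W' T = V"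
  show "ssum W' (T \<inter> W) = W"
  proof
    show "ssum W' (T \<inter> W) \<subseteq> W" using assms by (intro ssum_least) auto
    show "W \<subseteq> ssum W' (T \<inter> W)"
    proof
      fix w assume w: "w \<in> W"
      then have "w \<in> ssum W' T" using V assms(5) ssum_upper(1)[OF assms(1,2)] by blast
      then obtain x t where xt: "x \<in> W'" "t \<in> T" "w = x + t" by (rule ssumE)
      have "w - x \<in> W" using w xt(1) assms(4) by (intro subspace_diff[OF assms(1)]) auto
      then have "t \<in> W" using xt(3) by simp
      then show "w \<in> ssum W' (T \<inter> W)" using xt by (auto intro: ssumI)
    qed
  qed
next
  assume W: "ssum W' (T \<inter> W) = W"
  have "ssum W' T \<subseteq> V" using assms ssum_mono[of W' W T T] by blast
  moreover have "ssum W T \<subseteq> ssum W' T"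
  proof (rule ssum_least)
    show "W \<subseteq> ssum W' T" using W ssum_mono[of W' W' "T \<inter> W" T] by blast
  qed (use assms subspace_ssum ssum_upper in auto)
  ultimately show "ssum W' T = V" using assms(5) by blast
qed

text \<open>A hyperplane \<open>N\<close> over \<open>A\<close> avoiding \<open>s\<close> and some
  vector of \<open>T\<close> is itself a member. Those \<open>W\<close> whose trace on
  \<open>N\<close> still supplements \<open>T\<close> contract to \<open>N\<close>; any other
  \<open>W\<close> has as link a join of two supplement posets, inside \<open>W\<close> and over
  \<open>W\<close>. The degree fits since \<open>dim W\<close> ranges from
  \<open>dim V - dim T + dim A\<close> to \<open>dim V - 1\<close>.\<close>

theorem iconn_supplements:
  assumes "subspace V" "subspace A" "subspace T" "A \<subseteq> T" "T \<subseteq> V" "S \<inter> A = {}" "S \<subseteq> {s}"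
  shows "iconn (int (dim T) - int (dim A) - 2) (supplements A V T S)"
  using assms
proof (induction "dim V - dim A" arbitrary: V A T rule: less_induct)
  case less
  note sV = \<open>subspace V\<close> and sA = \<open>subspace A\<close> and sT = \<open>subspace T\<close>
  define X where "X = supplements A V T S"
  have XD: "subspace W" "A \<subseteq> W" "W \<subset> V" "ssum W T = V" "S \<inter> W = {}" if "W \<in> X" for W
    using supplementsD[of W A V T S] that by (simp_all add: X_def)
  have fh: "finite_height X" unfolding X_def by (rule finite_height_supplements) (rule subset_refl)
  show ?case
  proof (cases "T = A")
    case True
    then show ?thesis using fh unfolding X_def by (intro iconn.low) auto
  next
    case False
    then obtain t where t: "t \<in> T" "t \<notin> A" using less.prems by blast
    \<comment> \<open>\<open>t \<notin> N\<close> forces N + T = V, and avoiding \<open>S\<close>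
      puts \<open>N\<close> into the poset.\<close>
    obtain N where N: "hyperplane N V" "A \<subseteq> N" "t \<notin> N" "S \<inter> N = {}"
    proof (cases "S = {}")
      case True
      then show ?thesis
        using exists_hyperplane[OF sV sA order_trans[OF less.prems(4,5)] subsetD[OF less.prems(5) t(1)] t(2) t(2)] that
        by (metis Int_empty_left)
    next
      case False
      then have "S = {s}" "s \<notin> A" using less.prems(6,7) by auto
      then show ?thesis
        using exists_hyperplane[OF sV sA order_trans[OF less.prems(4,5)] subsetD[OF less.prems(5) t(1)] t(2) \<open>s \<notin> A\<close>] that
        by (metis Int_insert_left_if0 Int_empty_left)
    qed
    have sN: "subspace N" "N \<subset> V" using N(1) by (auto simp: hyperplane_def)
    define Z where "Z = {W \<in> X. ssum (W \<inter> N) T = V}"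
    define Z1 where "Z1 = {W \<in> Z. W \<subseteq> N}"
    have sumN: "ssum N T = V"
    proof
      show "ssum N T \<subseteq> V" using sN less.prems by (intro ssum_least) auto
      have "adj N t \<subseteq> ssum N T"
        using sN sT t ssum_upper by (intro adj_least subspace_ssum) blast+
      then show "V \<subseteq> ssum N T" using hyperplane_adj[OF N(1)] t N(3) less.prems by blast
    qed
    have NZ1: "N \<in> Z1"
      using N sN sumN by (simp add: Z1_def Z_def X_def supplements_def)
    have Z1: "iconn n Z1" for n
      by (rule iconn.cone[OF NZ1]) (auto simp: Z1_def)
    have Zc: "iconn n Z" for n
    proof (rule iconn_closure_down[OF Z1, where f = "\<lambda>W. W \<inter> N"])
      show "Z1 \<subseteq> Z" by (auto simp: Z1_def)
      show "finite_height Z" using fh by (rule finite_height_subset) (auto simp: Z_def)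
      show "W \<inter> N \<in> Z1" if "W \<in> Z" for W
      proof -
        have W: "W \<in> X" "ssum (W \<inter> N) T = V" using that by (auto simp: Z_def)
        have "W \<inter> N \<in> X"
          unfolding X_def supplements_def using XD[OF W(1)] W(2) N(2) sN subspace_inter by auto
        then show ?thesis using W(2) by (simp add: Z1_def Z_def Int_assoc)
      qed
    qed (auto simp: Z1_def)
    have "iconn (int (dim T) - int (dim A) - 2) X"
    proof (rule iconn_add_increasing[OF Zc _ fh])
      show "Z \<subseteq> X" by (auto simp: Z_def)
      fix W assume W: "W \<in> X - Z"
      then have WX: "W \<in> X" and WZ: "ssum (W \<inter> N) T \<noteq> V" by (auto simp: Z_def)
      note WD = XD[OF WX]
      have "A \<noteq> W"
      proof
        assume "A = W"
        then have "W \<inter> N = W" using N(2) by blast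
        then show False using WZ WD(4) by simp
      qed
      then have dAW: "dim A < dim W" using dim_strict[OF sA WD(1)] WD(2) by blast
      have dWV: "dim W < dim V" using dim_strict[OF WD(1) sV WD(3)] .
      \<comment> \<open>\<open>W \<inter> N\<close> has codimension one in \<open>W\<close>, so its
        sum with \<open>T\<close>, if not \<open>V\<close>, is a hyperplane of
        \<open>V\<close>.\<close>
      define M where "M = ssum (W \<inter> N) T"
      have sWN: "subspace (W \<inter> N)" using WD(1) sN(1) by (rule subspace_inter)
      have sM: "subspace M" unfolding M_def using sWN sT by (rule subspace_ssum)
      have WNM: "W \<inter> N \<subseteq> M" and TM: "T \<subseteq> M" unfolding M_def using sWN sT ssum_upper by blast+
      have MV: "M \<subseteq> V" unfolding M_def using WD(3) less.prems sV by (intro ssum_least) auto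
      obtain w0 where w0: "w0 \<in> W" "w0 \<notin> M"
      proof -
        have "\<not> W \<subseteq> M"
        proof
          assume "W \<subseteq> M"
          then have "ssum W T \<subseteq> M" using sM TM by (intro ssum_least)
          then show False using WZ MV WD(4) by (auto simp: M_def)
        qed
        then show ?thesis using that by blast
      qed
      have w0N: "w0 \<notin> N" "w0 \<in> V" using w0 WNM WD(3) by auto
      have Wdec: "\<exists>k. w - k \<odot> w0 \<in> W' \<inter> N" if w: "w \<in> W'" "w0 \<in> W'" "subspace W'" "W' \<subseteq> V" for w W'
      proof -
        have "w \<in> V" using w by blast
        from hyperplane_decomp[OF N(1) w0N(2,1) this] obtain k where "w - k \<odot> w0 \<in> N" .
        moreover have "w - k \<odot> w0 \<in> W'" using w(1,2) by (intro subspace_diff[OF w(3)] subspace_scale[OF w(3)])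
        ultimately show ?thesis by blast
      qed
      have hM: "hyperplane M V"
      proof (rule hyperplaneI[OF sM sV MV w0N(2) w0(2)])
        have "W \<subseteq> adj M w0"
        proof
          fix w assume "w \<in> W"
          then obtain k where "w - k \<odot> w0 \<in> W \<inter> N" using Wdec[of w W] w0 WD(1,3) by auto
          then show "w \<in> adj M w0" using WNM mem_adj_iff[OF sM] by blast
        qed
        then have "ssum W T \<subseteq> adj M w0" by (rule ssum_least[OF subspace_adj _ order_trans[OF TM adj_upper(1)]])
        then show "V \<subseteq> adj M w0" using WD(4) by simp
      qed
      obtain n0 where n0: "n0 \<in> N" "n0 \<notin> M"
      proof -
        have "\<not> N \<subseteq> M"
        proof
          assume "N \<subseteq> M"
          then have "N = M" using hM N(1) by (intro subspace_dim_equal) (auto simp: hyperplane_def)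
          then show False using TM t N(3) by blast
        qed
        then show ?thesis using that by blast
      qed
      \<comment> \<open>For \<open>W'\<close> above \<open>W\<close>, being in \<open>Z\<close>
        amounts to \<open>\<not> W' \<inter> N \<subseteq> M\<close>. As V = N + W, the quotients of
        \<open>V\<close> by \<open>W\<close> and of \<open>N\<close> by \<open>W \<inter> N\<close>
        are isomorphic. This takes \<open>W' \<inter> N\<close> to \<open>W'\<close> and
        \<open>M \<inter> N\<close> to \<open>M'\<close>, so the condition becomes W' + M' =
        V.\<close>
      define M' where "M' = ssum (M \<inter> N) W"
      have sMN: "subspace (M \<inter> N)" using sM sN(1) by (rule subspace_inter)
      have sM': "subspace M'" unfolding M'_def using sMN WD(1) by (rule subspace_ssum)
      have WM': "W \<subseteq> M'" and MNM': "M \<inter> N \<subseteq> M'" unfolding M'_def using sMN WD(1) ssum_upper by blast+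
      have M'V: "M' \<subseteq> V" unfolding M'_def using WD(3) MV sV by (intro ssum_least) auto
      have notM': "x \<notin> M'" if "x \<in> N" "x \<notin> M" for x
      proof
        assume "x \<in> M'"
        then obtain m w where mw: "m \<in> M \<inter> N" "w \<in> W" "x = m + w" unfolding M'_def by (rule ssumE)
        have "x - m \<in> N" using that mw(1) by (intro subspace_diff[OF sN(1)]) auto
        then have "w \<in> N" using mw(3) by simp
        then have "w \<in> M" using mw WNM by blast
        then have "x \<in> M" using mw sM by (auto intro: subspace_add)
        then show False using that by blast
      qed
      have hM': "hyperplane M' V"
      proof (rule hyperplaneI[OF sM' sV M'V])
        show "n0 \<in> V" using n0 sN by blast
        show "n0 \<notin> M'" using notM' n0 .
        show "V \<subseteq> adj M' n0"
        proof
          fix x assume "x \<in> V"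
          then obtain k where k: "x - k \<odot> w0 \<in> N" using hyperplane_decomp[OF N(1) w0N(2,1)] by blast
          then have "x - k \<odot> w0 \<in> V" using sN by blast
          moreover have "n0 \<in> V" using n0 sN by blast
          ultimately obtain j where j: "x - k \<odot> w0 - j \<odot> n0 \<in> M" using hyperplane_decomp[OF hM _ n0(2)] by blast
          have "x - k \<odot> w0 - j \<odot> n0 \<in> N" 
            by (rule subspace_diff[OF sN(1) k subspace_scale[OF sN(1) n0(1)]])
          then have "x - k \<odot> w0 - j \<odot> n0 \<in> M'" using j MNM' by blast
          moreover have "k \<odot> w0 \<in> M'" using w0(1) WM' by (intro subspace_scale[OF sM']) blast
          ultimately have "(x - k \<odot> w0 - j \<odot> n0) + k \<odot> w0 \<in> M'" by (rule subspace_add[OF sM'])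
          moreover have "(x - k \<odot> w0 - j \<odot> n0) + k \<odot> w0 = x - j \<odot> n0" by simp
          ultimately show "x \<in> adj M' n0" using mem_adj_iff[OF sM'] by auto
        qed
      qed
      have ZM': "W' \<in> Z \<longleftrightarrow> ssum W' M' = V" if W': "W' \<in> X" "W \<subset> W'" for W'
      proof -
        note D = XD[OF W'(1)]
        have "W' \<in> Z \<longleftrightarrow> \<not> W' \<inter> N \<subseteq> M"
        proof
          assume "W' \<in> Z"
          then have V: "ssum (W' \<inter> N) T = V" by (simp add: Z_def)
          show "\<not> W' \<inter> N \<subseteq> M"
          proof
            assume "W' \<inter> N \<subseteq> M"
            then have "ssum (W' \<inter> N) T \<subseteq> M" using sM TM by (intro ssum_least)
            then show False using V w0(2) w0N(2) by blast
          qed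
        next
          assume "\<not> W' \<inter> N \<subseteq> M"
          then obtain x where x: "x \<in> W' \<inter> N" "x \<notin> M" by blast
          have s: "subspace (W' \<inter> N)" using D(1) sN(1) by (rule subspace_inter)
          have "M \<subseteq> ssum (W' \<inter> N) T" unfolding M_def using W'(2) by (intro ssum_mono) auto
          moreover have "x \<in> ssum (W' \<inter> N) T" using x ssum_upper(1)[OF s sT] by blast
          ultimately have "adj M x \<subseteq> ssum (W' \<inter> N) T" using s sT by (intro adj_least subspace_ssum)
          moreover have "adj M x = V" using x sN by (intro hyperplane_adj[OF hM]) auto
          moreover have "ssum (W' \<inter> N) T \<subseteq> V" using sN less.prems sV by (intro ssum_least) auto
          ultimately show "W' \<in> Z" using W'(1) by (simp add: Z_def)
        qed
        also have "\<dots> \<longleftrightarrow> ssum W' M' = V"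
        proof
          assume "\<not> W' \<inter> N \<subseteq> M"
          then obtain x where x: "x \<in> W'" "x \<in> N" "x \<notin> M" by blast
          have "adj M' x \<subseteq> ssum W' M'"
            using ssum_upper[OF D(1) sM'] x D(1) sM' by (intro adj_least subspace_ssum) auto
          moreover have "adj M' x = V" using x sN notM' by (intro hyperplane_adj[OF hM']) auto
          moreover have "ssum W' M' \<subseteq> V" using D(3) M'V sV by (intro ssum_least) auto
          ultimately show "ssum W' M' = V" by simp
        next
          assume V: "ssum W' M' = V"
          show "\<not> W' \<inter> N \<subseteq> M"
          proof
            assume WM: "W' \<inter> N \<subseteq> M"
            have "W' \<subseteq> M'"
            proof
              fix w assume "w \<in> W'"
              then obtain k where "w - k \<odot> w0 \<in> W' \<inter> N" using Wdec[of w W'] w0 W'(2) D(1,3) by auto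
              then have "w - k \<odot> w0 \<in> M'" using WM MNM' by blast
              moreover have "k \<odot> w0 \<in> M'" using w0(1) WM' by (intro subspace_scale[OF sM']) blast
              ultimately have "(w - k \<odot> w0) + k \<odot> w0 \<in> M'" by (rule subspace_add[OF sM'])
              then show "w \<in> M'" by simp
            qed
            then have "ssum W' M' \<subseteq> M'" using sM' by (intro ssum_least) auto
            then show False using V hyperplane_psubset[OF hM'] by blast
          qed
        qed
        finally show ?thesis .
      qed
      have lower: "{W' \<in> X. W' \<subset> W} = supplements A W (T \<inter> W) S"
        using ssum_modular[OF WD(1) sT _ _ WD(4)] WD(3,5) by (auto simp: X_def supplements_def)
      have upper: "{W' \<in> Z. W \<subset> W'} = supplements W V M' S"
      proof (intro equalityI subsetI)
        fix W' assume "W' \<in> {W' \<in> Z. W \<subset> W'}"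
        then have W': "W' \<in> X" "W \<subset> W'" "W' \<in> Z" by (auto simp: Z_def)
        then show "W' \<in> supplements W V M' S"
          using ZM'[OF W'(1,2)] XD[OF W'(1)] by (auto simp: supplements_def)
      next
        fix W' assume "W' \<in> supplements W V M' S"
        note D = supplementsD[OF this]
        have "W \<noteq> W'"
        proof
          assume "W = W'"
          then have "ssum W' M' \<subseteq> M'" using WM' sM' by (intro ssum_least) auto
          then show False using D(4) hyperplane_psubset[OF hM'] by blast
        qed
        then have sub: "W \<subset> W'" using D(2) by blast
        have "ssum W T \<subseteq> ssum W' T" using D(2) by (intro ssum_mono) auto
        moreover have "ssum W' T \<subseteq> V" using D(3) less.prems sV by (intro ssum_least) auto
        ultimately have "W' \<in> X" using D WD(2,4) by (auto simp: X_def supplements_def)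
        then show "W' \<in> {W' \<in> Z. W \<subset> W'}" using ZM'[OF _ sub] D(4) sub by auto
      qed
      have IH1: "iconn (int (dim (T \<inter> W)) - int (dim A) - 2) (supplements A W (T \<inter> W) S)"
        by (rule less.hyps)
          (use dWV dAW WD sA sT less.prems in \<open>auto intro: subspace_inter\<close>)
      have IH2: "iconn (int (dim M') - int (dim W) - 2) (supplements W V M' S)"
        by (rule less.hyps) (use dAW dWV WD sV sM' WM' M'V less.prems in auto)
      have "iconn ((int (dim (T \<inter> W)) - int (dim A) - 2) + (int (dim M') - int (dim W) - 2) + 2)
         ({W' \<in> X. W' \<subset> W} \<union> {W' \<in> Z. W \<subset> W'})"
        unfolding lower upper
      proof (rule iconn_join[OF IH1 IH2])
        show "x \<subset> y" if "x \<in> supplements A W (T \<inter> W) S" "y \<in> supplements W V M' S" for x y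
          using that by (auto simp: supplements_def)
      qed
      \<comment> \<open>With these equations the degree of the join is exactly
        \<open>dim T - dim A - 3\<close>.\<close>
      moreover have "dim (T \<inter> W) + dim V = dim W + dim T" "dim V = Suc (dim M')"
        using dim_ssum[OF WD(1) sT] WD(4) hM' by (auto simp: hyperplane_def Int_commute)
      ultimately show "iconn (int (dim T) - int (dim A) - 2 - 1) ({W' \<in> X. W' \<subset> W} \<union> {W' \<in> Z. W \<subset> W'})"
        by (elim iconn_mono) linarith
    qed
    then show ?thesis by (simp add: X_def)
  qed
qed

text \<open>Connectivity of the building of a vector space. For a line \<open>L\<close> modulo
  \<open>A\<close>, the \<open>W\<close> with W + L different from \<open>B\<close> contract to
  \<open>L\<close> through W + L. The others are hyperplanes of \<open>B\<close>, so their links are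
  just the intervals below them.\<close>

theorem iconn_interval:
  assumes "subspace A" "subspace B" "A \<subset> B"
  shows "iconn (int (dim B) - int (dim A) - 3) {W. subspace W \<and> A \<subset> W \<and> W \<subset> B}"
  using assms
proof (induction "dim B" arbitrary: B rule: less_induct)
  case less
  define X where "X = {W. subspace W \<and> A \<subset> W \<and> W \<subset> B}"
  have fh: "finite_height X" by (rule finite_height_subspaces) (simp add: X_def)
  have "dim A < dim B" using less.prems dim_strict by blast
  obtain l where l: "l \<in> B" "l \<notin> A" using less.prems by blast
  define L where "L = adj A l"
  have L: "subspace L" "A \<subset> L" "L \<subseteq> B" "dim L = Suc (dim A)"
    using l less.prems adj_upper(1)[of A l] adj_upper(2)[of l A] adj_least[of B A l] subspace_adj dim_adj[of A l] by (auto simp: L_def)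
  show ?case
  proof (cases "L = B")
    case True
    then show ?thesis using fh L(4) unfolding X_def by (intro iconn.low) auto
  next
    case False
    define Z where "Z = {W \<in> X. ssum W L \<noteq> B}"
    define Z1 where "Z1 = {W \<in> Z. L \<subseteq> W}"
    have LL: "ssum L L = L" using ssum_least[of L L L] ssum_upper(1)[of L L] L(1) by blast
    have "L \<in> Z1" using L False LL by (auto simp: Z1_def Z_def X_def)
    then have Z1: "iconn n Z1" for n
      by (rule iconn.cone) (auto simp: Z1_def)
    have Zc: "iconn n Z" for n
    proof (rule iconn_closure_up[OF Z1, where f = "\<lambda>W. ssum W L"])
      show "Z1 \<subseteq> Z" by (auto simp: Z1_def)
      show "finite_height Z" using fh by (rule finite_height_subset) (auto simp: Z_def)
      show "ssum W L \<in> Z1" if "W \<in> Z" for W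
      proof -
        have W: "subspace W" "A \<subset> W" "W \<subset> B" "ssum W L \<noteq> B" using that by (auto simp: Z_def X_def)
        have s: "subspace (ssum W L)" "W \<subseteq> ssum W L" "L \<subseteq> ssum W L" "ssum W L \<subseteq> B"
          using W L less.prems subspace_ssum ssum_upper ssum_least[of B W L] by auto
        then have "ssum (ssum W L) L = ssum W L"
          using ssum_least[of "ssum W L" "ssum W L" L] ssum_upper(1)[of "ssum W L" L] L by auto
        then show ?thesis using s W by (auto simp: Z1_def Z_def X_def)
      qed
      show "W \<subseteq> ssum W L" if "W \<in> Z" for W
        using that L ssum_upper(1) by (auto simp: Z_def X_def)
      show "ssum W L \<subseteq> W'" if "W \<in> Z" "W' \<in> Z1" "W \<subseteq> W'" for W W'
        using that by (intro ssum_least) (auto simp: Z_def Z1_def X_def)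
    qed
    have "iconn (int (dim B) - int (dim A) - 3) X"
    proof (rule iconn_add_increasing[OF Zc _ fh])
      show "Z \<subseteq> X" by (auto simp: Z_def)
      fix W assume "W \<in> X - Z"
      then have W: "subspace W" "A \<subset> W" "W \<subset> B" "ssum W L = B" by (auto simp: Z_def X_def)
      have "\<not> L \<subseteq> W"
      proof
        assume "L \<subseteq> W"
        then have "ssum W L \<subseteq> W" using W(1) by (intro ssum_least) auto
        then show False using W by blast
      qed
      then have "dim (W \<inter> L) < dim L" using W L by (intro dim_strict subspace_inter) auto
      moreover have "dim A \<le> dim (W \<inter> L)" using W L by (intro dim_subset) auto
      ultimately have dW: "dim B = Suc (dim W)" using dim_ssum[OF W(1) L(1)] W(4) L(4) by simp
      have "W' \<notin> Z" if "W \<subset> W'" for W'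
      proof
        assume "W' \<in> Z"
        then have W': "subspace W'" "W' \<subset> B" by (auto simp: Z_def X_def)
        then show False using dim_strict[OF W(1) W'(1) that] dim_strict[OF W'(1) less.prems(2) W'(2)] dW by simp
      qed
      then have "{z \<in> X. z \<subset> W} \<union> {z \<in> Z. W \<subset> z} = {W'. subspace W' \<and> A \<subset> W' \<and> W' \<subset> W}"
        using W by (auto simp: X_def)
      moreover have "iconn (int (dim W) - int (dim A) - 3) {W'. subspace W' \<and> A \<subset> W' \<and> W' \<subset> W}"
        by (rule less.hyps) (use dW W less.prems in auto)
      ultimately show "iconn (int (dim B) - int (dim A) - 3 - 1) ({z \<in> X. z \<subset> W} \<union> {z \<in> Z. W \<subset> z})"
        using dW by simp
    qed
    then show ?thesis by (simp add: X_def)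
  qed
qed

end

section \<open>Isotropic subspaces\<close>

text \<open>The predicate \<open>qz v\<close> says that the quadratic form vanishes on the whole line through \<open>v\<close>; since
  \<open>\<Lambda>\<close> is only an additive subgroup, this is stronger than its vanishing at \<open>v\<close>.\<close>

locale isotropic_geometry = subspace_posets scale Basis
  for scale :: "'a::field \<Rightarrow> 'b::ab_group_add \<Rightarrow> 'b" (infixr "\<odot>" 75) and Basis :: "'b set" +
  fixes om :: "'b \<Rightarrow> 'b \<Rightarrow> 'a" and qz :: "'b \<Rightarrow> bool"
  assumes om_add_left: "om (x + y) z = om x z + om y z"
    and om_add_right: "om x (y + z) = om x y + om x z"
    and om_scale_right: "om x (c \<odot> y) = om x y * c"
    and om_sym: "om x y = 0 \<Longrightarrow> om y x = 0"
    and qz_0: "qz 0"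
    and qz_scale: "qz x \<Longrightarrow> qz (c \<odot> x)"
    and qz_add: "qz x \<Longrightarrow> qz y \<Longrightarrow> om x y = 0 \<Longrightarrow> qz (x + y)"
    and qz_om: "qz x \<Longrightarrow> om x x = 0"
    and qz_adjust: "qz m \<Longrightarrow> om m y \<noteq> 0 \<Longrightarrow> \<exists>c. qz (y + c \<odot> m)"
begin

definition orth :: "'b set \<Rightarrow> 'b set" where "orth U = {v. \<forall>u\<in>U. om v u = 0}"

definition K :: "'b set" where "K = {v. \<forall>w. om w v = 0}"

definition iso :: "'b set \<Rightarrow> bool" where
  "iso W \<longleftrightarrow> subspace W \<and> (\<forall>v\<in>W. \<forall>w\<in>W. om v w = 0) \<and> (\<forall>v\<in>W. qz v)"

definition R :: "'b set" where "R = {v \<in> K. qz v}"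

text \<open>The Witt index raised by the dimension of the radical. By \<open>iso_extend\<close>
  every maximal isotropic subspace has this dimension.\<close>

definition witt :: nat where "witt = Max (dim ` {W. iso W})"

lemma om_commute_zero: "om x y = 0 \<longleftrightarrow> om y x = 0"
  using om_sym by blast

lemma om_zero_right [simp]: "om x 0 = 0"
  using om_scale_right[of x 0 0] by simp

lemma om_diff_right: "om x (y - z) = om x y - om x z"
  using om_add_right[of x "y - z" z] by simp

text \<open>The scaling law is stated for the second argument, so linearity of complements is read
  off from that side.\<close>

lemma mem_orth: "x \<in> orth U \<longleftrightarrow> (\<forall>u\<in>U. om u x = 0)"
  unfolding orth_def using om_sym by blast

lemma subspace_orth: "subspace (orth U)"
  unfolding subspace_def by (auto simp: mem_orth om_add_right om_scale_right)

lemma orth_antimono: "U \<subseteq> U' \<Longrightarrow> orth U' \<subseteq> orth U"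
  by (auto simp: orth_def)

lemma subset_orth_commute: "W \<subseteq> orth U \<longleftrightarrow> U \<subseteq> orth W"
  unfolding orth_def using om_sym by blast

lemma subset_orth_singleton: "W \<subseteq> orth {v} \<longleftrightarrow> v \<in> orth W"
  using subset_orth_commute[of W "{v}"] by simp

lemma K_eq_orth: "K = orth UNIV"
  by (auto simp: K_def mem_orth)

lemma subspace_K: "subspace K" unfolding K_eq_orth by (rule subspace_orth)

lemma K_subset_orth: "K \<subseteq> orth U" unfolding K_eq_orth by (rule orth_antimono) simp

lemma R_subset_K: "R \<subseteq> K" by (auto simp: R_def)

lemma subspace_R: "subspace R"
  unfolding subspace_def
proof (intro conjI ballI allI)
  show "0 \<in> R" using subspace_0[OF subspace_K] by (simp add: R_def qz_0)
  show "x + y \<in> R" if "x \<in> R" "y \<in> R" for x y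
    using that subspace_add[OF subspace_K, of x y] qz_add[of x y] by (auto simp: R_def K_def)
  show "c \<odot> x \<in> R" if "x \<in> R" for c x
    using that subspace_scale[OF subspace_K, of x c] qz_scale[of x c] by (auto simp: R_def)
qed

lemma iso_R: "iso R"
  using subspace_R by (auto simp: iso_def R_def K_def)

lemma isoD: "iso W \<Longrightarrow> subspace W" "iso W \<Longrightarrow> v \<in> W \<Longrightarrow> w \<in> W \<Longrightarrow> om v w = 0" "iso W \<Longrightarrow> v \<in> W \<Longrightarrow> qz v"
  by (auto simp: iso_def)

lemma iso_subset: "iso W \<Longrightarrow> subspace W' \<Longrightarrow> W' \<subseteq> W \<Longrightarrow> iso W'"
  by (auto simp: iso_def)

lemma iso_subset_orth: "iso W \<Longrightarrow> A \<subseteq> W \<Longrightarrow> W \<subseteq> orth A"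
  by (auto simp: iso_def orth_def)

text \<open>Orthogonality of the span to itself is obtained by moving inclusions across
  \<open>subset_orth_commute\<close>, without expanding linear combinations.\<close>

lemma iso_adj:
  assumes "iso W" "qz v" "v \<in> orth W"
  shows "iso (adj W v)"
proof -
  have sW: "subspace W" using assms(1) by (rule isoD)
  have W: "W \<subseteq> orth {v}" using assms(3) by (simp add: subset_orth_singleton)
  have *: "adj W v \<subseteq> orth W"
    using iso_subset_orth[OF assms(1) subset_refl] assms(3) by (intro adj_least subspace_orth)
  have "adj W v \<subseteq> orth {v}"
    using W assms(2) by (intro adj_least subspace_orth) (auto simp: mem_orth qz_om)
  then have "v \<in> orth (adj W v)" by (simp add: subset_orth_singleton)
  moreover have "W \<subseteq> orth (adj W v)" using * subset_orth_commute by blast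
  ultimately have **: "adj W v \<subseteq> orth (adj W v)" by (intro adj_least subspace_orth)
  have "qz x" if x: "x \<in> adj W v" for x
  proof -
    obtain k where k: "x - k \<odot> v \<in> W" using mem_adj_iff[OF sW] x by blast
    have "om (x - k \<odot> v) (k \<odot> v) = 0"
      using assms(3) k by (auto simp: om_scale_right mem_orth)
    then have "qz ((x - k \<odot> v) + k \<odot> v)"
      using isoD(3)[OF assms(1) k] qz_scale[OF assms(2)] by (intro qz_add)
    then show ?thesis by simp
  qed
  then show ?thesis using ** subspace_adj by (auto simp: iso_def orth_def)
qed

text \<open>The intersection is the kernel of the nonzero functional \<open>om v\<close> on
  \<open>A\<close>.\<close>

lemma hyperplane_orth:
  assumes "subspace A" "x \<in> A" "om v x \<noteq> 0"
  shows "hyperplane (A \<inter> orth {v}) A"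
proof (rule hyperplaneI[where x = x])
  show s: "subspace (A \<inter> orth {v})" using assms(1) subspace_orth by (rule subspace_inter)
  show "x \<notin> A \<inter> orth {v}" using assms by (auto simp: mem_orth)
  show "A \<subseteq> adj (A \<inter> orth {v}) x"
  proof
    fix w assume w: "w \<in> A"
    define k where "k = om v w / om v x"
    have "om v (w - k \<odot> x) = 0" using assms(3) by (simp add: om_diff_right om_scale_right k_def)
    moreover have "w - k \<odot> x \<in> A" using w assms by (intro subspace_diff subspace_scale)
    ultimately show "w \<in> adj (A \<inter> orth {v}) x" unfolding mem_adj_iff[OF s] by (auto simp: mem_orth)
  qed
qed (use assms in auto)

lemma dim_orth_finite:
  assumes "subspace A" "finite S"
  shows "dim A \<le> dim (A \<inter> orth S) + card S"
  using assms(2)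
proof (induction S)
  case empty
  have "A \<inter> orth {} = A" by (auto simp: orth_def)
  then show ?case by simp
next
  case (insert v S)
  have s: "subspace (A \<inter> orth S)" using assms(1) subspace_orth by (rule subspace_inter)
  have eq: "A \<inter> orth (insert v S) = (A \<inter> orth S) \<inter> orth {v}" by (auto simp: orth_def)
  show ?case
  proof (cases "\<exists>x\<in>A \<inter> orth S. om v x \<noteq> 0")
    case True
    then obtain x where "x \<in> A \<inter> orth S" "om v x \<noteq> 0" by blast
    from hyperplane_orth[OF s this] insert show ?thesis by (simp add: hyperplane_def eq)
  next
    case False
    then have "(A \<inter> orth S) \<inter> orth {v} = A \<inter> orth S" by (auto simp: mem_orth[of _ "{v}"])
    then show ?thesis using insert by (simp add: eq)
  qed
qed

lemma relative_basis:
  assumes "subspace C" "subspace B" "C \<subseteq> B"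
  obtains S where "finite S" "card S + dim C = dim B" "B \<subseteq> span (S \<union> C)"
proof -
  obtain I where I: "I \<subseteq> C" "independent I" "C \<subseteq> span I" "card I = dim C" using basis_exists by blast
  obtain J where J: "I \<subseteq> J" "J \<subseteq> B" "independent J" "B \<subseteq> span J"
    using maximal_independent_subset_extend[of I B] I assms(3) by blast
  have fin: "finite J" using J(3) by (rule finiteI_independent)
  have "card J = dim B" using J by (intro basis_card_eq_dim)
  moreover have "card (J - I) + card I = card J"
    using fin J(1) by (metis card_Diff_subset card_mono finite_subset le_add_diff_inverse2)
  moreover have "span J \<subseteq> span ((J - I) \<union> C)" using I(1) by (intro span_mono) auto
  ultimately show thesis using that[of "J - I"] fin I(4) J(4) by auto
qed

text \<open>Half of the fact that \<open>A\<close> modulo \<open>A \<inter> orth B\<close> and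
  \<open>B\<close> modulo \<open>B \<inter> orth A\<close> are in duality. Generators of
  \<open>B\<close> modulo \<open>B \<inter> orth A\<close> cut \<open>A\<close> down to
  \<open>A \<inter> orth B\<close>, each at the cost of at most one dimension.\<close>

lemma pairing_le:
  assumes A: "subspace A" and B: "subspace B"
  shows "dim A + dim (B \<inter> orth A) \<le> dim B + dim (A \<inter> orth B)"
proof -
  have C: "subspace (B \<inter> orth A)" using B subspace_orth by (rule subspace_inter)
  obtain S where S: "finite S" "card S + dim (B \<inter> orth A) = dim B" "B \<subseteq> span (S \<union> (B \<inter> orth A))"
    using relative_basis[OF C B] by blast
  have "A \<inter> orth S \<subseteq> A \<inter> orth B"
  proof
    fix v assume v: "v \<in> A \<inter> orth S"
    have "S \<subseteq> orth {v}" using v subset_orth_singleton[of S v] by blast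
    moreover have "B \<inter> orth A \<subseteq> orth {v}" using v by (auto simp: orth_def)
    ultimately have "span (S \<union> (B \<inter> orth A)) \<subseteq> orth {v}" by (intro span_minimal subspace_orth) auto
    then have "v \<in> orth B" using S(3) subset_orth_singleton[of B v] by blast
    then show "v \<in> A \<inter> orth B" using v by blast
  qed
  then have "dim (A \<inter> orth S) \<le> dim (A \<inter> orth B)" by (rule dim_subset)
  then show ?thesis using dim_orth_finite[OF A S(1)] S(2) by linarith
qed

lemma pairing:
  "subspace A \<Longrightarrow> subspace B \<Longrightarrow> dim A + dim (B \<inter> orth A) = dim B + dim (A \<inter> orth B)"
  using pairing_le[of A B] pairing_le[of B A] by simp

lemma dim_orth: "subspace A \<Longrightarrow> dim A + dim (orth A) = dim (UNIV :: 'b set) + dim (A \<inter> K)"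
  using pairing[of A UNIV] by (simp add: K_eq_orth del: dim_UNIV)

text \<open>One inclusion is formal, and the dimensions agree because \<open>K\<close> lies in every
  complement.\<close>

lemma double_orth:
  assumes A: "subspace A"
  shows "orth (orth A) = ssum A K"
proof -
  have "A \<subseteq> orth (orth A)" using subset_orth_commute[of A "orth A"] by simp
  then have "ssum A K \<subseteq> orth (orth A)" using K_subset_orth subspace_orth by (intro ssum_least)
  moreover have "dim (orth (orth A)) \<le> dim (ssum A K)"
  proof -
    have "orth A \<inter> K = K" using K_subset_orth by blast
    then show ?thesis
      using dim_orth[OF A] dim_orth[OF subspace_orth[of A]] dim_ssum[OF A subspace_K] by simp
  qed
  ultimately show ?thesis
    using subspace_ssum[OF A subspace_K] subspace_orth by (intro subspace_dim_equal[symmetric])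
qed

text \<open>A vector of \<open>orth W \<inter> U\<close> is orthogonal to both summands, hence to
  their sum. The converse is a dimension count by \<open>pairing\<close>.\<close>

lemma ssum_orth_UNIV:
  assumes W: "subspace W" and U: "subspace U"
  shows "ssum W (orth U) = UNIV \<longleftrightarrow> orth W \<inter> U \<subseteq> K"
proof
  assume V: "ssum W (orth U) = UNIV"
  show "orth W \<inter> U \<subseteq> K"
  proof
    fix x assume x: "x \<in> orth W \<inter> U"
    have "W \<subseteq> orth {x}" using x by (simp add: subset_orth_singleton)
    moreover have "orth U \<subseteq> orth {x}" using x by (intro orth_antimono) auto
    ultimately have "ssum W (orth U) \<subseteq> orth {x}" by (intro ssum_least subspace_orth)
    then show "x \<in> K" using V by (simp add: K_eq_orth flip: subset_orth_singleton)
  qed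
next
  assume sub: "orth W \<inter> U \<subseteq> K"
  have "dim (U \<inter> orth W) \<le> dim (U \<inter> K)" using sub by (intro dim_subset) auto
  then have "dim (UNIV :: 'b set) \<le> dim (ssum W (orth U))"
    using dim_ssum[OF W subspace_orth[of U]] pairing[OF W U] dim_orth[OF U] by linarith
  then show "ssum W (orth U) = UNIV"
    using subspace_ssum[OF W subspace_orth] by (intro subspace_dim_equal) auto
qed

text \<open>In x = a + k the vector \<open>k\<close> is a difference of two orthogonal vectors
  satisfying \<open>qz\<close>, so it lies in \<open>R\<close>.\<close>

lemma iso_mem:
  assumes A: "iso A" "R \<subseteq> A" and x: "qz x" "x \<in> ssum A K"
  shows "x \<in> A"
proof -
  obtain a k where ak: "a \<in> A" "k \<in> K" "x = a + k" using x(2) by (rule ssumE)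
  have "x \<in> orth A"
  proof -
    have "ssum A K \<subseteq> orth A"
      using iso_subset_orth[OF A(1) subset_refl] K_subset_orth subspace_orth by (intro ssum_least)
    then show ?thesis using x by blast
  qed
  then have "om x ((-1) \<odot> a) = 0" using ak(1) unfolding om_scale_right by (simp add: orth_def)
  then have "qz (x + (-1) \<odot> a)" using x(1) isoD(3)[OF A(1) ak(1)] by (intro qz_add qz_scale)
  then have "qz k" using ak(3) by simp
  then have "k \<in> A" using ak(2) A(2) by (auto simp: R_def)
  then show ?thesis using ak isoD(1)[OF A(1)] by (auto intro: subspace_add)
qed

lemma finite_dims: "finite (dim ` {W. iso W})"
  by (rule finite_subset[of _ "{..dimension}"]) (auto simp: dim_subset_UNIV)

lemma iso_dim_le: "iso W \<Longrightarrow> dim W \<le> witt"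
  unfolding witt_def by (rule Max_ge[OF finite_dims]) auto

text \<open>Otherwise \<open>M' \<inter> orth M\<close> lies in \<open>M \<inter> orth M'\<close>,
  and \<open>pairing\<close> gives \<open>dim M' \<le> dim M\<close>. This takes the place of Witt's
  extension theorem.\<close>

lemma iso_exchange:
  assumes M: "iso M" "iso M'" "dim M < dim M'"
  obtains v where "v \<in> M'" "v \<notin> M" "v \<in> orth M"
proof -
  have "\<not> M' \<inter> orth M \<subseteq> M"
  proof
    assume "M' \<inter> orth M \<subseteq> M"
    then have "M' \<inter> orth M \<subseteq> M \<inter> orth M'" using iso_subset_orth[OF M(2) subset_refl] by blast
    then have "dim (M' \<inter> orth M) \<le> dim (M \<inter> orth M')" by (rule dim_subset)
    then show False using pairing[of M M'] isoD(1) M by simp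
  qed
  then show thesis using that by blast
qed

lemma iso_extend:
  assumes W: "iso W" "dim W < witt"
  obtains l where "l \<notin> W" "qz l" "l \<in> orth W"
proof -
  have "witt \<in> dim ` {W. iso W}" unfolding witt_def using iso_R by (intro Max_in finite_dims) auto
  then obtain M where M: "iso M" "dim M = witt" by auto
  then show thesis using iso_exchange[OF W(1) M(1)] W(2) that isoD(3)[OF M(1)] by metis
qed

section \<open>Isotropic subspaces above a given one\<close>

definition over :: "'b set \<Rightarrow> 'b set set" where
  "over A = {W. iso W \<and> A \<subset> W}"

lemma finite_height_iso: "(\<And>W. W \<in> X \<Longrightarrow> iso W) \<Longrightarrow> finite_height X"
  by (rule finite_height_subspaces) (simp add: isoD(1))

text \<open>Subspaces orthogonal to an isotropic \<open>l\<close> contract to \<open>adj A l\<close>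
  through \<open>adj W l\<close>. Any other \<open>W\<close> is added from above, and
  \<open>W \<inter> orth {l}\<close> is a cone point of its link unless it equals \<open>A\<close>;
  then \<open>W\<close> has one dimension more than \<open>A\<close>, and its link is
  \<open>over W\<close>.\<close>

theorem iconn_over:
  assumes "iso A"
  shows "iconn (int witt - int (dim A) - 2) (over A)"
  using assms
proof (induction "witt - dim A" arbitrary: A rule: less_induct)
  case less
  have fh: "finite_height (over A)" by (rule finite_height_iso) (simp add: over_def)
  show ?case
  proof (cases "dim A < witt")
    case False
    then show ?thesis using fh by (intro iconn.low) auto
  next
    case True
    then obtain l where l: "l \<notin> A" "qz l" "l \<in> orth A" using iso_extend[OF less.prems] by metis
    define Z where "Z = {W \<in> over A. l \<in> orth W}"
    define Z1 where "Z1 = {W \<in> Z. l \<in> W}"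
    have sA: "subspace A" using less.prems by (rule isoD)
    have L: "iso (adj A l)" using iso_adj[OF less.prems l(2,3)] .
    have "adj A l \<in> Z1"
      using L adj_upper(1)[of A l] adj_upper(2)[of l A] l(1) isoD(2)[OF L] by (auto simp: Z1_def Z_def over_def orth_def)
    then have Z1: "iconn n Z1" for n
    proof (rule iconn.cone)
      show "W \<subseteq> adj A l \<or> adj A l \<subseteq> W" if "W \<in> Z1" for W
        using that adj_least[of W A l] isoD(1)[of W] by (auto simp: Z1_def Z_def over_def)
    qed
    have Zc: "iconn n Z" for n
    proof (rule iconn_closure_up[OF Z1, where f = "\<lambda>W. adj W l"])
      show "Z1 \<subseteq> Z" by (auto simp: Z1_def)
      show "finite_height Z" using fh by (rule finite_height_subset) (auto simp: Z_def)
      show "adj W l \<in> Z1" if "W \<in> Z" for W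
      proof -
        have W: "iso W" "A \<subset> W" "l \<in> orth W" using that by (auto simp: Z_def over_def)
        have i: "iso (adj W l)" using iso_adj[OF W(1) l(2) W(3)] .
        then have "l \<in> orth (adj W l)" using isoD(2)[OF i] adj_upper(2)[of l W] by (auto simp: orth_def)
        then show ?thesis using i W adj_upper(1)[of W l] adj_upper(2)[of l W] by (auto simp: Z1_def Z_def over_def)
      qed
      show "W \<subseteq> adj W l" for W by (rule adj_upper)
      show "adj W l \<subseteq> W'" if "W \<in> Z" "W' \<in> Z1" "W \<subseteq> W'" for W W'
        using that isoD(1)[of W'] by (intro adj_least) (auto simp: Z1_def Z_def over_def)
    qed
    show ?thesis
    proof (rule iconn_add_decreasing[OF Zc _ fh])
      show "Z \<subseteq> over A" by (auto simp: Z_def)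
      fix W assume "W \<in> over A - Z"
      then have W: "iso W" "A \<subset> W" "l \<notin> orth W" by (auto simp: Z_def over_def)
      note sW = isoD(1)[OF W(1)]
      define P where "P = W \<inter> orth {l}"
      have sP: "subspace P" unfolding P_def using sW subspace_orth by (rule subspace_inter)
      have AP: "A \<subseteq> P" using W(2) l(3) subset_orth_singleton[of A l] by (auto simp: P_def)
      have PW: "P \<subset> W" using W(3) subset_orth_singleton[of W l] by (auto simp: P_def)
      show "iconn (int witt - int (dim A) - 2 - 1) ({z \<in> Z. z \<subset> W} \<union> {z \<in> over A. W \<subset> z})"
      proof (cases "A = P")
        case False
        show ?thesis
        proof (rule iconn.cone[of P])
          have "l \<in> orth P" using subset_orth_singleton[of P l] by (auto simp: P_def)
          then show "P \<in> {z \<in> Z. z \<subset> W} \<union> {z \<in> over A. W \<subset> z}"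
            using False AP PW iso_subset[OF W(1) sP] by (auto simp: Z_def over_def)
          fix z assume "z \<in> {z \<in> Z. z \<subset> W} \<union> {z \<in> over A. W \<subset> z}"
          then show "z \<subseteq> P \<or> P \<subseteq> z"
          proof
            assume "z \<in> {z \<in> Z. z \<subset> W}"
            then show ?thesis using subset_orth_singleton[of z l] by (auto simp: Z_def P_def)
          qed (use PW in auto)
        qed
      next
        case True
        obtain x where "x \<in> W" "om l x \<noteq> 0" using W(3) by (auto simp: orth_def)
        from hyperplane_orth[OF sW this] have dW: "dim W = Suc (dim A)"
          unfolding P_def[symmetric] True[symmetric] by (simp add: hyperplane_def)
        have none: "{z \<in> Z. z \<subset> W} = {}"
        proof -
          have "z \<subseteq> P" if "z \<in> Z" "z \<subset> W" for z
            using that subset_orth_singleton[of z l] by (auto simp: Z_def P_def)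
          then show ?thesis using True by (auto simp: Z_def over_def)
        qed
        have "{z \<in> over A. W \<subset> z} = over W" using W by (auto simp: over_def)
        moreover have "iconn (int witt - int (dim W) - 2) (over W)"
          by (rule less.hyps) (use dW W(1) \<open>dim A < witt\<close> in auto)
        ultimately show ?thesis unfolding none using dW by simp
      qed
    qed
  qed
qed

end

section \<open>Isotropic subspaces not orthogonal to a given vector\<close>

context isotropic_geometry
begin

text \<open>Some isotropic \<open>m\<close> lies in \<open>orth A\<close> outside \<open>A\<close>.
  If it is orthogonal to \<open>v\<close>, take \<open>x\<close> in \<open>orth A\<close> orthogonal
  neither to \<open>m\<close> nor to \<open>v\<close>; adding a multiple of \<open>m\<close> makes
  \<open>x\<close> isotropic and leaves its pairing with \<open>v\<close> alone. Such an
  \<open>x\<close> exists because \<open>m\<close> and \<open>v\<close> are outside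
  \<open>orth (orth A)\<close>, which is A + K.\<close>

lemma exists_isotropic_not_orth:
  assumes A: "iso A" "R \<subseteq> A" "dim A < witt" and v: "v \<in> orth A" "v \<notin> ssum A K"
  obtains l where "qz l" "l \<in> orth A" "om l v \<noteq> 0"
proof -
  obtain m where m: "m \<notin> A" "qz m" "m \<in> orth A" using iso_extend[OF A(1,3)] by metis
  show thesis
  proof (cases "om m v = 0")
    case False
    then show thesis using that m by blast
  next
    case True
    have sA: "subspace A" using A(1) by (rule isoD)
    have "m \<notin> ssum A K" using iso_mem[OF A(1,2) m(2)] m(1) by blast
    then have "m \<notin> orth (orth A)" "v \<notin> orth (orth A)" using v(2) double_orth[OF sA] by auto
    then obtain y z where y: "y \<in> orth A" "om m y \<noteq> 0" and z: "z \<in> orth A" "om v z \<noteq> 0"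
      by (auto simp: orth_def)
    \<comment> \<open>If neither \<open>y\<close> nor \<open>z\<close> serves for both vectors,
      their sum does.\<close>
    obtain x where x: "x \<in> orth A" "om m x \<noteq> 0" "om v x \<noteq> 0"
    proof (cases "om v y = 0 \<and> om m z = 0")
      case True
      then show ?thesis using that[of "y + z"] y z subspace_add[OF subspace_orth y(1) z(1)] by (simp add: om_add_right)
    next
      case False
      then show ?thesis using that y z by blast
    qed
    obtain c where c: "qz (x + c \<odot> m)" using qz_adjust[OF m(2) x(2)] by blast
    have "x + c \<odot> m \<in> orth A" using x(1) m(3) by (intro subspace_add[OF subspace_orth] subspace_scale[OF subspace_orth])
    moreover have "om v (x + c \<odot> m) \<noteq> 0"
      using x(3) True om_commute_zero[of m v] by (simp add: om_add_right om_scale_right)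
    then have "om (x + c \<odot> m) v \<noteq> 0" using om_sym by blast
    ultimately show thesis using that c by blast
  qed
qed

definition over_off :: "'b set \<Rightarrow> 'b \<Rightarrow> 'b set set" where
  "over_off A v = {W. iso W \<and> A \<subset> W \<and> v \<notin> orth W}"

text \<open>Below \<open>W\<close>, not being orthogonal to \<open>v\<close> means not lying in the
  hyperplane \<open>W \<inter> orth {v}\<close>, that is, supplementing it.\<close>

lemma supplements_orth:
  assumes W: "iso W" "v \<notin> orth W" and A: "A \<subseteq> W" "v \<in> orth A"
  shows "supplements A W (W \<inter> orth {v}) S = {W'. iso W' \<and> A \<subset> W' \<and> W' \<subset> W \<and> v \<notin> orth W' \<and> S \<inter> W' = {}}"
    and "hyperplane (W \<inter> orth {v}) W"
proof -
  obtain x where x: "x \<in> W" "om v x \<noteq> 0" using W(2) by (auto simp: orth_def)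
  show H: "hyperplane (W \<inter> orth {v}) W" using hyperplane_orth[OF isoD(1)[OF W(1)] x] .
  have s: "subspace (W \<inter> orth {v})" using isoD(1)[OF W(1)] subspace_orth by (rule subspace_inter)
  have eq: "ssum W' (W \<inter> orth {v}) = W \<longleftrightarrow> v \<notin> orth W'" if W': "subspace W'" "W' \<subset> W" for W'
  proof
    assume V: "ssum W' (W \<inter> orth {v}) = W"
    show "v \<notin> orth W'"
    proof
      assume "v \<in> orth W'"
      then have "W' \<subseteq> orth {v}" by (simp add: subset_orth_singleton)
      then have "ssum W' (W \<inter> orth {v}) \<subseteq> orth {v}" by (intro ssum_least subspace_orth) auto
      then show False using V x by (auto simp: mem_orth)
    qed
  next
    assume "v \<notin> orth W'"
    then obtain y where y: "y \<in> W'" "om v y \<noteq> 0" by (auto simp: orth_def)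
    have "adj (W \<inter> orth {v}) y = W" using y W' by (intro hyperplane_adj[OF H]) (auto simp: mem_orth)
    moreover have "adj (W \<inter> orth {v}) y \<subseteq> ssum W' (W \<inter> orth {v})"
      using ssum_upper[OF W'(1) s] y by (intro adj_least subspace_ssum W' s) auto
    moreover have "ssum W' (W \<inter> orth {v}) \<subseteq> W" using W' isoD(1)[OF W(1)] by (intro ssum_least) auto
    ultimately show "ssum W' (W \<inter> orth {v}) = W" by blast
  qed
  show "supplements A W (W \<inter> orth {v}) S = {W'. iso W' \<and> A \<subset> W' \<and> W' \<subset> W \<and> v \<notin> orth W' \<and> S \<inter> W' = {}}"
  proof (intro equalityI subsetI)
    fix W' assume "W' \<in> supplements A W (W \<inter> orth {v}) S"
    note D = supplementsD[OF this]
    have "v \<notin> orth W'" using eq[OF D(1,3)] D(4) by blast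
    moreover have "iso W'" using D by (intro iso_subset[OF W(1)]) auto
    moreover have "A \<noteq> W'" using A(2) \<open>v \<notin> orth W'\<close> by blast
    ultimately show "W' \<in> {W'. iso W' \<and> A \<subset> W' \<and> W' \<subset> W \<and> v \<notin> orth W' \<and> S \<inter> W' = {}}"
      using D by auto
  next
    fix W' assume "W' \<in> {W'. iso W' \<and> A \<subset> W' \<and> W' \<subset> W \<and> v \<notin> orth W' \<and> S \<inter> W' = {}}"
    then show "W' \<in> supplements A W (W \<inter> orth {v}) S"
      using eq[of W'] isoD(1)[of W'] by (auto simp: supplements_def)
  qed
qed

text \<open>By \<open>double_orth\<close>, the last hypothesis says that \<open>v\<close> is a
  nonzero functional on \<open>orth A\<close>. It decides how a subspace \<open>W\<close> with
  exceptional vector \<open>y\<close> is treated: if \<open>y\<close> is outside W + K, the same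
  statement applies to \<open>y\<close> above \<open>W\<close>; if not, \<open>W\<close> is added
  from above, where all of \<open>over W\<close> is present.\<close>

theorem iconn_over_off:
  assumes "iso A" "R \<subseteq> A" "v \<in> orth A" "v \<notin> ssum A K"
  shows "iconn (int witt - int (dim A) - 2) (over_off A v)"
  using assms
proof (induction "witt - dim A" arbitrary: A v rule: less_induct)
  case less
  define X where "X = over_off A v"
  have XI: "iso W" "A \<subset> W" "v \<notin> orth W" if "W \<in> X" for W using that by (auto simp: X_def over_off_def)
  have fh: "finite_height X" by (rule finite_height_iso) (simp add: X_def over_off_def)
  show ?case
  proof (cases "dim A < witt")
    case False
    then show ?thesis using fh unfolding X_def by (intro iconn.low) auto
  next
    case True
    have sA: "subspace A" using less.prems(1) by (rule isoD)
    obtain l where l: "qz l" "l \<in> orth A" "om l v \<noteq> 0"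
      using exists_isotropic_not_orth[OF less.prems(1,2) True less.prems(3,4)] by metis
    have Al: "A \<subseteq> orth {l}" using l(2) by (simp add: subset_orth_singleton)
    have lA: "l \<notin> A" using less.prems(3) l(3) om_commute_zero[of l v] by (auto simp: orth_def)
    \<comment> \<open>\<open>Z\<close> contracts to \<open>Z1\<close> by intersecting with
      \<open>orth {l}\<close>, \<open>Z1\<close> to \<open>Z2\<close> by adding \<open>l\<close>,
      and \<open>Z2\<close> is a cone with apex \<open>adj A l\<close>. The first operation stays in
      \<open>X\<close> by the choice of \<open>Z\<close>, the second because \<open>l\<close> is not
      orthogonal to \<open>v\<close>.\<close>
    define Z where "Z = {W \<in> X. v \<notin> orth (W \<inter> orth {l})}"
    define Z1 where "Z1 = {W \<in> Z. W \<subseteq> orth {l}}"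
    define Z2 where "Z2 = {W \<in> Z1. l \<in> W}"
    have L: "iso (adj A l)" using iso_adj[OF less.prems(1) l(1,2)] .
    have lL: "l \<in> adj A l" by (rule adj_upper)
    have Ll: "adj A l \<subseteq> orth {l}" using isoD(2)[OF L _ lL] by (auto simp: orth_def)
    have vl: "v \<notin> orth W" if "l \<in> W" for W using that l(3) om_commute_zero[of l v] by (auto simp: orth_def)
    have "adj A l \<in> Z2"
    proof -
      have "adj A l \<inter> orth {l} = adj A l" using Ll by blast
      moreover have "A \<subset> adj A l" using adj_upper(1)[of A l] lL lA by blast
      ultimately show ?thesis using L vl[OF lL] lL Ll by (simp add: Z2_def Z1_def Z_def X_def over_off_def)
    qed
    then have Z2: "iconn n Z2" for n
    proof (rule iconn.cone)
      show "W \<subseteq> adj A l \<or> adj A l \<subseteq> W" if "W \<in> Z2" for W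
      proof -
        have "W \<in> X" "l \<in> W" using that by (auto simp: Z2_def Z1_def Z_def)
        then show ?thesis using XI[of W] isoD(1)[of W] adj_least[of W A l] by blast
      qed
    qed
    have fhZ1: "finite_height Z1" using fh by (rule finite_height_subset) (auto simp: Z1_def Z_def)
    have Z1c: "iconn n Z1" for n
    proof (rule iconn_closure_up[OF Z2 _ fhZ1, where f = "\<lambda>W. adj W l"])
      show "Z2 \<subseteq> Z1" by (auto simp: Z2_def)
      show "adj W l \<in> Z2" if "W \<in> Z1" for W
      proof -
        have W: "W \<in> X" "W \<subseteq> orth {l}" using that by (auto simp: Z1_def Z_def)
        note WI = XI[OF W(1)]
        have i: "iso (adj W l)" using iso_adj[OF WI(1) l(1)] W(2) by (simp add: subset_orth_singleton)
        have li: "l \<in> adj W l" by (rule adj_upper)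
        have sub: "adj W l \<subseteq> orth {l}" using isoD(2)[OF i _ li] by (auto simp: orth_def)
        then have "adj W l \<inter> orth {l} = adj W l" by blast
        moreover have "A \<subset> adj W l" using WI(2) adj_upper(1)[of W l] by blast
        ultimately show ?thesis using i vl[OF li] li sub by (simp add: Z2_def Z1_def Z_def X_def over_off_def)
      qed
      show "W \<subseteq> adj W l" for W by (rule adj_upper)
      show "adj W l \<subseteq> W'" if "W \<in> Z1" "W' \<in> Z2" "W \<subseteq> W'" for W W'
      proof -
        have "W' \<in> X" "l \<in> W'" using that by (auto simp: Z2_def Z1_def Z_def)
        then show ?thesis using XI(1)[of W'] isoD(1)[of W'] that(3) by (intro adj_least) auto
      qed
    qed
    have fhZ: "finite_height Z" using fh by (rule finite_height_subset) (auto simp: Z_def)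
    have Zc: "iconn n Z" for n
    proof (rule iconn_closure_down[OF Z1c _ fhZ, where f = "\<lambda>W. W \<inter> orth {l}"])
      show "Z1 \<subseteq> Z" by (auto simp: Z1_def)
      show "W \<inter> orth {l} \<in> Z1" if "W \<in> Z" for W
      proof -
        have W: "W \<in> X" "v \<notin> orth (W \<inter> orth {l})" using that by (auto simp: Z_def)
        note WI = XI[OF W(1)]
        have i: "iso (W \<inter> orth {l})"
          by (rule iso_subset[OF WI(1) subspace_inter[OF isoD(1)[OF WI(1)] subspace_orth]]) blast
        have "A \<subseteq> W \<inter> orth {l}" using WI(2) Al by blast
        moreover have "A \<noteq> W \<inter> orth {l}" using W(2) less.prems(3) by metis
        ultimately show ?thesis using i W(2) by (auto simp: Z1_def Z_def X_def over_off_def Int_assoc)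
      qed
    qed (auto simp: Z1_def)
    have diff_orth: "v - c \<odot> l \<in> orth W \<Longrightarrow> l \<in> orth W \<Longrightarrow> v \<in> orth W" for c W
      using subspace_add[OF subspace_orth, of "v - c \<odot> l" W "c \<odot> l"] subspace_scale[OF subspace_orth, of l W c] by simp
    \<comment> \<open>Two values would make \<open>l\<close>, and then \<open>v\<close>, orthogonal
      to \<open>W\<close>.\<close>
    have uniq: "c = c'" if W: "W \<in> X" "v - c \<odot> l \<in> orth W" "v - c' \<odot> l \<in> orth W" for W c c'
    proof (rule ccontr)
      assume "c \<noteq> c'"
      have "(v - c \<odot> l) - (v - c' \<odot> l) \<in> orth W" 
        by (rule subspace_diff[OF subspace_orth W(2,3)])
      then have "(c' - c) \<odot> l \<in> orth W" by (simp add: scale_left_diff_distrib)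
      then have "inverse (c' - c) \<odot> ((c' - c) \<odot> l) \<in> orth W" by (rule subspace_scale[OF subspace_orth])
      then have "l \<in> orth W" using \<open>c \<noteq> c'\<close> by simp
      then show False using diff_orth W(2) XI(3)[OF W(1)] by blast
    qed
    have notZ: "W \<notin> Z" if W: "v - c \<odot> l \<in> orth W" for W c
    proof
      assume "W \<in> Z"
      have "v - c \<odot> l \<in> orth (W \<inter> orth {l})" using W orth_antimono[of "W \<inter> orth {l}" W] by blast
      moreover have "l \<in> orth (W \<inter> orth {l})" using subset_orth_singleton[of "W \<inter> orth {l}" l] by blast
      ultimately show False using diff_orth \<open>W \<in> Z\<close> by (auto simp: Z_def)
    qed
    \<comment> \<open>On such a \<open>W\<close> the functional of \<open>v\<close> vanishes on the
      kernel of that of \<open>l\<close>, so the two are proportional; the constant is found at a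
      vector \<open>w0\<close> outside the kernel.\<close>
    have notZE: "\<exists>c. v - c \<odot> l \<in> orth W" if W: "W \<in> X" "W \<notin> Z" for W
    proof -
      note WI = XI[OF W(1)]
      obtain w0 where w0: "w0 \<in> W" "om v w0 \<noteq> 0" using WI(3) by (auto simp: orth_def)
      have vo: "om v w = 0" if "w \<in> W" "om l w = 0" for w
        using W that om_sym[of l w] by (auto simp: Z_def orth_def)
      have l0: "om l w0 \<noteq> 0" using vo w0 by blast
      then have l0': "om w0 l \<noteq> 0" using om_sym by blast
      define c where "c = om w0 v / om w0 l"
      define y where "y = v - c \<odot> l"
      have y0: "om w0 y = 0" using l0' by (simp add: y_def c_def om_diff_right om_scale_right)
      have "om w y = 0" if w: "w \<in> W" for w
      proof -
        define k where "k = om l w / om l w0"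
        define u where "u = w - k \<odot> w0"
        have uW: "u \<in> W" using w w0(1) unfolding u_def by (intro subspace_diff subspace_scale isoD(1)[OF WI(1)])
        have lu: "om l u = 0" using l0 by (simp add: u_def k_def om_diff_right om_scale_right)
        have "om u y = 0"
          unfolding y_def om_diff_right om_scale_right using om_sym[OF lu] om_sym[OF vo[OF uW lu]] by simp
        moreover have "om (k \<odot> w0) y = 0" using om_sym[OF y0] by (intro om_sym[of y]) (simp add: om_scale_right)
        moreover have "w = u + k \<odot> w0" by (simp add: u_def)
        ultimately show ?thesis by (simp add: om_add_left)
      qed
      then have "y \<in> orth W" by (simp add: mem_orth)
      then show ?thesis unfolding y_def by blast
    qed
    \<comment> \<open>A \<open>W\<close> in \<open>Z\<close> admits no \<open>c\<close> at all, so
      \<open>Z\<close> is contained in \<open>X'\<close>. The rest of \<open>X'\<close> is added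
      from below, and what is outside \<open>X'\<close> from above.\<close>
    define X' where "X' = {W \<in> X. \<forall>c. v - c \<odot> l \<in> orth W \<longrightarrow> v - c \<odot> l \<notin> ssum W K}"
    have ZX': "Z \<subseteq> X'" using notZ by (auto simp: X'_def Z_def)
    have fhX': "finite_height X'" using fh by (rule finite_height_subset) (auto simp: X'_def)
    \<comment> \<open>The hyperplane \<open>W \<inter> orth {v}\<close> has dimension
      \<open>dim W - 1\<close>, which turns -2 into -3.\<close>
    have lower_conn: "iconn (int (dim W) - int (dim A) - 3) (supplements A W (W \<inter> orth {v}) S)"
      if W: "W \<in> X" and S: "S \<inter> A = {}" "S \<subseteq> {s}" for W S s
    proof -
      note WI = XI[OF W]
      have h: "hyperplane (W \<inter> orth {v}) W" using supplements_orth(2)[OF WI(1,3) _ less.prems(3)] WI(2) by blast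
      have "iconn (int (dim (W \<inter> orth {v})) - int (dim A) - 2) (supplements A W (W \<inter> orth {v}) S)"
      proof (rule iconn_supplements[OF isoD(1)[OF WI(1)] sA _ _ _ S])
        show "subspace (W \<inter> orth {v})" using h by (simp add: hyperplane_def)
        show "A \<subseteq> W \<inter> orth {v}" using WI(2) less.prems(3) subset_orth_singleton[of A v] by blast
      qed blast
      then show ?thesis using h by (simp add: hyperplane_def)
    qed
    have X'c: "iconn (int witt - int (dim A) - 2) X'"
    proof (rule iconn_add_increasing[OF Zc ZX' fhX'])
      fix W assume "W \<in> X' - Z"
      then have W: "W \<in> X" "W \<in> X'" "W \<notin> Z" by (auto simp: X'_def)
      note WI = XI[OF W(1)]
      obtain c where c: "v - c \<odot> l \<in> orth W" using notZE[OF W(1,3)] by blast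
      define y where "y = v - c \<odot> l"
      have y: "y \<in> orth W" "y \<notin> ssum W K" using c W(2) by (auto simp: y_def X'_def)
      have lower: "{z \<in> X'. z \<subset> W} = supplements A W (W \<inter> orth {v}) {}"
      proof -
        \<comment> \<open>A smaller \<open>W'\<close> has the same constant \<open>c\<close>, and W'
          + K is smaller as well.\<close>
        have "W' \<in> X'" if W': "W' \<in> X" "W' \<subset> W" for W'
        proof -
          have "v - c \<odot> l \<in> orth W'" using c orth_antimono[of W' W] W'(2) by blast
          then have "v - c' \<odot> l \<notin> ssum W' K" if "v - c' \<odot> l \<in> orth W'" for c'
            using uniq[OF W'(1) that, of c] y(2) ssum_mono[of W' W K K] W'(2) by (auto simp: y_def)
          then show ?thesis using W'(1) by (auto simp: X'_def)
        qed
        moreover have "X' \<subseteq> X" by (auto simp: X'_def)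
        ultimately have "{z \<in> X'. z \<subset> W} = {z \<in> X. z \<subset> W}" by blast
        also have "\<dots> = supplements A W (W \<inter> orth {v}) {}"
          using supplements_orth(1)[OF WI(1,3) _ less.prems(3), of "{}"] WI(2) by (auto simp: X_def over_off_def)
        finally show ?thesis .
      qed
      \<comment> \<open>Above \<open>W\<close> the only possible constant is \<open>c\<close>, so
        \<open>z\<close> is outside \<open>Z\<close> exactly when \<open>y\<close> is orthogonal to
        it.\<close>
      have upper: "{z \<in> Z. W \<subset> z} = over_off W y"
      proof (intro equalityI subsetI)
        fix z assume "z \<in> {z \<in> Z. W \<subset> z}"
        then have z: "z \<in> Z" "z \<in> X" "W \<subset> z" by (auto simp: Z_def)
        then have "y \<notin> orth z" using notZ unfolding y_def by blast
        then show "z \<in> over_off W y" using z XI[OF z(2)] by (simp add: over_off_def)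
      next
        fix z assume "z \<in> over_off W y"
        then have z: "iso z" "W \<subset> z" "y \<notin> orth z" by (auto simp: over_off_def)
        have oz: "orth z \<subseteq> orth W" using z(2) by (intro orth_antimono) blast
        have zX: "z \<in> X" using z WI oz by (auto simp: X_def over_off_def)
        have "z \<in> Z"
        proof (rule ccontr)
          assume "z \<notin> Z"
          then obtain c' where c': "v - c' \<odot> l \<in> orth z" using notZE[OF zX] by blast
          then have "c' = c" using uniq[OF W(1)] c oz by blast
          then show False using c' z(3) by (simp add: y_def)
        qed
        then show "z \<in> {z \<in> Z. W \<subset> z}" using z by blast
      qed
      have RW: "R \<subseteq> W" using less.prems(2) WI(2) by blast
      have dAW: "dim A < dim W" using dim_strict[OF sA isoD(1)[OF WI(1)] WI(2)] .
      have IH: "iconn (int witt - int (dim W) - 2) (over_off W y)"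
        by (rule less.hyps) (use dAW True WI RW y in auto)
      have "iconn (int (dim W) - int (dim A) - 3 + (int witt - int (dim W) - 2) + 2) ({z \<in> X'. z \<subset> W} \<union> {z \<in> Z. W \<subset> z})"
        unfolding lower upper
      proof (rule iconn_join[OF lower_conn[OF W(1)] IH])
        show "x \<subset> x'" if "x \<in> supplements A W (W \<inter> orth {v}) {}" "x' \<in> over_off W y" for x x'
          using that by (auto simp: supplements_def over_off_def)
      qed auto
      then show "iconn (int witt - int (dim A) - 2 - 1) ({z \<in> X'. z \<subset> W} \<union> {z \<in> Z. W \<subset> z})"
        by (rule iconn_mono) simp
    qed
    have "iconn (int witt - int (dim A) - 2) X"
    proof (rule iconn_add_decreasing[OF X'c _ fh])
      show "X' \<subseteq> X" by (auto simp: X'_def)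
      fix W assume "W \<in> X - X'"
      then obtain c where W: "W \<in> X" and c: "v - c \<odot> l \<in> orth W" "v - c \<odot> l \<in> ssum W K" by (auto simp: X'_def)
      note WI = XI[OF W]
      define y where "y = v - c \<odot> l"
      obtain w k where wk: "w \<in> W" "k \<in> K" "y = w + k" using c(2) unfolding y_def by (rule ssumE)
      \<comment> \<open>To serve as avoided vector \<open>w\<close> must lie outside
        \<open>A\<close>, which is orthogonal to \<open>v\<close>. Indeed \<open>om w v\<close> is
        \<open>om w l * c\<close>, and neither factor vanishes.\<close>
      have "om l y \<noteq> 0" using l(3) qz_om[OF l(1)] by (simp add: y_def om_diff_right om_scale_right)
      then have lw: "om l w \<noteq> 0" using wk by (simp add: om_add_right K_def)
      have "om w y = 0" using c(1) wk(1) by (simp add: y_def mem_orth)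
      then have wv: "om w v = om w l * c" by (simp add: y_def om_diff_right om_scale_right)
      have "c \<noteq> 0" using c(1) WI(3) by auto
      then have "om w v \<noteq> 0" using wv lw om_sym[of w l] by auto
      then have wA: "w \<notin> A" using less.prems(3) by (auto simp: mem_orth)
      have lower: "{z \<in> X'. z \<subset> W} = supplements A W (W \<inter> orth {v}) {w}"
      proof -
        \<comment> \<open>The component of \<open>y\<close> in \<open>W\<close> is unique up to
          \<open>K \<inter> W\<close>, which lies in \<open>R\<close> and hence in
          \<open>W'\<close>.\<close>
        have "W' \<in> X' \<longleftrightarrow> w \<notin> W'" if W': "W' \<in> X" "W' \<subset> W" for W'
        proof -
          have c': "y \<in> orth W'" using c(1) orth_antimono[of W' W] W'(2) by (auto simp: y_def)
          have sW': "subspace W'" using XI(1)[OF W'(1)] by (rule isoD)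
          have "W' \<in> X' \<longleftrightarrow> y \<notin> ssum W' K"
          proof
            assume "W' \<in> X'"
            then show "y \<notin> ssum W' K" using c' unfolding X'_def y_def by blast
          next
            assume y: "y \<notin> ssum W' K"
            have "v - e \<odot> l \<notin> ssum W' K" if "v - e \<odot> l \<in> orth W'" for e
              using uniq[OF W'(1) that c'[unfolded y_def]] y by (simp add: y_def)
            then show "W' \<in> X'" using W'(1) unfolding X'_def by blast
          qed
          also have "\<dots> \<longleftrightarrow> w \<notin> W'"
          proof -
            have "w \<in> W'" if yK: "y \<in> ssum W' K"
            proof -
              obtain w' k' where wk': "w' \<in> W'" "k' \<in> K" "y = w' + k'" using yK by (rule ssumE)
              have "w - w' = k' - k" using wk wk' by (simp add: algebra_simps)
              then have "w - w' \<in> K" using subspace_diff[OF subspace_K wk'(2) wk(2)] by simp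
              moreover have "w - w' \<in> W" using wk(1) wk'(1) W'(2) by (intro subspace_diff isoD(1)[OF WI(1)]) auto
              then have "qz (w - w')" using isoD(3)[OF WI(1)] by blast
              ultimately have "w - w' \<in> W'" using less.prems(2) XI(2)[OF W'(1)] by (auto simp: R_def)
              then have "(w - w') + w' \<in> W'" using wk'(1) sW' by (intro subspace_add)
              then show ?thesis by simp
            qed
            moreover have "y \<in> ssum W' K" if "w \<in> W'" using that wk by (auto intro: ssumI)
            ultimately show ?thesis by blast
          qed
          finally show ?thesis .
        qed
        moreover have "X' \<subseteq> X" by (auto simp: X'_def)
        ultimately have "{z \<in> X'. z \<subset> W} = {z \<in> X. z \<subset> W \<and> w \<notin> z}" by blast
        also have "\<dots> = supplements A W (W \<inter> orth {v}) {w}"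
          using supplements_orth(1)[OF WI(1,3) _ less.prems(3), of "{w}"] WI(2) by (auto simp: X_def over_off_def)
        finally show ?thesis .
      qed
      have upper: "{z \<in> X. W \<subset> z} = over W"
        using WI orth_antimono[of W] by (auto simp: X_def over_off_def over_def)
      have "iconn (int (dim W) - int (dim A) - 3 + (int witt - int (dim W) - 2) + 2) ({z \<in> X'. z \<subset> W} \<union> {z \<in> X. W \<subset> z})"
        unfolding lower upper
      proof (rule iconn_join[OF lower_conn[OF W] iconn_over[OF WI(1)]])
        show "x \<subset> x'" if "x \<in> supplements A W (W \<inter> orth {v}) {w}" "x' \<in> over W" for x x'
          using that by (auto simp: supplements_def over_def)
      qed (use wA in auto)
      then show "iconn (int witt - int (dim A) - 2 - 1) ({z \<in> X'. z \<subset> W} \<union> {z \<in> X. W \<subset> z})"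
        by (rule iconn_mono) simp
    qed
    then show ?thesis by (simp add: X_def)
  qed
qed

section \<open>Isotropic subspaces opposite to a given one\<close>

definition opposite :: "'b set \<Rightarrow> 'b set set" where
  "opposite U = {W. iso W \<and> R \<subseteq> W \<and> orth W \<inter> U \<subseteq> R}"

text \<open>An isotropic \<open>U\<close> meets \<open>K\<close> inside \<open>R\<close>, so the
  criterion of \<open>ssum_orth_UNIV\<close> can be phrased with \<open>R\<close>.\<close>

lemma opposite_iff_ssum:
  assumes U: "iso U" and W: "iso W" "R \<subseteq> W"
  shows "W \<in> opposite U \<longleftrightarrow> ssum W (orth U) = UNIV"
proof -
  have "orth W \<inter> U \<subseteq> R \<longleftrightarrow> orth W \<inter> U \<subseteq> K" using isoD(3)[OF U] by (auto simp: R_def)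
  then show ?thesis
    using ssum_orth_UNIV[OF isoD(1)[OF W(1)] isoD(1)[OF U]] W by (simp add: opposite_def)
qed

text \<open>The modular law identifies what lies below \<open>W\<close> with supplements of
  \<open>orth U \<inter> W\<close>. The dimension comes from \<open>pairing\<close>, since
  \<open>U \<inter> orth W\<close> is exactly \<open>R\<close>.\<close>

lemma opposite_below:
  assumes U: "iso U" "R \<subseteq> U" and W: "W \<in> opposite U"
  shows "supplements R W (orth U \<inter> W) S = {W' \<in> opposite U. W' \<subset> W \<and> S \<inter> W' = {}}"
    and "int (dim (orth U \<inter> W)) = int (dim W) - int (dim U) + int (dim R)"
proof -
  have WI: "iso W" "R \<subseteq> W" "orth W \<inter> U \<subseteq> R" using W by (auto simp: opposite_def)
  have V: "ssum W (orth U) = UNIV" using W opposite_iff_ssum[OF U(1) WI(1,2)] by simp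
  have eq: "ssum W' (orth U \<inter> W) = W \<longleftrightarrow> W' \<in> opposite U" if W': "subspace W'" "W' \<subset> W" "R \<subseteq> W'" for W'
  proof -
    have "iso W'" using W' by (intro iso_subset[OF WI(1)]) auto
    then show ?thesis
      using ssum_modular[OF isoD(1)[OF WI(1)] subspace_orth W'(1) _ V] W' opposite_iff_ssum[OF U(1), of W'] by auto
  qed
  show "supplements R W (orth U \<inter> W) S = {W' \<in> opposite U. W' \<subset> W \<and> S \<inter> W' = {}}"
  proof (intro equalityI subsetI)
    fix W' assume "W' \<in> supplements R W (orth U \<inter> W) S"
    note D = supplementsD[OF this]
    show "W' \<in> {W' \<in> opposite U. W' \<subset> W \<and> S \<inter> W' = {}}" using eq[OF D(1,3,2)] D by simp
  next
    fix W' assume W': "W' \<in> {W' \<in> opposite U. W' \<subset> W \<and> S \<inter> W' = {}}"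
    then have "subspace W'" "R \<subseteq> W'" using isoD(1)[of W'] by (auto simp: opposite_def)
    then show "W' \<in> supplements R W (orth U \<inter> W) S" using eq[of W'] W' by (simp add: supplements_def)
  qed
  have "U \<inter> orth W = R"
    using WI(3) U(2) R_subset_K K_subset_orth[of W] by blast
  then show "int (dim (orth U \<inter> W)) = int (dim W) - int (dim U) + int (dim R)"
    using pairing[OF isoD(1)[OF WI(1)] isoD(1)[OF U(1)]] by (simp add: Int_commute)
qed

text \<open>For \<open>W\<close> in \<open>opposite U'\<close>, with \<open>U'\<close> a hyperplane
  of \<open>U\<close>, the space \<open>orth W \<inter> U\<close> exceeds \<open>R\<close> by at
  most a line. If this line lies in \<open>W\<close>, the upper link is \<open>over W\<close>; if
  not, it is \<open>over_off W s\<close> for a spanning vector \<open>s\<close>. The two kinds are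
  removed in turn, in opposite orders.\<close>

theorem opposite_connected:
  assumes "iso U" "R \<subset> U"
  shows "poset_connected (int witt - int (dim U) - 1) (opposite U)"
  using assms
proof (induction "dim U" arbitrary: U rule: less_induct)
  case less
  note U = less.prems
  have sU: "subspace U" using U(1) by (rule isoD)
  obtain p where p: "p \<in> U" "p \<notin> R" using U(2) by blast
  have "R \<subseteq> U" using U(2) by blast
  from exists_hyperplane[OF sU subspace_R this p p(2)] obtain U' where U': "hyperplane U' U" "R \<subseteq> U'"
    by metis
  have U'D: "subspace U'" "U' \<subseteq> U" "dim U = Suc (dim U')" using U'(1) by (auto simp: hyperplane_def)
  have iU': "iso U'" using U'D by (intro iso_subset[OF U(1)])
  show ?case
  proof (cases "U' = R")
    case True
    have adj: "U = adj R p" using hyperplane_adj[OF U'(1) p(1)] p(2) True by simp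
    have "p \<in> orth R" using R_subset_K K_subset_orth subset_orth_singleton[of R p] by blast
    moreover have "p \<notin> ssum R K" using iso_mem[OF iso_R subset_refl isoD(3)[OF U(1) p(1)]] p(2) by blast
    ultimately have "iconn (int witt - int (dim R) - 2) (over_off R p)"
      by (intro iconn_over_off iso_R subset_refl)
    moreover have "over_off R p = opposite U"
    proof -
      have "orth W \<inter> U \<subseteq> R \<longleftrightarrow> p \<notin> orth W" if "R \<subseteq> W" for W
      proof
        assume "p \<notin> orth W"
        show "orth W \<inter> U \<subseteq> R"
        proof
          fix x assume x: "x \<in> orth W \<inter> U"
          then obtain k where k: "x - k \<odot> p \<in> R" using adj mem_adj_iff[OF subspace_R] by blast
          then have "x - k \<odot> p \<in> orth W" using R_subset_K K_subset_orth by blast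
          then have "x - (x - k \<odot> p) \<in> orth W" 
            using x subspace_diff[OF subspace_orth, of x W "x - k \<odot> p"] by blast
          then have kp: "k \<odot> p \<in> orth W" by simp
          have "k = 0"
          proof (rule ccontr)
            assume "k \<noteq> 0"
            have "inverse k \<odot> (k \<odot> p) \<in> orth W" using kp by (rule subspace_scale[OF subspace_orth])
            then show False using \<open>p \<notin> orth W\<close> \<open>k \<noteq> 0\<close> by simp
          qed
          then show "x \<in> R" using k by simp
        qed
      qed (use p in blast)
      moreover have "R \<noteq> W" if "p \<notin> orth W" for W using that \<open>p \<in> orth R\<close> by blast
      ultimately show ?thesis by (auto simp: over_off_def opposite_def)
    qed
    ultimately show ?thesis
      using iconn_imp_poset_connected[of _ "opposite U"] U'D(3) True by (simp add: algebra_simps)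
  next
    case False
    then have RU': "R \<subset> U'" using U'(2) by blast
    define n where "n = int witt - int (dim U) - 1"
    define X where "X = opposite U'"
    have fhX: "finite_height X" by (rule finite_height_iso) (simp add: X_def opposite_def)
    have IH: "poset_connected (int witt - int (dim U') - 1) X"
      unfolding X_def by (rule less.hyps) (use U'D iU' RU' in auto)
    \<comment> \<open>Induction provides degree \<open>n + 1\<close>; the links allow only
      \<open>n\<close>.\<close>
    then have Xc: "poset_connected n X" using U'D(3) by (auto simp: poset_connected_def n_def)
    have XI: "iso W" "R \<subseteq> W" "orth W \<inter> U' \<subseteq> R" if "W \<in> X" for W using that by (auto simp: X_def opposite_def)
    define X0 where "X0 = {W \<in> X. W \<inter> U \<subseteq> R}"
    have lower_conn: "iconn (int (dim W) - int (dim U') - 2) (supplements R W (orth U' \<inter> W) S)"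
      if W: "W \<in> X" and S: "S \<inter> R = {}" "S \<subseteq> {s}" for W S s
    proof -
      have "iconn (int (dim (orth U' \<inter> W)) - int (dim R) - 2) (supplements R W (orth U' \<inter> W) S)"
      proof (rule iconn_supplements[OF isoD(1)[OF XI(1)[OF W]] subspace_R _ _ _ S])
        show "subspace (orth U' \<inter> W)" using subspace_orth isoD(1)[OF XI(1)[OF W]] by (rule subspace_inter)
        show "R \<subseteq> orth U' \<inter> W" using XI(2)[OF W] R_subset_K K_subset_orth[of U'] by blast
      qed blast
      then show ?thesis using opposite_below(2)[OF iU' U'(2) W[unfolded X_def]] by simp
    qed
    \<comment> \<open>As \<open>dim U\<close> is \<open>dim U' + 1\<close>, the degree of the join
      is exactly \<open>n\<close>, which is what removal asks of a link.\<close>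
    have join: "poset_connected n (P \<union> Q)" if "iconn (int (dim W) - int (dim U') - 2) P" "iconn (int witt - int (dim W) - 2) Q"
      "\<And>x y. x \<in> P \<Longrightarrow> y \<in> Q \<Longrightarrow> x \<subset> y" for P Q W
      by (rule iconn_imp_poset_connected, rule iconn_mono[OF iconn_join[OF that]]) (simp_all add: n_def U'D(3))
    have notU': "s \<notin> U'" if "W \<in> X" "s \<in> orth W" "s \<notin> R" for s W
      using XI(3)[OF that(1)] that(2,3) by blast
    \<comment> \<open>\<open>orth W \<inter> U\<close> meets the hyperplane \<open>U'\<close> inside
      \<open>R\<close>. So any \<open>x\<close> of it outside \<open>R\<close> is, up to
      \<open>R\<close>, a nonzero multiple of \<open>s\<close>, and a subspace over \<open>R\<close>
      containing \<open>x\<close> contains \<open>s\<close>.\<close>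
    have key: "s \<in> Y" if s: "s \<in> U" "s \<notin> U'" and x: "x \<in> U" "x \<notin> R" "x \<in> Y"
      and Y: "subspace Y" "R \<subseteq> Y" and W: "W \<in> X" "x \<in> orth W" "s \<in> orth W" for s x Y W
    proof -
      obtain k where k: "x - k \<odot> s \<in> U'" using hyperplane_decomp[OF U'(1) s x(1)] .
      have "x - k \<odot> s \<in> orth W" using W by (intro subspace_diff[OF subspace_orth] subspace_scale[OF subspace_orth])
      then have r: "x - k \<odot> s \<in> R" using k XI(3)[OF W(1)] by blast
      then have "k \<noteq> 0" using x(2) by auto
      have "x - (x - k \<odot> s) \<in> Y" by (rule subspace_diff[OF Y(1) x(3)]) (use r Y(2) in blast)
      then have "k \<odot> s \<in> Y" by simp
      then have "inverse k \<odot> (k \<odot> s) \<in> Y" by (rule subspace_scale[OF Y(1)])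
      then show "s \<in> Y" using \<open>k \<noteq> 0\<close> by simp
    qed
    \<comment> \<open>For a \<open>W\<close> meeting \<open>U\<close> outside \<open>R\<close>:
      below it, belonging to \<open>X0\<close> means avoiding \<open>s\<close>, and above it
      everything is still present.\<close>
    have X0c: "poset_connected n X0"
    proof (rule poset_connected_remove_decreasing[OF Xc fhX])
      show "X0 \<subseteq> X" by (auto simp: X0_def)
      fix W assume "W \<in> X - X0"
      then obtain s where W: "W \<in> X" and s: "s \<in> W" "s \<in> U" "s \<notin> R" by (auto simp: X0_def)
      note WI = XI[OF W]
      have Wo: "W \<subseteq> orth W" using iso_subset_orth[OF WI(1) subset_refl] .
      have sU': "s \<notin> U'" using notU'[OF W _ s(3)] Wo s(1) by blast
      have "{z \<in> X0. z \<subset> W} = {z \<in> X. z \<subset> W \<and> {s} \<inter> z = {}}"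
      proof -
        have "z \<inter> U \<subseteq> R \<longleftrightarrow> s \<notin> z" if z: "z \<in> X" "z \<subset> W" for z
          using key[OF s(2) sU' _ _ _ isoD(1)[OF XI(1)[OF z(1)]] XI(2)[OF z(1)] W] Wo s z(2) by blast
        then show ?thesis by (auto simp: X0_def)
      qed
      also have "\<dots> = supplements R W (orth U' \<inter> W) {s}"
        using opposite_below(1)[OF iU' U'(2) W[unfolded X_def]] by (simp add: X_def)
      finally have lower: "{z \<in> X0. z \<subset> W} = supplements R W (orth U' \<inter> W) {s}" .
      have upper: "{z \<in> X. W \<subset> z} = over W"
      proof -
        have "z \<in> X" if "iso z" "W \<subset> z" for z
          using that WI orth_antimono[of W z] by (auto simp: X_def opposite_def)
        then show ?thesis using XI(1) by (auto simp: over_def)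
      qed
      show "poset_connected n ({z \<in> X0. z \<subset> W} \<union> {z \<in> X. W \<subset> z})"
        unfolding lower upper
      proof (rule join[of W])
        show "iconn (int (dim W) - int (dim U') - 2) (supplements R W (orth U' \<inter> W) {s})"
          using s by (intro lower_conn[OF W, of _ s]) auto
        show "iconn (int witt - int (dim W) - 2) (over W)" by (rule iconn_over[OF WI(1)])
        show "x \<subset> y" if "x \<in> supplements R W (orth U' \<inter> W) {s}" "y \<in> over W" for x y
          using that by (auto simp: supplements_def over_def)
      qed
    qed
    have sub: "opposite U \<subseteq> X0"
    proof
      fix W assume W: "W \<in> opposite U"
      then have "iso W" by (simp add: opposite_def)
      then have "W \<inter> U \<subseteq> orth W \<inter> U" using iso_subset_orth[of W W] by blast
      then show "W \<in> X0" using W U'D(2) by (auto simp: opposite_def X0_def X_def)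
    qed
    \<comment> \<open>Now \<open>W \<inter> U \<subseteq> R\<close> keeps the isotropic vector
      \<open>s\<close> out of W + K, so \<open>iconn_over_off\<close> applies above
      \<open>W\<close>, while everything of \<open>X\<close> below \<open>W\<close> belongs to
      \<open>X0\<close>.\<close>
    have "poset_connected n (opposite U)"
    proof (rule poset_connected_remove_increasing[OF X0c _ sub])
      show "finite_height X0" using fhX by (rule finite_height_subset) (auto simp: X0_def)
      fix W assume "W \<in> X0 - opposite U"
      then have W: "W \<in> X" "W \<inter> U \<subseteq> R" "W \<notin> opposite U" by (auto simp: X0_def)
      note WI = XI[OF W(1)]
      obtain s where s: "s \<in> orth W" "s \<in> U" "s \<notin> R" using W(3) WI by (auto simp: opposite_def)
      have sU': "s \<notin> U'" using notU'[OF W(1) s(1,3)] .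
      have "{z \<in> X0. z \<subset> W} = {z \<in> X. z \<subset> W \<and> {} \<inter> z = {}}" using W(2) by (auto simp: X0_def)
      also have "\<dots> = supplements R W (orth U' \<inter> W) {}"
        using opposite_below(1)[OF iU' U'(2) W(1)[unfolded X_def]] by (simp add: X_def)
      finally have lower: "{z \<in> X0. z \<subset> W} = supplements R W (orth U' \<inter> W) {}" .
      have upper: "{z \<in> opposite U. W \<subset> z} = over_off W s"
      proof -
        have "orth z \<inter> U \<subseteq> R \<longleftrightarrow> s \<notin> orth z" if z: "W \<subset> z" for z
        proof -
          have oz: "orth z \<subseteq> orth W" using z by (intro orth_antimono) blast
          have "R \<subseteq> orth z" using R_subset_K K_subset_orth by blast
          from key[OF s(2) sU' _ _ _ subspace_orth this W(1) _ s(1)] show ?thesis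
            using oz s by blast
        qed
        then show ?thesis using WI(2) by (auto simp: opposite_def over_off_def)
      qed
      have "s \<notin> ssum W K"
        using iso_mem[OF WI(1,2) isoD(3)[OF U(1) s(2)]] W(2) s by blast
      then have c2: "iconn (int witt - int (dim W) - 2) (over_off W s)"
        using iconn_over_off[OF WI(1,2) s(1)] by blast
      show "poset_connected n ({z \<in> X0. z \<subset> W} \<union> {z \<in> opposite U. W \<subset> z})"
        unfolding lower upper
      proof (rule join[OF _ c2])
        show "iconn (int (dim W) - int (dim U') - 2) (supplements R W (orth U' \<inter> W) {})"
          by (intro lower_conn[OF W(1)]) auto
        show "x \<subset> y" if "x \<in> supplements R W (orth U' \<inter> W) {}" "y \<in> over_off W s" for x y
          using that by (auto simp: supplements_def over_off_def)
      qed
    qed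
    then show ?thesis by (simp add: n_def)
  qed
qed

end

section \<open>The Cohen--Macaulay property\<close>

text \<open>An upper bound serves because connectivity passes to smaller degrees. The empty chain,
  of length -1, keeps the set under \<open>Max\<close> nonempty.\<close>

lemma poset_dim_le:
  assumes "\<And>C. C \<subseteq> Q \<Longrightarrow> finite C \<Longrightarrow> is_chain C \<Longrightarrow> card C \<le> m"
  shows "poset_dim Q \<le> int m - 1"
proof -
  let ?D = "{int (card C) - 1 | C. C \<subseteq> Q \<and> finite C \<and> is_chain C}"
  have D: "d \<in> {-1..int m - 1}" if "d \<in> ?D" for d
  proof -
    obtain C where C: "d = int (card C) - 1" "C \<subseteq> Q" "finite C" "is_chain C" using \<open>d \<in> ?D\<close> by blast
    show ?thesis using assms[OF C(2-4)] C(1) by simp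
  qed
  then have "?D \<subseteq> {-1..int m - 1}" by blast
  then have "finite ?D" by (rule finite_subset) simp
  moreover have "int (card {}) - 1 \<in> ?D" by (rule CollectI, rule exI[of _ "{}"]) (simp add: is_chain_def)
  ultimately show ?thesis
    unfolding poset_dim_def by (intro Max.boundedI) (use D in auto)
qed

context isotropic_geometry
begin

lemma poset_dim_subspaces:
  assumes "\<And>W. W \<in> X \<Longrightarrow> subspace W \<and> a \<le> dim W \<and> dim W < b"
  shows "poset_dim X \<le> int (b - a) - 1"
proof (rule poset_dim_le)
  fix C assume C: "C \<subseteq> X" "finite C" "is_chain C"
  have "inj_on dim C"
  proof (rule inj_onI)
    fix V W assume VW: "V \<in> C" "W \<in> C" "dim V = dim W"
    then have s: "subspace V" "subspace W" using assms C(1) by auto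
    consider "V \<subseteq> W" | "W \<subseteq> V" using C(3) VW unfolding is_chain_def by blast
    then show "V = W"
    proof cases
      case 1
      then show ?thesis using s VW(3) by (intro subspace_dim_equal) auto
    next
      case 2
      then show ?thesis using s VW(3) subspace_dim_equal[of W V] by auto
    qed
  qed
  moreover have "dim ` C \<subseteq> {a..<b}" using assms C(1) by fastforce
  ultimately have "card C \<le> card {a..<b}" by (metis card_image card_mono finite_atLeastLessThan)
  then show "card C \<le> b - a" by simp
qed

lemma k_connected_subspaces:
  assumes "\<And>W. W \<in> X \<Longrightarrow> subspace W \<and> a \<le> dim W \<and> dim W < b" "poset_connected (int (b - a) - 2) X"
  shows "k_connected (poset_dim X - 1) (realization X)"
  using poset_dim_subspaces[of X a b, OF assms(1)] by (intro poset_connected_imp_k_connected[OF assms(2)]) simp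

text \<open>Four kinds of intervals: the whole poset, a supplement poset below \<open>y\<close>, all
  isotropic subspaces above \<open>x\<close>, and an interval of subspaces between two members.
  Above \<open>x\<close> the condition defining \<open>opposite U\<close> is inherited, since
  \<open>orth\<close> shrinks.\<close>

theorem cohen_macaulay_opposite:
  assumes U: "iso U" "R \<subset> U"
  shows "cohen_macaulay (opposite U)"
  unfolding cohen_macaulay_def
proof (intro allI impI)
  have RU: "R \<subseteq> U" using U(2) by blast
  have QI: "iso W" "R \<subseteq> W" "orth W \<inter> U \<subseteq> R" "subspace W" "dim W \<le> witt" "dim U \<le> dim W" if "W \<in> opposite U" for W
  proof -
    show *: "iso W" "R \<subseteq> W" "orth W \<inter> U \<subseteq> R" using that by (auto simp: opposite_def)
    show "subspace W" "dim W \<le> witt" using *(1) isoD(1) iso_dim_le by auto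
    \<comment> \<open>Through the dimension formula of \<open>opposite_below\<close> this bounds
      \<open>dim W\<close> from below.\<close>
    have "R \<subseteq> orth U \<inter> W" using *(2) R_subset_K K_subset_orth by blast
    then show "dim U \<le> dim W" using opposite_below(2)[OF U(1) RU that] dim_subset[of R "orth U \<inter> W"] by linarith
  qed
  have up: "z \<in> opposite U" if "x \<in> opposite U" "iso z" "x \<subset> z" for x z
    using that orth_antimono[of x z] by (auto simp: opposite_def)
  fix lo hi
  assume LH: "(\<forall>x. lo = Some x \<longrightarrow> x \<in> opposite U) \<and> (\<forall>y. hi = Some y \<longrightarrow> y \<in> opposite U) \<and>
    (\<forall>x y. lo = Some x \<and> hi = Some y \<longrightarrow> x \<subseteq> y)"
  let ?I = "open_interval (opposite U) lo hi"
  show "k_connected (poset_dim ?I - 1) (realization ?I)"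
  proof (cases lo)
    case None
    show ?thesis
    proof (cases hi)
      case hi: None
      have I: "?I = opposite U" by (simp add: open_interval_def None hi)
      have "dim U \<le> witt" using U(1) by (rule iso_dim_le)
      then have "poset_connected (int (Suc witt - dim U) - 2) (opposite U)"
        using opposite_connected[OF U] by (simp add: of_nat_diff)
      then show ?thesis
        unfolding I
      proof (rule k_connected_subspaces[rotated])
        show "subspace W \<and> dim U \<le> dim W \<and> dim W < Suc witt" if "W \<in> opposite U" for W
          using QI(4-6)[OF that] by simp
      qed
    next
      case (Some y)
      then have y: "y \<in> opposite U" using LH by blast
      note Y = QI[OF y]
      have I: "?I = supplements R y (orth U \<inter> y) {}"
        unfolding opposite_below(1)[OF U(1) RU y] by (auto simp: open_interval_def None Some)
      have "iconn (int (dim (orth U \<inter> y)) - int (dim R) - 2) ?I"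
        unfolding I
      proof (rule iconn_supplements[OF Y(4) subspace_R])
        show "subspace (orth U \<inter> y)" using subspace_orth Y(4) by (rule subspace_inter)
        show "R \<subseteq> orth U \<inter> y" using Y(2) R_subset_K K_subset_orth by blast
      qed auto
      then have "poset_connected (int (dim y - dim U) - 2) ?I"
        using opposite_below(2)[OF U(1) RU y] Y(6) by (intro iconn_imp_poset_connected) (simp add: of_nat_diff)
      then show ?thesis
      proof (rule k_connected_subspaces[rotated])
        fix W assume "W \<in> ?I"
        then have W: "W \<in> opposite U" "W \<subset> y" by (auto simp: open_interval_def None Some)
        then show "subspace W \<and> dim U \<le> dim W \<and> dim W < dim y"
          using QI[OF W(1)] dim_strict[of W y] Y(4) by simp
      qed
    qed
  next
    case (Some x)
    then have x: "x \<in> opposite U" using LH by blast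
    note X = QI[OF x]
    show ?thesis
    proof (cases hi)
      case None
      have I: "?I = over x" using up[OF x] QI(1) by (auto simp: open_interval_def None Some over_def)
      have "poset_connected (int (Suc witt - Suc (dim x)) - 2) ?I"
        unfolding I using iconn_imp_poset_connected[OF iconn_over[OF X(1)]] X(5) by (simp add: of_nat_diff)
      then show ?thesis
      proof (rule k_connected_subspaces[rotated])
        fix W assume "W \<in> ?I"
        then have W: "W \<in> opposite U" "x \<subset> W" by (auto simp: open_interval_def None Some)
        then show "subspace W \<and> Suc (dim x) \<le> dim W \<and> dim W < Suc witt"
          using QI[OF W(1)] dim_strict[of x W] X(4) by simp
      qed
    next
      case hi: (Some y)
      then have y: "y \<in> opposite U" "x \<subseteq> y" using LH Some by blast+
      note Y = QI[OF y(1)]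
      have bounds: "subspace W \<and> Suc (dim x) \<le> dim W \<and> dim W < dim y" if "W \<in> ?I" for W
      proof -
        have W: "W \<in> opposite U" "x \<subset> W" "W \<subset> y" using that by (auto simp: open_interval_def Some hi)
        then show ?thesis using QI[OF W(1)] dim_strict[of x W] dim_strict[of W y] X(4) Y(4) by simp
      qed
      have I: "?I = {W. subspace W \<and> x \<subset> W \<and> W \<subset> y}"
      proof -
        have "W \<in> opposite U" if "subspace W" "x \<subset> W" "W \<subset> y" for W
          using up[OF x] iso_subset[OF Y(1) that(1)] that by blast
        then show ?thesis using QI(4) by (auto simp: open_interval_def Some hi)
      qed
      \<comment> \<open>For \<open>x = y\<close> the truncated difference is 0, and the interval is
        empty with required degree -2.\<close>
      have "iconn (int (dim y - Suc (dim x)) - 2) ?I"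
      proof (cases "x = y")
        case True
        then show ?thesis
          by (intro iconn.low finite_height_subspaces) (use bounds in auto)
      next
        case False
        then have "x \<subset> y" using y(2) by blast
        then show ?thesis
          using iconn_interval[OF X(4) Y(4)] dim_strict[OF X(4) Y(4)] unfolding I by (simp add: of_nat_diff algebra_simps)
      qed
      then show ?thesis
        by (intro k_connected_subspaces[OF bounds] iconn_imp_poset_connected)
    qed
  qed
qed

end

section \<open>From formed spaces to isotropic geometries\<close>

lemma formed_space_isotropic_geometry:
  fixes \<sigma> :: "'k::field \<Rightarrow> 'k" and smul :: "'k \<Rightarrow> 'v::ab_group_add \<Rightarrow> 'v"
  assumes "formed_space \<sigma> \<epsilon> \<Lambda> smul q"
  obtains B where "isotropic_geometry smul B (omega_form \<sigma> \<epsilon> q) (\<lambda>v. \<forall>a. \<sigma> a * q v v * a \<in> \<Lambda>)"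
proof -
  have par: "form_parameters \<sigma> \<epsilon> \<Lambda>" and vs: "vector_space smul" and ses: "sesquilinear \<sigma> smul q"
    using assms by (auto simp: formed_space_def)
  interpret vector_space smul by (rule vs)
  note P = par[unfolded form_parameters_def]
  have s_add: "\<sigma> (a + b) = \<sigma> a + \<sigma> b" for a b using P by simp
  have s_mult: "\<sigma> (a * b) = \<sigma> a * \<sigma> b" for a b using P by simp
  have ss: "\<sigma> (\<sigma> a) = a" for a using P by simp
  have s1: "\<sigma> 1 = 1" and e: "\<epsilon> * \<sigma> \<epsilon> = 1" and L0: "0 \<in> \<Lambda>" using P by simp_all
  have Ladd: "a + b \<in> \<Lambda>" if "a \<in> \<Lambda>" "b \<in> \<Lambda>" for a b using P that by simp
  have Lmin: "a - \<epsilon> * \<sigma> a \<in> \<Lambda>" for a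
  proof -
    have "{c - \<epsilon> * \<sigma> c | c. True} \<subseteq> \<Lambda>" using P by simp
    then show ?thesis by blast
  qed
  have Lmax: "a + \<epsilon> * \<sigma> a = 0" if "a \<in> \<Lambda>" for a
  proof -
    have "\<Lambda> \<subseteq> {c. c + \<epsilon> * \<sigma> c = 0}" using P by simp
    then show ?thesis using that by blast
  qed
  have s0: "\<sigma> 0 = 0" using s_add[of 0 0] by (metis add_0_left add_cancel_right_right)
  have s_minus: "\<sigma> (- a) = - \<sigma> a" for a using s_add[of a "- a"] s0 by (simp add: eq_neg_iff_add_eq_0 add.commute)
  have q_add1: "q (v + v') w = q v w + q v' w" for v v' w using ses by (simp add: sesquilinear_def)
  have q_add2: "q v (w + w') = q v w + q v w'" for v w w' using ses by (simp add: sesquilinear_def)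
  have q_sc: "q (smul a v) (smul b w) = \<sigma> a * q v w * b" for v w a b using ses by (simp add: sesquilinear_def)
  have q_sc1: "q (smul a v) w = \<sigma> a * q v w" for a v w using q_sc[of a v 1 w] by simp
  have q_sc2: "q v (smul b w) = q v w * b" for b v w using q_sc[of 1 v b w] by (simp add: s1)
  let ?om = "omega_form \<sigma> \<epsilon> q"
  have om_comm: "?om y x = \<epsilon> * \<sigma> (?om x y)" for x y
  proof -
    have "\<epsilon> * \<sigma> (?om x y) = \<epsilon> * \<sigma> (q x y) + (\<epsilon> * \<sigma> \<epsilon>) * q y x"
      by (simp add: omega_form_def s_add s_mult ss algebra_simps)
    then show ?thesis by (simp add: e omega_form_def add.commute)
  qed
  obtain B where B: "finite B" "span B = UNIV" using assms by (auto simp: formed_space_def)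
  obtain B' where B': "B' \<subseteq> B" "independent B'" "B \<subseteq> span B'" using maximal_independent_subset by blast
  have "span B' = UNIV" using B(2) span_mono[OF B'(3)] by (simp add: span_span top.extremum_unique)
  then interpret finite_dimensional_vector_space smul B'
    using B' finite_subset[OF B'(1) B(1)] by unfold_locales auto
  have "isotropic_geometry smul B' ?om (\<lambda>v. \<forall>a. \<sigma> a * q v v * a \<in> \<Lambda>)"
  proof unfold_locales
    fix x y z :: 'v and c :: 'k
    show "?om (x + y) z = ?om x z + ?om y z"
      by (simp add: omega_form_def q_add1 q_add2 s_add algebra_simps)
    show "?om x (y + z) = ?om x y + ?om x z"
      by (simp add: omega_form_def q_add1 q_add2 s_add algebra_simps)
    show "?om x (smul c y) = ?om x y * c"
      by (simp add: omega_form_def q_sc1 q_sc2 s_mult ss algebra_simps)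
    show "?om y x = 0" if "?om x y = 0" using om_comm[of y x] that s0 by simp
    have "q 0 0 = 0" using q_sc1[of 0 0 0] s0 by simp
    then show "\<forall>a. \<sigma> a * q 0 0 * a \<in> \<Lambda>" using L0 by simp
    show "\<forall>a. \<sigma> a * q (smul c x) (smul c x) * a \<in> \<Lambda>" if "\<forall>a. \<sigma> a * q x x * a \<in> \<Lambda>"
    proof
      fix a
      have "\<sigma> a * q (smul c x) (smul c x) * a = \<sigma> (a * c) * q x x * (a * c)"
        by (simp add: q_sc s_mult algebra_simps)
      also have "\<dots> \<in> \<Lambda>" using that by blast
      finally show "\<sigma> a * q (smul c x) (smul c x) * a \<in> \<Lambda>" .
    qed
    show "?om x x = 0" if "\<forall>a. \<sigma> a * q x x * a \<in> \<Lambda>"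
      using Lmax[of "q x x"] spec[OF that, of 1] by (simp add: omega_form_def s1)
    show "\<forall>a. \<sigma> a * q (x + y) (x + y) * a \<in> \<Lambda>"
      if x: "\<forall>a. \<sigma> a * q x x * a \<in> \<Lambda>" and y: "\<forall>a. \<sigma> a * q y y * a \<in> \<Lambda>" and xy: "?om x y = 0"
    proof
      fix a
      \<comment> \<open>Orthogonality turns the two mixed terms into
        \<open>d - \<epsilon> * \<sigma> d\<close>, an element of the smallest admissible
        \<open>\<Lambda>\<close>.\<close>
      define d where "d = \<sigma> a * q y x * a"
      have sd: "\<sigma> d = \<sigma> a * \<sigma> (q y x) * a" by (simp add: d_def s_mult ss algebra_simps)
      have qxy: "q x y = - (\<epsilon> * \<sigma> (q y x))" using xy by (simp add: omega_form_def eq_neg_iff_add_eq_0)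
      have "\<sigma> a * q (x + y) (x + y) * a = \<sigma> a * q x x * a + \<sigma> a * q y y * a + (d - \<epsilon> * \<sigma> d)"
        unfolding sd by (simp add: q_add1 q_add2 qxy d_def algebra_simps)
      then show "\<sigma> a * q (x + y) (x + y) * a \<in> \<Lambda>" using Ladd Lmin x y by simp
    qed
    show "\<exists>c. \<forall>a. \<sigma> a * q (y + smul c x) (y + smul c x) * a \<in> \<Lambda>"
      if x: "\<forall>a. \<sigma> a * q x x * a \<in> \<Lambda>" and xy: "?om x y \<noteq> 0"
    proof (intro exI allI)
      \<comment> \<open>\<open>c\<close> solves \<open>q y y + \<sigma> c * ?om x y = 0\<close>.
        Substituting for \<open>q y y\<close> cancels the term with \<open>q x y\<close> and leaves
        \<open>q y x * c\<close> minus \<open>\<epsilon>\<close> times its conjugate, besides the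
        term with \<open>q x x\<close>; this works in every characteristic.\<close>
      define c where "c = \<sigma> (- q y y / ?om x y)"
      have sc: "\<sigma> c = - q y y / ?om x y" by (simp add: c_def ss)
      then have "q y y + \<sigma> c * ?om x y = 0" using xy by simp
      then have qyy: "q y y = - (\<sigma> c * (q x y + \<epsilon> * \<sigma> (q y x)))"
        by (simp add: omega_form_def eq_neg_iff_add_eq_0)
      fix a
      define d where "d = \<sigma> a * (q y x * c) * a"
      have sd: "\<sigma> d = \<sigma> a * (\<sigma> (q y x) * \<sigma> c) * a" by (simp add: d_def s_mult ss algebra_simps)
      have "\<sigma> a * q (y + smul c x) (y + smul c x) * a
          = \<sigma> a * (q y y + q y x * c + \<sigma> c * q x y) * a + \<sigma> (a * c) * q x x * (a * c)"
        by (simp add: q_add1 q_add2 q_sc q_sc1 q_sc2 s_mult algebra_simps)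
      also have "\<dots> = (d - \<epsilon> * \<sigma> d) + \<sigma> (a * c) * q x x * (a * c)"
        unfolding sd qyy by (simp add: d_def algebra_simps)
      finally show "\<sigma> a * q (y + smul c x) (y + smul c x) * a \<in> \<Lambda>"
        using Ladd[OF Lmin] x by metis
    qed
  qed
  then show thesis by (rule that)
qed

theorem theorem4p7:
  fixes \<sigma> :: "'k::field \<Rightarrow> 'k" and \<epsilon> :: 'k and \<Lambda> :: "'k set"
    and smul :: "'k \<Rightarrow> 'v::ab_group_add \<Rightarrow> 'v" and q :: "'v \<Rightarrow> 'v \<Rightarrow> 'k"
    and U :: "'v set"
  assumes "formed_space \<sigma> \<epsilon> \<Lambda> smul q"
    and "U \<in> P_omega \<sigma> \<epsilon> \<Lambda> smul q"
  shows "cohen_macaulay (P_omega_rel \<sigma> \<epsilon> \<Lambda> smul q U)"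
proof -
  obtain B where B: "isotropic_geometry smul B (omega_form \<sigma> \<epsilon> q) (\<lambda>v. \<forall>a. \<sigma> a * q v v * a \<in> \<Lambda>)"
    using formed_space_isotropic_geometry[OF assms(1)] by blast
  interpret isotropic_geometry smul B "omega_form \<sigma> \<epsilon> q" "\<lambda>v. \<forall>a. \<sigma> a * q v v * a \<in> \<Lambda>" by (rule B)
  have s1: "\<sigma> 1 = 1" and q_sc: "q (smul a v) (smul b w) = \<sigma> a * q v w * b" for v w a b
    using assms(1) by (auto simp: formed_space_def form_parameters_def sesquilinear_def)
  \<comment> \<open>On a subspace, testing every vector tests every line.\<close>
  have iso_iff: "isotropic \<sigma> \<epsilon> \<Lambda> q W \<longleftrightarrow> iso W" if W: "subspace W" for W
  proof -
    have "(\<forall>v\<in>W. q v v \<in> \<Lambda>) \<longleftrightarrow> (\<forall>v\<in>W. \<forall>a. \<sigma> a * q v v * a \<in> \<Lambda>)"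
    proof
      assume *: "\<forall>v\<in>W. q v v \<in> \<Lambda>"
      show "\<forall>v\<in>W. \<forall>a. \<sigma> a * q v v * a \<in> \<Lambda>"
        using * subspace_scale[OF W] by (simp flip: q_sc)
    next
      assume *: "\<forall>v\<in>W. \<forall>a. \<sigma> a * q v v * a \<in> \<Lambda>"
      show "\<forall>v\<in>W. q v v \<in> \<Lambda>"
      proof
        fix v assume "v \<in> W"
        then have "\<sigma> 1 * q v v * 1 \<in> \<Lambda>" using * by blast
        then show "q v v \<in> \<Lambda>" by (simp add: s1)
      qed
    qed
    then show ?thesis using W by (simp add: isotropic_def iso_def Q_zero_def)
  qed
  have U: "subspace U" "isotropic \<sigma> \<epsilon> \<Lambda> q U" "radical \<sigma> \<epsilon> \<Lambda> q \<subset> U"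
    using assms(2) by (auto simp: P_omega_def)
  have iU: "iso U" using U iso_iff by blast
  \<comment> \<open>The radical tests single vectors, \<open>R\<close> whole lines. The two agree
    because the radical lies in \<open>U\<close>, a subspace on which the form vanishes.\<close>
  have rad: "radical \<sigma> \<epsilon> \<Lambda> q = R"
  proof (intro equalityI subsetI)
    fix v assume v: "v \<in> radical \<sigma> \<epsilon> \<Lambda> q"
    then have "v \<in> U" using U(3) by blast
    then show "v \<in> R" using v isoD(3)[OF iU] by (auto simp: R_def radical_def K_def K_space_def)
  next
    fix v assume v: "v \<in> R"
    then have "\<sigma> 1 * q v v * 1 \<in> \<Lambda>" unfolding R_def by blast
    then show "v \<in> radical \<sigma> \<epsilon> \<Lambda> q"
      using v by (simp add: R_def radical_def K_def K_space_def Q_zero_def s1)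
  qed
  have RU: "R \<subset> U" using U(3) rad by simp
  \<comment> \<open>\<open>W = R\<close> would make \<open>orth W\<close> the whole space, and
    \<open>W = UNIV\<close> would make \<open>R\<close> the whole space; both contradict that
    \<open>R\<close> is properly contained in \<open>U\<close>.\<close>
  have proper: "R \<subset> W \<and> W \<subset> UNIV" if W: "W \<in> opposite U" for W
  proof -
    have WI: "iso W" "R \<subseteq> W" "orth W \<inter> U \<subseteq> R" using W by (auto simp: opposite_def)
    have "R \<noteq> W"
    proof
      assume "R = W"
      then have "orth W = UNIV" using R_subset_K subset_orth_commute[of UNIV W] by (auto simp: K_eq_orth)
      then show False using WI(3) RU by blast
    qed
    moreover have "W \<noteq> UNIV"
    proof
      assume "W = UNIV"
      then have "UNIV \<subseteq> R" unfolding R_def K_def using isoD(2,3)[OF WI(1)] by blast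
      then show False using RU by blast
    qed
    ultimately show ?thesis using WI(2) by blast
  qed
  have "P_omega_rel \<sigma> \<epsilon> \<Lambda> smul q U = {W. subspace W \<and> iso W \<and> R \<subset> W \<and> W \<subset> UNIV \<and> ssum W (orth U) = UNIV}"
    using iso_iff rad by (auto simp: P_omega_rel_def P_omega_def ssum_def orth_def perp_def)
  also have "\<dots> = opposite U"
  proof (intro equalityI subsetI)
    fix W assume "W \<in> {W. subspace W \<and> iso W \<and> R \<subset> W \<and> W \<subset> UNIV \<and> ssum W (orth U) = UNIV}"
    then show "W \<in> opposite U" using opposite_iff_ssum[OF iU, of W] by blast
  next
    fix W assume W: "W \<in> opposite U"
    then have "iso W" "R \<subseteq> W" by (auto simp: opposite_def)
    then show "W \<in> {W. subspace W \<and> iso W \<and> R \<subset> W \<and> W \<subset> UNIV \<and> ssum W (orth U) = UNIV}"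
      using proper[OF W] opposite_iff_ssum[OF iU] W isoD(1)[of W] by blast
  qed
  finally show ?thesis using cohen_macaulay_opposite[OF iU RU] by simp
qed

end
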